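(* For every $n\ge 1$ there is a positive-definite measure $\mu$ on $\mathbb{R}^n$, of the form $\mu=\sum_{\lambda\in\Lambda}\mu(\lambda)\delta_\lambda$ with $\Lambda\subset\mathbb{R}^n$ a discrete set and $\mu(\lambda)\neq 0$ for all $\lambda\in\Lambda$, whose Fourier transform is a slowly increasing, purely atomic measure $\hat\mu=\sum_{s\in S}\hat\mu(s)\delta_s$ with $S$ countable and $\hat\mu(s)\neq 0$ for all $s\in S$, such that: (i) $\Lambda$ is not contained in a finite union of translates of any lattice; (ii) the set $\Lambda-\Lambda$ is uniformly discrete; (iii) $S$ is a nowhere dense (countable) set in $\mathbb{R}^n$.
   Context: A "measure" on $\mathbb{R}^n$ means a complex, locally finite measure $\mu$ that is slowly increasing: there is $N$ with $|\mu|(\{|x|<R\})=O(R^N)$ as $R\to\infty$. Such a measure is a temperate distribution, and $\hat\mu$ denotes its distributional Fourier transform, $\langle\hat\mu,\varphi\rangle=\langle\mu,\hat\varphi\rangle$ for Schwartz $\varphi$, with $\hat\varphi(t)=\int\varphi(x)e^{-2\pi i\langle t,x\rangle}dx$. A measure is positive-definite if its Fourier transform is a positive distribution (nonnegative on nonnegative Schwartz functions). $\delta_x$ is the unit point mass at $x$. $\Lambda-\Lambda=\{\lambda-\lambda':\lambda,\lambda'\in\Lambda\}$. A set $A\subset\mathbb{R}^n$ is uniformly discrete if $\inf\{|x-y|:x,y\in A,\ x\neq y\}>0$. A lattice is the image of $\mathbb{Z}^n$ under an invertible linear map of $\mathbb{R}^n$. *)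

theory Defs
  imports "HOL-Analysis.Analysis"
begin

section \<open>Locally finite complex measures\<close>

text \<open>A locally finite complex measure is a complex-valued set function, countably additive on
  the bounded Borel sets. Its values on all other sets are never used (a locally finite
  complex measure need not have a value on an unbounded set). Finiteness of the variation on bounded sets is
  automatic.\<close>

definition complex_measure :: "('a::euclidean_space set \<Rightarrow> complex) \<Rightarrow> bool" where
  "complex_measure \<mu> \<longleftrightarrow>
     (\<forall>A :: nat \<Rightarrow> 'a set. range A \<subseteq> sets borel \<longrightarrow> disjoint_family A \<longrightarrow> bounded (\<Union>i. A i) \<longrightarrow>
        (\<lambda>i. \<mu> (A i)) sums \<mu> (\<Union>i. A i))"

text \<open>The total variation \<open>|\<mu>|\<close>, a positive Borel measure: the supremum over countable Borel
  partitions. The pieces are bounded, so that unbounded sets are covered as well.\<close>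

definition variation :: "('a::euclidean_space set \<Rightarrow> complex) \<Rightarrow> 'a measure" where
  "variation \<mu> = measure_of UNIV (sets borel)
     (\<lambda>B. SUP E \<in> {E :: nat \<Rightarrow> 'a set. range E \<subseteq> sets borel \<and> disjoint_family E \<and>
                     (\<forall>i. bounded (E i)) \<and> (\<Union>i. E i) = B}.
            (\<Sum>i. ennreal (cmod (\<mu> (E i)))))"

text \<open>The polar decomposition \<open>d\<mu> = h d|\<mu>|\<close> with \<open>|h| = 1\<close>. The density exists and is unique up to
  a set of \<open>|\<mu>|\<close>-measure zero, so the integral below does not depend on the choice.\<close>

definition polar_density :: "('a::euclidean_space set \<Rightarrow> complex) \<Rightarrow> 'a \<Rightarrow> complex" where
  "polar_density \<mu> = (SOME h. h \<in> borel_measurable borel \<and> (\<forall>x. cmod (h x) = 1) \<and>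
     (\<forall>B \<in> sets borel. bounded B \<longrightarrow> \<mu> B = set_lebesgue_integral (variation \<mu>) B h))"

definition cintegral :: "('a::euclidean_space set \<Rightarrow> complex) \<Rightarrow> ('a \<Rightarrow> complex) \<Rightarrow> complex" where
  "cintegral \<mu> f = (\<integral>x. f x * polar_density \<mu> x \<partial>variation \<mu>)"

definition slowly_increasing :: "('a::euclidean_space set \<Rightarrow> complex) \<Rightarrow> bool" where
  "slowly_increasing \<mu> \<longleftrightarrow>
     (\<exists>(N::nat) (C::real). \<forall>\<^sub>F R in at_top.
        emeasure (variation \<mu>) {x. norm x < R} \<le> ennreal (C * R ^ N))"

definition temperate_measure :: "('a::euclidean_space set \<Rightarrow> complex) \<Rightarrow> bool" where
  "temperate_measure \<mu> \<longleftrightarrow> complex_measure \<mu> \<and> slowly_increasing \<mu>"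

text \<open>\<open>\<mu> = (\<Sum>x\<in>A. \<mu>(x) \<delta>\<^sub>x)\<close> with \<open>\<mu>(x) \<noteq> 0\<close> for \<open>x \<in> A\<close>, where \<open>\<mu>(x)\<close> is the mass of the
  point \<open>x\<close>. The sum over \<open>A \<inter> B\<close> is unordered, hence absolutely convergent.\<close>

definition atomic_on :: "('a::euclidean_space set \<Rightarrow> complex) \<Rightarrow> 'a set \<Rightarrow> bool" where
  "atomic_on \<mu> A \<longleftrightarrow> (\<forall>x\<in>A. \<mu> {x} \<noteq> 0) \<and>
     (\<forall>B \<in> sets borel. bounded B \<longrightarrow> ((\<lambda>x. \<mu> {x}) has_sum \<mu> B) (A \<inter> B))"


section \<open>Schwartz functions and the Fourier transform\<close>

fun iterated_deriv :: "'a::euclidean_space list \<Rightarrow> ('a \<Rightarrow> complex) \<Rightarrow> 'a \<Rightarrow> complex" where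
  "iterated_deriv [] f = f"
| "iterated_deriv (v # vs) f = (\<lambda>x. frechet_derivative (iterated_deriv vs f) (at x) v)"

definition schwartz :: "('a::euclidean_space \<Rightarrow> complex) \<Rightarrow> bool" where
  "schwartz f \<longleftrightarrow> (\<forall>vs. set vs \<subseteq> Basis \<longrightarrow>
     iterated_deriv vs f differentiable_on UNIV \<and>
     (\<forall>k::nat. bounded (range (\<lambda>x. norm x ^ k *\<^sub>R iterated_deriv vs f x))))"

definition fourier :: "('a::euclidean_space \<Rightarrow> complex) \<Rightarrow> 'a \<Rightarrow> complex" where
  "fourier \<phi> t = (\<integral>x. \<phi> x * exp (- 2 * of_real pi * \<i> * of_real (t \<bullet> x)) \<partial>lborel)"

text \<open>The distributional Fourier transform of \<open>\<mu>\<close>, as a functional on Schwartz functions.\<close>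

definition fourier_distr ::
    "('a::euclidean_space set \<Rightarrow> complex) \<Rightarrow> ('a \<Rightarrow> complex) \<Rightarrow> complex" where
  "fourier_distr \<mu> \<phi> = cintegral \<mu> (fourier \<phi>)"

definition positive_definite :: "('a::euclidean_space set \<Rightarrow> complex) \<Rightarrow> bool" where
  "positive_definite \<mu> \<longleftrightarrow>
     (\<forall>\<phi>. schwartz \<phi> \<and> (\<forall>x. \<phi> x \<in> \<real>\<^sub>\<ge>\<^sub>0) \<longrightarrow> fourier_distr \<mu> \<phi> \<in> \<real>\<^sub>\<ge>\<^sub>0)"

definition has_fourier_transform ::
    "('a::euclidean_space set \<Rightarrow> complex) \<Rightarrow> ('a set \<Rightarrow> complex) \<Rightarrow> bool" where
  "has_fourier_transform \<mu> \<nu> \<longleftrightarrow> (\<forall>\<phi>. schwartz \<phi> \<longrightarrow> fourier_distr \<mu> \<phi> = cintegral \<nu> \<phi>)"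


section \<open>Lattices\<close>

definition euclidean_lattice :: "(real ^ 'n) set \<Rightarrow> bool" where
  "euclidean_lattice L \<longleftrightarrow>
     (\<exists>T :: real ^ 'n \<Rightarrow> real ^ 'n. linear T \<and> bij T \<and> L = T ` {k. \<forall>i. k $ i \<in> \<int>})"

end

theory Submission
  imports Defs "HOL-Probability.Characteristic_Functions" "HOL-Analysis.Kronecker_Approximation_Theorem"
begin

text \<open>
A model set with one-dimensional internal space in each coordinate: the points \<open>r - \<tau> p\<close> with
  \<open>p, r \<in> \<int>\<^sup>n\<close>, \<open>\<tau>\<close> irrational, carry the mass \<open>fourier \<Phi> (p + \<tau> r)\<close>. By Poisson summation in
  \<open>2n\<close> dimensions the Fourier transform is carried by the same module, scaled by \<open>1 / (1 + \<tau>\<^sup>2)\<close>, with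
  the nonnegative masses \<open>\<Phi>\<close> of the conjugate coordinate. If \<open>\<Phi>\<close> is band-limited, the support
  is a Meyer set. To make the spectrum nowhere dense, \<open>\<Phi>\<close> is an infinite product of squared
  band-limited functions, each vanishing at the conjugates of all spectral points in some tiny interval
  \<open>I\<close>. These conjugates are as sparse as one likes when \<open>I\<close> is short, so such a function is a
  small perturbation \<open>1 - (\<Sum>v. c v * nsinc (e * (t - v))\<^sup>2)\<close> of \<open>1\<close>, the \<open>c v\<close> being found from a
  diagonally dominant linear system.
\<close>

section \<open>Atomic measures\<close>

text \<open>The difficulty is that (ii) and (iii) pull against each other. Uniform discreteness of
  \<open>\<Lambda> - \<Lambda>\<close> comes from a bounded internal window for
  \<open>\<mu>\<close>, so \<open>\<Phi>\<close> is band-limited, hence the restriction of an entire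
  function, and cannot vanish on an interval without being 0. Cutting a window on the spectral side
  is therefore impossible, although the unthinned spectrum is a dense module. Only discrete sets of
  conjugates can be removed. Bandwidths of the factors add up, so they are taken summable; the
  cleared intervals are found inside all rational ones, which makes the gaps dense. Squaring the
  factors gives \<open>\<Phi> \<ge> 0\<close>, and this is what makes \<open>\<mu>\<close>
  positive-definite. The factors are bounded but close to 1 only up to some radius; radii growing
  geometrically keep the product below a quadratic polynomial, which a fixed power of the sinc
  absorbs. In several dimensions a tensor power of \<open>\<Phi>\<close> is used: a zero in one
  coordinate clears a whole slab.\<close>

definition atomic_measure :: "'a::euclidean_space set \<Rightarrow> ('a \<Rightarrow> complex) \<Rightarrow> 'a set \<Rightarrow> complex" where
  "atomic_measure A a B = (\<integral>x. a x \<partial>count_space (A \<inter> B))"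

text \<open>\<open>distr\<close> along the inclusion trades the discrete sigma-algebra of
  \<open>count_space A\<close> for the Borel sets, so that equality with \<open>variation\<close>
  makes sense.\<close>

definition atomic_variation :: "'a::euclidean_space set \<Rightarrow> ('a \<Rightarrow> complex) \<Rightarrow> 'a measure" where
  "atomic_variation A a = distr (density (count_space A) (\<lambda>x. ennreal (cmod (a x)))) borel (\<lambda>x. x)"

lemma sets_atomic_variation [simp]: "sets (atomic_variation A a) = sets borel"
  by (simp add: atomic_variation_def)

lemma space_atomic_variation [simp]: "space (atomic_variation A a) = UNIV"
  by (simp add: atomic_variation_def)

lemma emeasure_atomic_variation:
  assumes "B \<in> sets borel"
  shows "emeasure (atomic_variation A a) B = (\<integral>\<^sup>+x. ennreal (cmod (a x)) \<partial>count_space (A \<inter> B))"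
proof -
  have "emeasure (atomic_variation A a) B
      = emeasure (density (count_space A) (\<lambda>x. ennreal (cmod (a x)))) (A \<inter> B)"
    unfolding atomic_variation_def using assms
    by (subst emeasure_distr) (auto simp: Int_commute vimage_def)
  also have "\<dots> = (\<integral>\<^sup>+x. ennreal (cmod (a x)) * indicator (A \<inter> B) x \<partial>count_space A)"
    by (subst emeasure_density) auto
  also have "\<dots> = (\<integral>\<^sup>+x. ennreal (cmod (a x)) \<partial>count_space (A \<inter> B))"
    by (simp add: nn_integral_restrict_space[symmetric] restrict_count_space Int_commute Int_left_commute)
  finally show ?thesis .
qed

lemma norm_integral_le_nn:
  fixes f :: "'b \<Rightarrow> complex"
  shows "ennreal (cmod (\<integral>x. f x \<partial>M)) \<le> (\<integral>\<^sup>+x. ennreal (cmod (f x)) \<partial>M)"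
  by (cases "integrable M f") (auto simp: integral_norm_bound_ennreal not_integrable_integral_eq)

text \<open>On a piece with at most one atom nothing can cancel, so such a partition attains the
  supremum in \<open>variation\<close>. The atom-free rest has to be cut up as well, since pieces
  must be bounded.\<close>

lemma exists_atom_partition:
  fixes A :: "'a::euclidean_space set"
  assumes A: "countable A" and B: "B \<in> sets borel"
  obtains E :: "nat \<Rightarrow> 'a set" where "range E \<subseteq> sets borel" "disjoint_family E"
    "\<And>i. bounded (E i)" "(\<Union>i. E i) = B" "\<And>i. \<exists>x. A \<inter> E i \<subseteq> {x}"
proof -
  \<comment> \<open>Even indices carry single atoms, numbered by \<open>to_nat_on A\<close>; odd
    indices carry the integer shells of the atom-free rest.\<close>
  define E where "E i = (if even i then {x \<in> A \<inter> B. to_nat_on A x = i div 2}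
      else {x \<in> B - A. nat \<lfloor>norm x\<rfloor> = i div 2})" for i
  have sub: "\<exists>x. {x \<in> A \<inter> B. to_nat_on A x = k} \<subseteq> {x}" for k
  proof (cases "{x \<in> A \<inter> B. to_nat_on A x = k} = {}")
    case False
    then obtain x where "x \<in> {x \<in> A \<inter> B. to_nat_on A x = k}" by auto
    then show ?thesis using to_nat_on_inj[OF A] by (intro exI[of _ x]) auto
  qed auto
  have fin: "finite {x \<in> A \<inter> B. to_nat_on A x = k}" for k
    using sub[of k] by (meson finite.emptyI finite_insert finite_subset)
  have Ab: "A \<in> sets borel" using A by (rule sets.countable[rotated]) auto 
  show thesis
  proof
    show "range E \<subseteq> sets borel"
    proof safe
      fix i
      have m: "{x \<in> B - A. nat \<lfloor>norm x\<rfloor> = k} \<in> sets borel" for k :: nat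
      proof -
        have "{x \<in> space borel. nat \<lfloor>norm (x::'a)\<rfloor> = k} \<in> sets borel" by measurable
        then have "{x \<in> space borel. nat \<lfloor>norm (x::'a)\<rfloor> = k} \<inter> (B - A) \<in> sets borel"
          using Ab B by blast
        also have "{x \<in> space borel. nat \<lfloor>norm (x::'a)\<rfloor> = k} \<inter> (B - A) = {x \<in> B - A. nat \<lfloor>norm x\<rfloor> = k}" by auto
        finally show ?thesis .
      qed
      show "E i \<in> sets borel"
        unfolding E_def using m fin by (auto intro!: borel_closed finite_imp_closed)
    qed
    show "disjoint_family E"
      unfolding disjoint_family_on_def
    proof safe
      fix i j x assume "i \<noteq> j" "x \<in> E i" "x \<in> E j"
      then have "even i = even j" "i div 2 = j div 2"
        by (auto simp: E_def split: if_splits)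
      then have "i = j" by presburger
      then show "x \<in> {}" using \<open>i \<noteq> j\<close> by simp
    qed
    show "bounded (E i)" for i
    proof (cases "even i")
      case True then show ?thesis unfolding E_def using fin by (auto intro: finite_imp_bounded)
    next
      case False
      have "norm x \<le> real (i div 2) + 1" if "x \<in> E i" for x
        using that False unfolding E_def by (auto, linarith)
      then show ?thesis by (auto simp: bounded_iff)
    qed
    show "(\<Union>i. E i) = B"
    proof safe
      fix x i assume "x \<in> E i" then show "x \<in> B" by (auto simp: E_def split: if_splits)
    next
      fix x assume "x \<in> B"
      show "x \<in> (\<Union>i. E i)"
      proof (cases "x \<in> A")
        case True
        then have "x \<in> E (2 * to_nat_on A x)" using \<open>x \<in> B\<close> by (auto simp: E_def)
        then show ?thesis by blast
      next
        case False
        then have "x \<in> E (2 * nat \<lfloor>norm x\<rfloor> + 1)" using \<open>x \<in> B\<close> by (auto simp: E_def)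
        then show ?thesis by blast
      qed
    qed
    show "\<exists>x. A \<inter> E i \<subseteq> {x}" for i
      using sub[of "i div 2"] by (cases "even i") (auto simp: E_def)
  qed
qed

text \<open>The triangle inequality bounds every partition sum by the sum of the moduli, and the
  partition into single atoms attains this bound.\<close>

lemma variation_atomic_measure:
  assumes A: "countable A"
  shows "variation (atomic_measure A a) = atomic_variation A a"
proof -
  let ?N = "atomic_variation A a"
  have eq: "(SUP E \<in> {E :: nat \<Rightarrow> 'a set. range E \<subseteq> sets borel \<and> disjoint_family E \<and>
                     (\<forall>i. bounded (E i)) \<and> (\<Union>i. E i) = B}.
            (\<Sum>i. ennreal (cmod (atomic_measure A a (E i))))) = emeasure ?N B" (is "Sup (?g ` ?P) = _")
    if B: "B \<in> sets borel" for B
  proof (rule antisym)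
    show "Sup (?g ` ?P) \<le> emeasure ?N B"
    proof (rule SUP_least)
      fix E assume E: "E \<in> ?P"
      have "?g E \<le> (\<Sum>i. emeasure ?N (E i))"
      proof (rule suminf_le)
        fix i have "E i \<in> sets borel" using E by auto
        then show "ennreal (cmod (atomic_measure A a (E i))) \<le> emeasure ?N (E i)"
          by (simp add: emeasure_atomic_variation atomic_measure_def norm_integral_le_nn)
      qed auto
      also have "\<dots> = emeasure ?N B" using E by (subst suminf_emeasure) auto
      finally show "?g E \<le> emeasure ?N B" .
    qed
    obtain E :: "nat \<Rightarrow> 'a set" where E: "range E \<subseteq> sets borel" "disjoint_family E"
    "\<And>i. bounded (E i)" "(\<Union>i. E i) = B" "\<And>i. \<exists>x. A \<inter> E i \<subseteq> {x}"
      by (rule exists_atom_partition[OF A B]) (rule that)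
    have "emeasure ?N B = (\<Sum>i. emeasure ?N (E i))" using E by (subst suminf_emeasure) auto
    also have "\<dots> = ?g E"
    proof (rule suminf_cong)
      fix i
      obtain x where x: "A \<inter> E i \<subseteq> {x}" using E by blast
      have i: "E i \<in> sets borel" using E by auto
      from x consider "A \<inter> E i = {}" | "A \<inter> E i = {x}" by blast
      then show "emeasure ?N (E i) = ennreal (cmod (atomic_measure A a (E i)))"
        using i by cases (simp_all add: emeasure_atomic_variation atomic_measure_def 
            lebesgue_integral_count_space_finite nn_integral_count_space_finite)
    qed
    finally show "emeasure ?N B \<le> Sup (?g ` ?P)"
      using E by (auto intro: SUP_upper)
  qed
  have "variation (atomic_measure A a) = measure_of UNIV (sets borel) (emeasure ?N)"
    unfolding variation_def
    by (rule measure_of_eq) (auto simp: eq sets.sigma_sets_eq[of borel, simplified])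
  also have "\<dots> = ?N" using measure_of_of_measure[of ?N] by simp
  finally show ?thesis .
qed


text \<open>A product of one-dimensional Cauchy profiles rather than a power of the norm: this makes
  it integrable, multiplicative on pairs and, up to constants, stable under bounded translations. It
  measures growth and decay throughout, mostly squared because the passage to the rotated
  coordinates of a pair spends one power.\<close>

definition weight :: "'a::euclidean_space \<Rightarrow> real" where
  "weight x = (\<Prod>b\<in>Basis. 1 / (1 + (x \<bullet> b)\<^sup>2))"

lemma weight_pos: "weight x > 0"
  unfolding weight_def by (intro prod_pos) (auto intro!: divide_pos_pos add_pos_nonneg)

lemma weight_le_1: "weight x \<le> 1"
  unfolding weight_def by (intro prod_le_1) (auto simp: divide_le_eq_1_pos add_pos_nonneg)

lemma weight_lower: "weight (x::'a::euclidean_space) \<ge> 1 / (1 + (norm x)\<^sup>2) ^ DIM('a)"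
proof -
  have "(\<Prod>b\<in>(Basis::'a set). 1 / (1 + (norm x)\<^sup>2)) \<le> weight x"
    unfolding weight_def
  proof (intro prod_mono conjI)
    fix b :: 'a assume "b \<in> Basis"
    then have "(x \<bullet> b)\<^sup>2 \<le> (norm x)\<^sup>2" using Basis_le_norm[of b x] abs_le_square_iff[of "x \<bullet> b" "norm x"] by simp
    then show "1 / (1 + (norm x)\<^sup>2) \<le> 1 / (1 + (x \<bullet> b)\<^sup>2)"
      by (intro divide_left_mono mult_pos_pos add_pos_nonneg) auto
  qed auto
  then show ?thesis by (simp add: power_one_over)
qed

lemma weight_Sup_norm:
  fixes x :: "'a::euclidean_space"
  assumes "norm x \<le> R"
  shows "1 \<le> (1 + R\<^sup>2) ^ (2 * DIM('a)) * (weight x)\<^sup>2"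
proof -
  have "(norm x)\<^sup>2 \<le> R\<^sup>2" using assms by (intro power_mono) auto
  then have "(1 + (norm x)\<^sup>2) ^ DIM('a) \<le> (1 + R\<^sup>2) ^ DIM('a)" by (intro power_mono) auto
  moreover have "1 \<le> (1 + (norm x)\<^sup>2) ^ DIM('a) * weight x"
    using weight_lower[of x] by (simp add: field_simps add_pos_nonneg)
  ultimately have "1 \<le> (1 + R\<^sup>2) ^ DIM('a) * weight x"
    using weight_pos[of x] by (meson less_imp_le mult_right_mono order_trans)
  then have "1 \<le> ((1 + R\<^sup>2) ^ DIM('a) * weight x)\<^sup>2" by (simp add: one_le_power)
  then show ?thesis by (simp add: power_mult_distrib power_mult[symmetric] mult.commute)
qed

context
  fixes A :: "'a::euclidean_space set" and a :: "'a \<Rightarrow> complex"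
  assumes countable: "countable A"
    and weighted: "integrable (count_space A) (\<lambda>x. a x * of_real ((weight x)\<^sup>2))"
begin

text \<open>On the ball the weight is at least \<open>1 / (1 + R\<^sup>2) ^ DIM('a)\<close>, so
  weighted summability controls mass with polynomial loss. Local finiteness and slow growth both
  come from here.\<close>

lemma nn_integral_ball_le:
  assumes "B \<subseteq> cball 0 R"
  shows "(\<integral>\<^sup>+x. ennreal (cmod (a x)) \<partial>count_space (A \<inter> B))
    \<le> ennreal ((\<integral>x. cmod (a x) * (weight x)\<^sup>2 \<partial>count_space A) * (1 + R\<^sup>2) ^ (2 * DIM('a)))"
proof -
  let ?C = "(1 + R\<^sup>2) ^ (2 * DIM('a))"
  have int: "integrable (count_space A) (\<lambda>x. cmod (a x) * (weight x)\<^sup>2)"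
    using integrable_norm[OF weighted] by (simp add: norm_mult norm_power)
  have "(\<integral>\<^sup>+x. ennreal (cmod (a x)) \<partial>count_space (A \<inter> B))
      = (\<integral>\<^sup>+x. ennreal (cmod (a x)) * indicator B x \<partial>count_space A)"
    by (simp add: nn_integral_restrict_space[symmetric] restrict_count_space Int_commute)
  also have "\<dots> \<le> (\<integral>\<^sup>+x. ennreal (cmod (a x) * (weight x)\<^sup>2 * ?C) \<partial>count_space A)"
  proof (intro nn_integral_mono)
    fix x
    show "ennreal (cmod (a x)) * indicator B x \<le> ennreal (cmod (a x) * (weight x)\<^sup>2 * ?C)"
    proof (cases "x \<in> B")
      case True
      then have "norm x \<le> R" using assms by auto
      from mult_left_mono[OF weight_Sup_norm[OF this], of "cmod (a x)"]
      show ?thesis using True by (auto intro!: ennreal_leI simp: mult_ac)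
    qed auto
  qed
  also have "\<dots> = ennreal (\<integral>x. cmod (a x) * (weight x)\<^sup>2 * ?C \<partial>count_space A)"
    by (intro nn_integral_eq_integral integrable_mult_left int) auto
  finally show ?thesis by simp
qed

lemma integrable_bounded_part:
  assumes "bounded B"
  shows "integrable (count_space (A \<inter> B)) a"
proof -
  obtain R where "B \<subseteq> cball 0 R" using assms by (auto simp: bounded_iff subset_iff)
  from nn_integral_ball_le[OF this] show ?thesis
    by (auto simp: integrable_iff_bounded intro: le_less_trans)
qed

lemma set_integrable_bounded_part:
  assumes "bounded B"
  shows "set_integrable (count_space A) B a"
  using integrable_bounded_part[OF assms]
  unfolding set_integrable_def
  by (subst integrable_restrict_space[symmetric]) (auto simp: restrict_count_space Int_commute)

lemma atomic_measure_eq_set_integral: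
  "atomic_measure A a B = set_lebesgue_integral (count_space A) B a"
  unfolding set_lebesgue_integral_def atomic_measure_def
  by (subst integral_restrict_space[symmetric]) (auto simp: restrict_count_space Int_commute)

lemma complex_measure_atomic_measure: "complex_measure (atomic_measure A a)"
  unfolding complex_measure_def
proof (intro allI impI)
  fix B :: "nat \<Rightarrow> 'a set"
  assume B: "range B \<subseteq> sets borel" "disjoint_family B" "bounded (\<Union>i. B i)"
  let ?N = "atomic_variation A a"
  have fin: "emeasure ?N (\<Union>i. B i) \<noteq> \<infinity>"
    using integrable_bounded_part[OF B(3)] B(1)
    by (subst emeasure_atomic_variation) (auto simp: integrable_iff_bounded)
  have "summable (\<lambda>i. measure ?N (B i))"
    using B(1,2) fin by (intro sums_summable[OF measure_UNION]) auto
  moreover have "cmod (atomic_measure A a (B i)) \<le> measure ?N (B i)" for i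
  proof -
    have i: "B i \<in> sets borel" using B(1) by auto
    have "bounded (B i)" using B(3) by (meson UN_upper UNIV_I bounded_subset)
    then have f: "emeasure ?N (B i) < \<infinity>"
      using integrable_bounded_part[of "B i"] i
      by (subst emeasure_atomic_variation) (auto simp: integrable_iff_bounded)
    have "ennreal (cmod (atomic_measure A a (B i))) \<le> emeasure ?N (B i)"
      unfolding emeasure_atomic_variation[OF i] atomic_measure_def by (rule norm_integral_le_nn)
    then show ?thesis using f by (simp add: emeasure_eq_ennreal_measure)
  qed
  ultimately have "summable (\<lambda>i. atomic_measure A a (B i))"
    by (rule summable_comparison_test')
  moreover have "atomic_measure A a (\<Union>i. B i) = (\<Sum>i. atomic_measure A a (B i))"
  proof -
    \<comment> \<open>The measurable sets of \<open>count_space A\<close> are the subsets of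
      \<open>A\<close>, so the pieces are cut down to \<open>A\<close> before countable additivity
      is applied.\<close>
    have eq: "atomic_measure A a C = set_lebesgue_integral (count_space A) (A \<inter> C) a" for C
      unfolding set_lebesgue_integral_def atomic_measure_eq_set_integral
      by (intro Bochner_Integration.integral_cong) (auto split: split_indicator)
    have "set_integrable (count_space A) (\<Union>i. A \<inter> B i) a"
      using set_integrable_bounded_part[OF B(3)] by (rule set_integrable_subset) auto
    then have "set_lebesgue_integral (count_space A) (\<Union>i. A \<inter> B i) a
      = (\<Sum>i. set_lebesgue_integral (count_space A) (A \<inter> B i) a)"
      using B(2) by (intro lebesgue_integral_countable_add) (auto simp: disjoint_family_on_def)
    then show ?thesis unfolding eq Int_UN_distrib .
  qed
  ultimately show "(\<lambda>i. atomic_measure A a (B i)) sums atomic_measure A a (\<Union>i. B i)"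
    by (simp add: summable_sums)
qed

lemma emeasure_variation_ball:
  "emeasure (variation (atomic_measure A a)) {x. norm x < R}
    \<le> ennreal ((\<integral>x. cmod (a x) * (weight x)\<^sup>2 \<partial>count_space A) * (1 + R\<^sup>2) ^ (2 * DIM('a)))"
proof -
  have "{x::'a. norm x < R} = ball 0 R" by (auto)
  then have "{x::'a. norm x < R} \<in> sets borel" by simp
  then show ?thesis
    by (auto simp: variation_atomic_measure[OF countable] emeasure_atomic_variation intro!: nn_integral_ball_le)
qed

lemma temperate_atomic_measure: "temperate_measure (atomic_measure A a)"
  unfolding temperate_measure_def slowly_increasing_def
proof (intro conjI complex_measure_atomic_measure exI)
  define M where "M = (\<integral>x. cmod (a x) * (weight x)\<^sup>2 \<partial>count_space A)"
  have M: "M \<ge> 0" unfolding M_def by (intro Bochner_Integration.integral_nonneg) auto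
  show "\<forall>\<^sub>F R in at_top. emeasure (variation (atomic_measure A a)) {x. norm x < R}
      \<le> ennreal (M * 2 ^ (2 * DIM('a)) * R ^ (2 * (2 * DIM('a))))"
  proof (rule eventually_at_top_linorderI[of 1])
    fix R :: real assume R: "1 \<le> R"
    then have "1 + R\<^sup>2 \<le> 2 * R\<^sup>2" by (simp add: one_le_power)
    then have "(1 + R\<^sup>2) ^ (2 * DIM('a)) \<le> (2 * R\<^sup>2) ^ (2 * DIM('a))"
      by (intro power_mono) auto
    also have "\<dots> = 2 ^ (2 * DIM('a)) * R ^ (2 * (2 * DIM('a)))"
      by (simp add: power_mult_distrib power_mult[symmetric])
    finally have "M * (1 + R\<^sup>2) ^ (2 * DIM('a)) \<le> M * 2 ^ (2 * DIM('a)) * R ^ (2 * (2 * DIM('a)))"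
      using M by (simp add: mult_left_mono mult.assoc)
    then show "emeasure (variation (atomic_measure A a)) {x. norm x < R}
        \<le> ennreal (M * 2 ^ (2 * DIM('a)) * R ^ (2 * (2 * DIM('a))))"
      using emeasure_variation_ball[of R] M_def by (meson ennreal_leI order_trans)
  qed
qed

lemma atomic_measure_singleton:
  assumes "x \<in> A"
  shows "atomic_measure A a {x} = a x"
proof -
  have "A \<inter> {x} = {x}" using assms by auto
  then show ?thesis by (simp add: atomic_measure_def lebesgue_integral_count_space_finite)
qed

lemma atomic_on_atomic_measure:
  assumes "\<And>x. x \<in> A \<Longrightarrow> a x \<noteq> 0"
  shows "atomic_on (atomic_measure A a) A"
  unfolding atomic_on_def
proof (intro conjI ballI impI)
  fix B :: "'a set" assume B: "bounded B"
  have i: "Infinite_Set_Sum.abs_summable_on a (A \<inter> B)"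
    unfolding Infinite_Set_Sum.abs_summable_on_def by (rule integrable_bounded_part[OF B])
  then have "(a has_sum infsetsum a (A \<inter> B)) (A \<inter> B)"
    by (metis abs_summable_equivalent abs_summable_summable has_sum_infsum infsetsum_infsum)
  then show "((\<lambda>x. atomic_measure A a {x}) has_sum atomic_measure A a B) (A \<inter> B)"
    by (subst has_sum_cong[of _ _ a]) (auto simp: atomic_measure_singleton infsetsum_def atomic_measure_def[of A a B])
qed (use assms in \<open>auto simp: atomic_measure_singleton\<close>)

lemma integral_atomic_variation:
  fixes f :: "'a \<Rightarrow> complex"
  assumes "f \<in> borel_measurable borel"
  shows "(\<integral>x. f x \<partial>atomic_variation A a) = (\<integral>x. cmod (a x) *\<^sub>R f x \<partial>count_space A)"
  unfolding atomic_variation_def using assms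
  by (subst integral_distr) (auto intro: integral_density)

text \<open>The polar density is a Hilbert choice, so only its defining property is available.
  Testing that property on singletons pins it down at atoms of nonzero mass, which is all that an
  integral sees.\<close>

lemma polar_density_atomic_measure:
  defines "h \<equiv> polar_density (atomic_measure A a)"
  shows "h \<in> borel_measurable borel" "x \<in> A \<Longrightarrow> cmod (a x) *\<^sub>R h x = a x"
proof -
  let ?P = "\<lambda>h. h \<in> borel_measurable borel \<and> (\<forall>x. cmod (h x) = 1) \<and>
     (\<forall>B \<in> sets borel. bounded B \<longrightarrow> atomic_measure A a B =
        set_lebesgue_integral (variation (atomic_measure A a)) B h)"
  \<comment> \<open>The value 1 off the atoms makes the witness unimodular everywhere, and Borel
    because it differs from a constant on a countable set only.\<close>
  define g where "g x = (if x \<in> A \<and> a x \<noteq> 0 then sgn (a x) else 1)" for x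
  have g: "g \<in> borel_measurable borel"
  proof (rule measurable_discrete_difference[of "\<lambda>_. 1" _ _ A])
    show "{x} \<in> sets borel" if "x \<in> A" for x using that by auto
  qed (use countable in \<open>auto simp: g_def\<close>)
  have eq: "set_lebesgue_integral (variation (atomic_measure A a)) B k
     = (\<integral>x. cmod (a x) *\<^sub>R k x \<partial>count_space (A \<inter> B))"
    if "B \<in> sets borel" "k \<in> borel_measurable borel" for B :: "'a set" and k :: "'a \<Rightarrow> complex"
  proof -
    have "set_lebesgue_integral (variation (atomic_measure A a)) B k
      = (\<integral>x. cmod (a x) *\<^sub>R (indicator B x *\<^sub>R k x) \<partial>count_space A)"
      unfolding set_lebesgue_integral_def variation_atomic_measure[OF countable]
      using that by (intro integral_atomic_variation) auto
    also have "\<dots> = (\<integral>x. indicator B x *\<^sub>R (cmod (a x) *\<^sub>R k x) \<partial>count_space A)"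
      by (simp add: mult_ac)
    also have "\<dots> = (\<integral>x. cmod (a x) *\<^sub>R k x \<partial>count_space (A \<inter> B))"
      by (subst integral_restrict_space[symmetric]) (auto simp: restrict_count_space Int_commute)
    finally show ?thesis .
  qed
  have "?P g"
  proof (intro conjI g allI ballI impI)
    show "cmod (g x) = 1" for x by (auto simp: g_def norm_sgn)
    fix B :: "'a set" assume B: "B \<in> sets borel"
    show "atomic_measure A a B = set_lebesgue_integral (variation (atomic_measure A a)) B g"
      unfolding eq[OF B g] atomic_measure_def
      by (intro Bochner_Integration.integral_cong) (auto simp: g_def sgn_eq scaleR_conv_of_real)
  qed
  then have h: "?P h" unfolding h_def polar_density_def by (rule someI[of ?P])
  then show "h \<in> borel_measurable borel" by blast
  assume x: "x \<in> A"
  have "a x = set_lebesgue_integral (variation (atomic_measure A a)) {x} h"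
    unfolding atomic_measure_singleton[OF x, symmetric] using h by auto
  also have "\<dots> = (\<integral>y. cmod (a y) *\<^sub>R h y \<partial>count_space (A \<inter> {x}))"
    using h by (intro eq) auto
  also have "A \<inter> {x} = {x}" using x by auto
  also have "(\<integral>y. cmod (a y) *\<^sub>R h y \<partial>count_space {x}) = cmod (a x) *\<^sub>R h x"
    by (simp add: lebesgue_integral_count_space_finite)
  finally show "cmod (a x) *\<^sub>R h x = a x" ..
qed

lemma cintegral_atomic_measure:
  assumes "f \<in> borel_measurable borel"
  shows "cintegral (atomic_measure A a) f = (\<integral>x. a x * f x \<partial>count_space A)"
proof -
  let ?h = "polar_density (atomic_measure A a)"
  have "cintegral (atomic_measure A a) f = (\<integral>x. cmod (a x) *\<^sub>R (f x * ?h x) \<partial>count_space A)"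
    unfolding cintegral_def variation_atomic_measure[OF countable]
    using assms polar_density_atomic_measure(1) by (intro integral_atomic_variation) auto
  also have "\<dots> = (\<integral>x. a x * f x \<partial>count_space A)"
    using polar_density_atomic_measure(2)
    by (intro Bochner_Integration.integral_cong) (auto simp: scaleR_conv_of_real mult_ac)
  finally show ?thesis .
qed

end

section \<open>The integer lattice\<close>

definition int_lattice :: "'a::euclidean_space set" where
  "int_lattice = {x. \<forall>b\<in>Basis. x \<bullet> b \<in> \<int>}"

definition unit_cube :: "'a::euclidean_space set" where
  "unit_cube = {x. \<forall>b\<in>Basis. 0 \<le> x \<bullet> b \<and> x \<bullet> b < 1}"

lemma countable_int_lattice: "countable (int_lattice :: 'a::euclidean_space set)"
proof -
  have "x \<in> (\<lambda>f. \<Sum>b\<in>Basis. f b *\<^sub>R b) ` (PiE Basis (\<lambda>_. \<int>))" if "x \<in> int_lattice" for x :: 'a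
  proof
    show "x = (\<Sum>b\<in>Basis. restrict (\<lambda>b. x \<bullet> b) Basis b *\<^sub>R b)"
      by (simp add: euclidean_representation)
    show "restrict (\<lambda>b. x \<bullet> b) Basis \<in> (PiE Basis (\<lambda>_. \<int>))"
      using that by (auto simp: int_lattice_def)
  qed
  then have "int_lattice \<subseteq> (\<lambda>f. \<Sum>b\<in>Basis. f b *\<^sub>R b :: 'a) ` (PiE Basis (\<lambda>_. \<int>))" by blast
  moreover have "countable (PiE (Basis::'a set) (\<lambda>_. \<int> :: real set))"
    by (intro countable_PiE) (auto intro: countable_int)
  ultimately show ?thesis by (meson countable_image countable_subset)
qed

lemma int_lattice_0: "0 \<in> int_lattice"
  and int_lattice_add: "x \<in> int_lattice \<Longrightarrow> y \<in> int_lattice \<Longrightarrow> x + y \<in> int_lattice"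
  and int_lattice_diff: "x \<in> int_lattice \<Longrightarrow> y \<in> int_lattice \<Longrightarrow> x - y \<in> int_lattice"
  and int_lattice_uminus: "x \<in> int_lattice \<Longrightarrow> - x \<in> int_lattice"
  by (auto simp: int_lattice_def inner_add_left inner_diff_left)

lemma borel_unit_cube [measurable]: "unit_cube \<in> sets borel"
proof -
  have "unit_cube = (\<Inter>b\<in>Basis. {x::'a. 0 \<le> x \<bullet> b} \<inter> {x. x \<bullet> b < 1})"
    by (auto simp: unit_cube_def)
  also have "\<dots> \<in> sets borel"
    by (intro sets.finite_INT sets.Int borel_closed borel_open closed_Collect_le open_Collect_less continuous_intros) auto
  finally show ?thesis .
qed

lemma emeasure_unit_cube: "emeasure lborel (unit_cube :: 'a::euclidean_space set) = 1"
proof (rule antisym)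
  have "emeasure lborel (unit_cube :: 'a set) \<le> emeasure lborel (cbox 0 (One::'a))"
    by (intro emeasure_mono) (auto simp: unit_cube_def mem_box less_imp_le)
  then show "emeasure lborel (unit_cube :: 'a set) \<le> 1"
    by (simp add: emeasure_lborel_cbox_eq)
  have "emeasure lborel (box 0 (One::'a)) \<le> emeasure lborel (unit_cube :: 'a set)"
    by (intro emeasure_mono) (auto simp: unit_cube_def mem_box less_imp_le)
  then show "1 \<le> emeasure lborel (unit_cube :: 'a set)"
    by (simp add: emeasure_lborel_box_eq)
qed

definition lattice_floor :: "'a::euclidean_space \<Rightarrow> 'a" where
  "lattice_floor x = (\<Sum>b\<in>Basis. of_int \<lfloor>x \<bullet> b\<rfloor> *\<^sub>R b)"

lemma lattice_floor_inner: "b \<in> Basis \<Longrightarrow> lattice_floor x \<bullet> b = of_int \<lfloor>x \<bullet> b\<rfloor>"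
  by (simp add: lattice_floor_def)

lemma lattice_floor_in: "lattice_floor x \<in> int_lattice"
  by (auto simp: int_lattice_def lattice_floor_inner)

lemma diff_in_unit_cube_iff:
  assumes "l \<in> int_lattice"
  shows "x - l \<in> unit_cube \<longleftrightarrow> l = lattice_floor x"
proof
  assume c: "x - l \<in> unit_cube"
  show "l = lattice_floor x"
  proof (rule euclidean_eqI)
    fix b :: 'a assume b: "b \<in> Basis"
    then obtain k where k: "l \<bullet> b = of_int k" using assms by (auto simp: int_lattice_def elim: Ints_cases)
    have "\<lfloor>x \<bullet> b\<rfloor> = k"
      using c b k by (auto simp: unit_cube_def inner_diff_left floor_eq_iff)
    then show "l \<bullet> b = lattice_floor x \<bullet> b" using b k by (simp add: lattice_floor_inner)
  qed
next
  assume "l = lattice_floor x"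
  then show "x - l \<in> unit_cube"
    by (auto simp: unit_cube_def inner_diff_left lattice_floor_inner) linarith
qed

section \<open>Exchanging lattice sums with integrals, and tiling by cubes\<close>

lemma measurable_count_space_pair:
  assumes "countable L" "\<And>l. l \<in> L \<Longrightarrow> F l \<in> measurable M N"
  shows "(\<lambda>(l, x). F l x) \<in> measurable (count_space L \<Otimes>\<^sub>M M) N"
  using assms by (intro measurable_pair_measure_countable1) auto

lemma nn_integral_count_space_swap:
  fixes F :: "'i \<Rightarrow> 'b \<Rightarrow> ennreal"
  assumes "countable L" "sigma_finite_measure M" "\<And>l. l \<in> L \<Longrightarrow> F l \<in> borel_measurable M"
  shows "(\<integral>\<^sup>+l. \<integral>\<^sup>+x. F l x \<partial>M \<partial>count_space L) = (\<integral>\<^sup>+x. \<integral>\<^sup>+l. F l x \<partial>count_space L \<partial>M)"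
proof -
  interpret pair_sigma_finite "count_space L" M
    using assms sigma_finite_measure_count_space_countable by (auto simp: pair_sigma_finite_def)
  show ?thesis
    using Fubini'[OF measurable_count_space_pair[OF assms(1,3)]] by simp
qed

lemma integral_count_space_swap:
  fixes F :: "'i \<Rightarrow> 'b \<Rightarrow> complex"
  assumes L: "countable L" and M: "sigma_finite_measure M"
    and F: "\<And>l. l \<in> L \<Longrightarrow> F l \<in> borel_measurable M"
    and fin: "(\<integral>\<^sup>+l. \<integral>\<^sup>+x. ennreal (cmod (F l x)) \<partial>M \<partial>count_space L) < \<infinity>"
  shows "integrable (count_space L) (\<lambda>l. \<integral>x. F l x \<partial>M)"
    and "integrable M (\<lambda>x. \<integral>l. F l x \<partial>count_space L)"
    and "(\<integral>l. \<integral>x. F l x \<partial>M \<partial>count_space L) = (\<integral>x. \<integral>l. F l x \<partial>count_space L \<partial>M)"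
proof -
  interpret pair_sigma_finite "count_space L" M
    using L M sigma_finite_measure_count_space_countable by (auto simp: pair_sigma_finite_def)
  have m: "case_prod F \<in> borel_measurable (count_space L \<Otimes>\<^sub>M M)"
    using measurable_count_space_pair[OF L F] by simp
  have i: "integrable (count_space L \<Otimes>\<^sub>M M) (case_prod F)"
    unfolding integrable_iff_bounded
    using m fin M2.nn_integral_fst[of "\<lambda>z. ennreal (cmod (case_prod F z))" "count_space L"] by auto
  show "integrable (count_space L) (\<lambda>l. \<integral>x. F l x \<partial>M)" using integrable_fst'[OF i] by simp
  show "integrable M (\<lambda>x. \<integral>l. F l x \<partial>count_space L)" using integrable_snd[OF i] by simp
  show "(\<integral>l. \<integral>x. F l x \<partial>M \<partial>count_space L) = (\<integral>x. \<integral>l. F l x \<partial>count_space L \<partial>M)"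
    using Fubini_integral[OF i] by simp
qed

lemma nn_integral_lborel_translate:
  fixes g :: "'a::euclidean_space \<Rightarrow> ennreal"
  assumes "g \<in> borel_measurable borel"
  shows "(\<integral>\<^sup>+x. g (a + x) \<partial>lborel) = (\<integral>\<^sup>+x. g x \<partial>lborel)"
  using assms by (subst (2) lborel_distr_plus[of a, symmetric]) (simp add: nn_integral_distr)

lemma integral_lborel_translate:
  fixes g :: "'a::euclidean_space \<Rightarrow> 'b::{banach, second_countable_topology}"
  assumes "g \<in> borel_measurable borel"
  shows "(\<integral>x. g (a + x) \<partial>lborel) = (\<integral>x. g x \<partial>lborel)"
  using assms by (subst (2) lborel_distr_plus[of a, symmetric]) (simp add: integral_distr)

lemma integral_count_space_indicator:
  fixes c :: complex
  assumes "k \<in> L"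
  shows "(\<integral>l. c * indicator {k} l \<partial>count_space L) = c"
proof -
  have "(\<integral>l. c * indicator {k} l \<partial>count_space L) = (\<Sum>l\<in>{k}. c * indicator {k} l)"
    by (subst lebesgue_integral_count_space_finite_support)
       (use assms in \<open>auto simp: indicator_def Collect_conv_if cong: conj_cong\<close>)
  then show ?thesis by simp
qed

text \<open>Unfolding: the lattice translates of the half-open cube tile the space, and the tile of
  a point is indexed by its \<open>lattice_floor\<close>.\<close>

lemma nn_integral_tiling:
  fixes g :: "'a::euclidean_space \<Rightarrow> ennreal"
  assumes [measurable]: "g \<in> borel_measurable borel"
  shows "(\<integral>\<^sup>+l. \<integral>\<^sup>+u. g (l + u) * indicator unit_cube u \<partial>lborel \<partial>count_space int_lattice) = (\<integral>\<^sup>+x. g x \<partial>lborel)"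
proof -
  have "(\<integral>\<^sup>+u. g (l + u) * indicator unit_cube u \<partial>lborel)
    = (\<integral>\<^sup>+x. g x * indicator unit_cube (x - l) \<partial>lborel)" for l
    using nn_integral_lborel_translate[of "\<lambda>x. g x * indicator unit_cube (x - l)" l] by simp
  then have "(\<integral>\<^sup>+l. \<integral>\<^sup>+u. g (l + u) * indicator unit_cube u \<partial>lborel \<partial>count_space int_lattice)
    = (\<integral>\<^sup>+l. \<integral>\<^sup>+x. g x * indicator unit_cube (x - l) \<partial>lborel \<partial>count_space int_lattice)" by simp
  also have "\<dots> = (\<integral>\<^sup>+x. \<integral>\<^sup>+l. g x * indicator unit_cube (x - l) \<partial>count_space int_lattice \<partial>lborel)"
    by (intro nn_integral_count_space_swap countable_int_lattice sigma_finite_lborel) measurable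
  also have "(\<lambda>x. \<integral>\<^sup>+l. g x * indicator unit_cube (x - l) \<partial>count_space int_lattice) = g"
  proof
    fix x :: 'a
    have "(\<integral>\<^sup>+l. g x * indicator unit_cube (x - l) \<partial>count_space int_lattice)
       = (\<Sum>l\<in>{lattice_floor x}. g x * indicator unit_cube (x - l))"
      by (intro nn_integral_count_space')
         (auto simp: diff_in_unit_cube_iff lattice_floor_in split: split_indicator)
    then show "(\<integral>\<^sup>+l. g x * indicator unit_cube (x - l) \<partial>count_space int_lattice) = g x"
      using diff_in_unit_cube_iff[of "lattice_floor x" x] by (simp add: lattice_floor_in)
  qed
  finally show ?thesis .
qed

lemma integral_tiling:
  fixes g :: "'a::euclidean_space \<Rightarrow> complex"
  assumes g: "integrable lborel g"
  shows "(\<integral>u. (\<integral>l. g (l + u) \<partial>count_space int_lattice) * indicator unit_cube u \<partial>lborel) = (\<integral>x. g x \<partial>lborel)"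
proof -
  have [measurable]: "g \<in> borel_measurable borel" using g by (auto dest: borel_measurable_integrable)
  have "(\<integral>\<^sup>+l. \<integral>\<^sup>+u. ennreal (cmod (g (l + u) * indicator unit_cube u)) \<partial>lborel \<partial>count_space int_lattice)
     = (\<integral>\<^sup>+x. ennreal (cmod (g x)) \<partial>lborel)"
    by (subst nn_integral_tiling[symmetric])
      (auto intro!: nn_integral_cong simp: norm_mult split: split_indicator)
  then have fin: "(\<integral>\<^sup>+l. \<integral>\<^sup>+u. ennreal (cmod (g (l + u) * indicator unit_cube u)) \<partial>lborel \<partial>count_space int_lattice) < \<infinity>"
    using g by (simp add: integrable_iff_bounded)
  have "(\<integral>u. (\<integral>l. g (l + u) \<partial>count_space int_lattice) * indicator unit_cube u \<partial>lborel)
    = (\<integral>u. (\<integral>l. g (l + u) * indicator unit_cube u \<partial>count_space int_lattice) \<partial>lborel)"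
    by simp
  also have "\<dots> = (\<integral>l. (\<integral>u. g (l + u) * indicator unit_cube u \<partial>lborel) \<partial>count_space int_lattice)"
    by (intro integral_count_space_swap(3)[symmetric] countable_int_lattice sigma_finite_lborel fin) measurable
  also have "\<dots> = (\<integral>l. (\<integral>x. g x * indicator unit_cube (x - l) \<partial>lborel) \<partial>count_space int_lattice)"
    using integral_lborel_translate[of "\<lambda>x. g x * indicator unit_cube (x - l)" l for l] by simp
  also have "\<dots> = (\<integral>x. (\<integral>l. g x * indicator unit_cube (x - l) \<partial>count_space int_lattice) \<partial>lborel)"
  proof (intro integral_count_space_swap(3) countable_int_lattice sigma_finite_lborel)
    have "(\<integral>\<^sup>+x. ennreal (cmod (g x * indicator unit_cube (x - l))) \<partial>lborel)
       = (\<integral>\<^sup>+u. ennreal (cmod (g (l + u) * indicator unit_cube u)) \<partial>lborel)" for l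
      using nn_integral_lborel_translate[of "\<lambda>x. ennreal (cmod (g x * indicator unit_cube (x - l)))" l] by simp
    then show "(\<integral>\<^sup>+l. \<integral>\<^sup>+x. ennreal (cmod (g x * indicator unit_cube (x - l))) \<partial>lborel \<partial>count_space int_lattice) < \<infinity>"
      using fin by simp
  qed measurable
  also have "(\<lambda>x. \<integral>l. g x * indicator unit_cube (x - l) \<partial>count_space int_lattice) = g"
  proof
    fix x :: 'a
    have "(\<integral>l. g x * indicator unit_cube (x - l) \<partial>count_space int_lattice)
      = (\<integral>l. g x * indicator {lattice_floor x} l \<partial>count_space int_lattice)"
      by (intro Bochner_Integration.integral_cong) (auto simp: diff_in_unit_cube_iff split: split_indicator)
    also have "\<dots> = g x" by (rule integral_count_space_indicator[OF lattice_floor_in])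
    finally show "(\<integral>l. g x * indicator unit_cube (x - l) \<partial>count_space int_lattice) = g x" .
  qed
  finally show ?thesis .
qed

text \<open>A Peetre-type inequality, from \<open>1 + (x + y)\<^sup>2 \<le> 2 * ((1 + x\<^sup>2) *
  (1 + y\<^sup>2))\<close> in each coordinate. It moves a translation out of a weight at polynomial
  cost.\<close>

lemma weight_mult_le:
  fixes u v :: "'a::euclidean_space"
  shows "weight u * weight v \<le> 2 ^ DIM('a) * weight (u + v)"
proof -
  have "weight u * weight v = (\<Prod>b\<in>(Basis::'a set). 1 / (1 + (u \<bullet> b)\<^sup>2) * (1 / (1 + (v \<bullet> b)\<^sup>2)))"
    by (simp only: weight_def prod.distrib)
  also have "\<dots> \<le> (\<Prod>b\<in>(Basis::'a set). 2 * (1 / (1 + ((u + v) \<bullet> b)\<^sup>2)))"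
  proof (intro prod_mono conjI)
    fix b :: 'a
    define x y where "x = u \<bullet> b" and "y = v \<bullet> b"
    have "0 \<le> (x - y)\<^sup>2" "0 \<le> x\<^sup>2 * y\<^sup>2" by auto
    then have le: "1 + (x + y)\<^sup>2 \<le> 2 * ((1 + x\<^sup>2) * (1 + y\<^sup>2))"
      unfolding power2_diff power2_sum ring_distribs by linarith
    have p: "0 < 1 + x\<^sup>2" "0 < 1 + y\<^sup>2" "0 < 1 + (x + y)\<^sup>2" by (auto intro: add_pos_nonneg)
    have "1 / (1 + x\<^sup>2) * (1 / (1 + y\<^sup>2)) = 2 / (2 * ((1 + x\<^sup>2) * (1 + y\<^sup>2)))" by simp
    also have "\<dots> \<le> 2 / (1 + (x + y)\<^sup>2)"
      using le p by (intro divide_left_mono mult_pos_pos) auto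
    finally show "1 / (1 + (u \<bullet> b)\<^sup>2) * (1 / (1 + (v \<bullet> b)\<^sup>2)) \<le> 2 * (1 / (1 + ((u + v) \<bullet> b)\<^sup>2))"
      by (simp add: x_def y_def inner_add_left)
  qed auto
  also have "\<dots> = 2 ^ DIM('a) * weight (u + v)"
    by (simp only: weight_def prod.distrib prod_constant)
  finally show ?thesis .
qed

lemma weight_measurable [measurable]: "weight \<in> borel_measurable borel"
  unfolding weight_def[abs_def] by measurable

lemma nn_integral_cauchy_density: "(\<integral>\<^sup>+(x::real). ennreal (1 / (1 + x\<^sup>2)) \<partial>lborel) < \<infinity>"
proof -
  have half: "(\<integral>\<^sup>+(x::real). ennreal (1 / (1 + x\<^sup>2)) * indicator {0..} x \<partial>lborel) = ennreal (pi / 2 - arctan 0)"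
  proof (rule nn_integral_FTC_atLeast)
    show "DERIV arctan x :> 1 / (1 + x\<^sup>2)" for x :: real
      using DERIV_arctan[of x] by (simp add: inverse_eq_divide)
  qed (auto intro: tendsto_arctan_at_top)
  have "(\<integral>\<^sup>+(x::real). ennreal (1 / (1 + x\<^sup>2)) \<partial>lborel) \<le>
     (\<integral>\<^sup>+(x::real). ennreal (1 / (1 + x\<^sup>2)) * indicator {0..} x + ennreal (1 / (1 + x\<^sup>2)) * indicator {0..} (- x) \<partial>lborel)"
    by (intro nn_integral_mono) (auto split: split_indicator)
  also have "\<dots> = (\<integral>\<^sup>+(x::real). ennreal (1 / (1 + x\<^sup>2)) * indicator {0..} x \<partial>lborel)
     + (\<integral>\<^sup>+(x::real). ennreal (1 / (1 + x\<^sup>2)) * indicator {0..} (- x) \<partial>lborel)"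
    by (intro nn_integral_add) auto
  also have "(\<integral>\<^sup>+(x::real). ennreal (1 / (1 + x\<^sup>2)) * indicator {0..} (- x) \<partial>lborel)
     = (\<integral>\<^sup>+(x::real). ennreal (1 / (1 + x\<^sup>2)) * indicator {0..} x \<partial>lborel)"
    by (subst (2) lborel_distr_uminus[symmetric]) (simp add: nn_integral_distr)
  finally have "(\<integral>\<^sup>+(x::real). ennreal (1 / (1 + x\<^sup>2)) \<partial>lborel) \<le> ennreal (pi / 2 + pi / 2)"
    unfolding half by (simp flip: ennreal_plus)
  then show ?thesis by (rule le_less_trans) simp
qed

lemma integrable_weight: "integrable lborel (weight :: 'a::euclidean_space \<Rightarrow> real)"
proof -
  have "(\<integral>\<^sup>+(x::'a). ennreal (weight x) \<partial>lborel)
     = (\<integral>\<^sup>+(x::'a). (\<Prod>b\<in>Basis. ennreal (1 / (1 + (x \<bullet> b)\<^sup>2))) \<partial>lborel)"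
    by (intro nn_integral_cong) (simp add: weight_def prod_ennreal)
  also have "\<dots> = (\<Prod>b\<in>(Basis::'a set). (\<integral>\<^sup>+(x::real). ennreal (1 / (1 + x\<^sup>2)) \<partial>lborel))"
    by (intro nn_integral_lborel_prod[where f="\<lambda>_ x. ennreal (1 / (1 + x\<^sup>2))"]) auto
  also have "\<dots> < \<infinity>"
    using nn_integral_cauchy_density by (simp add: less_top[symmetric] power_eq_top_ennreal)
  finally show ?thesis
    by (simp add: integrable_iff_bounded less_imp_le[OF weight_pos])
qed

lemma weight_unit_cube:
  assumes "u \<in> unit_cube"
  shows "1 / 2 ^ DIM('a) \<le> weight (u :: 'a::euclidean_space)"
proof -
  have "(\<Prod>b\<in>(Basis::'a set). 1 / 2) \<le> weight u"
    unfolding weight_def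
  proof (intro prod_mono conjI)
    fix b :: 'a assume "b \<in> Basis"
    then have "0 \<le> u \<bullet> b" "u \<bullet> b \<le> 1" using assms by (auto simp: unit_cube_def)
    then have "1 + (u \<bullet> b)\<^sup>2 \<le> 2" by (simp add: power_le_one)
    moreover have "0 < 1 + (u \<bullet> b)\<^sup>2" by (simp add: add_pos_nonneg)
    ultimately show "1 / 2 \<le> 1 / (1 + (u \<bullet> b)\<^sup>2)" by (simp add: field_simps)
  qed auto
  then show ?thesis by (simp add: power_one_over)
qed

text \<open>Comparison of sum and integral: across a unit cube the weight drops by a bounded factor
  only. One \<open>2 ^ DIM('a)\<close> bounds the weight from below on the cube, the other comes
  from \<open>weight_mult_le\<close>. Uniformity in \<open>x\<close> is needed later, when sums over
  sparse sets are centred at arbitrary points.\<close>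

lemma nn_integral_weight_int_lattice:
  fixes x :: "'a::euclidean_space"
  shows "(\<integral>\<^sup>+l. ennreal (weight (l + x)) \<partial>count_space int_lattice)
     \<le> ennreal (4 ^ DIM('a) * (\<integral>y. weight (y::'a) \<partial>lborel))"
proof -
  have "ennreal (weight (l + x)) \<le>
    (\<integral>\<^sup>+u. ennreal (4 ^ DIM('a) * weight (x + (l + u))) * indicator unit_cube u \<partial>lborel)" for l
  proof -
    have "ennreal (weight (l + x)) = (\<integral>\<^sup>+(u::'a). ennreal (weight (l + x)) * indicator unit_cube u \<partial>lborel)"
      by (simp add: nn_integral_cmult_indicator emeasure_unit_cube)
    also have "\<dots> \<le> (\<integral>\<^sup>+u. ennreal (4 ^ DIM('a) * weight (x + (l + u))) * indicator unit_cube u \<partial>lborel)"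
    proof (intro nn_integral_mono)
      fix u :: 'a
      show "ennreal (weight (l + x)) * indicator unit_cube u
         \<le> ennreal (4 ^ DIM('a) * weight (x + (l + u))) * indicator unit_cube u"
      proof (cases "u \<in> unit_cube")
        case True
        have "weight (l + x) * (1 / 2 ^ DIM('a)) \<le> weight (l + x) * weight u"
          using weight_unit_cube[OF True] weight_pos[of "l + x"] by (intro mult_left_mono) auto
        also have "\<dots> \<le> 2 ^ DIM('a) * weight (l + x + u)" by (rule weight_mult_le)
        finally have "weight (l + x) \<le> 2 ^ DIM('a) * 2 ^ DIM('a) * weight (x + (l + u))"
          by (simp add: field_simps add_ac)
        then show ?thesis by (auto simp: True power_mult_distrib[symmetric] intro!: ennreal_leI)
      qed auto
    qed
    finally show ?thesis .
  qed
  then have "(\<integral>\<^sup>+l. ennreal (weight (l + x)) \<partial>count_space int_lattice) \<le>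
    (\<integral>\<^sup>+l. \<integral>\<^sup>+u. ennreal (4 ^ DIM('a) * weight (x + (l + u))) * indicator unit_cube u \<partial>lborel \<partial>count_space int_lattice)"
    by (intro nn_integral_mono) auto
  also have "\<dots> = (\<integral>\<^sup>+y. ennreal (4 ^ DIM('a) * weight (x + y)) \<partial>lborel)"
    by (intro nn_integral_tiling) measurable
  also have "\<dots> = (\<integral>\<^sup>+y. ennreal (4 ^ DIM('a) * weight (y::'a)) \<partial>lborel)"
    by (intro nn_integral_lborel_translate[where g="\<lambda>y. ennreal (4 ^ DIM('a) * weight y)"]) measurable
  also have "\<dots> = ennreal (\<integral>y. 4 ^ DIM('a) * weight (y::'a) \<partial>lborel)"
    by (intro nn_integral_eq_integral integrable_mult_right integrable_weight)
       (simp add: less_imp_le[OF weight_pos])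
  finally show ?thesis by simp
qed

lemma integrable_weight_int_lattice: "integrable (count_space int_lattice) (\<lambda>l. weight (l + x))"
  using nn_integral_weight_int_lattice[of x]
  by (auto simp: integrable_iff_bounded less_imp_le[OF weight_pos] intro: le_less_trans)

lemma integrable_lattice_weight: "integrable (count_space int_lattice) weight"
  using integrable_weight_int_lattice[of 0] by simp

text \<open>A summable function, here \<open>weight\<close>, can be bounded below by a positive
  constant on a finite set only.\<close>

lemma finite_int_lattice_norm_le:
  "finite {z \<in> int_lattice. norm (z::'a::euclidean_space) \<le> R}"
proof -
  define e where "e = 1 / (1 + R\<^sup>2) ^ DIM('a)"
  have e: "e > 0" unfolding e_def by (intro divide_pos_pos zero_less_power add_pos_nonneg) auto
  define F where "F = {z \<in> int_lattice. norm (z::'a) \<le> R}"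
  have "e \<le> weight z" if "z \<in> F" for z
  proof -
    have "(norm z)\<^sup>2 \<le> R\<^sup>2" using that by (intro power_mono) (auto simp: F_def)
    then have "e \<le> 1 / (1 + (norm z)\<^sup>2) ^ DIM('a)" unfolding e_def
      by (intro divide_left_mono power_mono mult_pos_pos zero_less_power add_pos_nonneg) auto
    then show ?thesis using weight_lower[of z] by simp
  qed
  then have "(\<integral>\<^sup>+z. ennreal e * indicator F z \<partial>count_space int_lattice) \<le>
      (\<integral>\<^sup>+z. ennreal (weight (z::'a)) \<partial>count_space int_lattice)"
    by (intro nn_integral_mono) (auto simp: ennreal_leI split: split_indicator)
  also have "\<dots> < \<infinity>" using nn_integral_weight_int_lattice[of "0::'a"] by (auto intro: le_less_trans)
  finally have "ennreal e * emeasure (count_space int_lattice) F < \<infinity>"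
    by (simp add: nn_integral_cmult_indicator F_def)
  then have "emeasure (count_space int_lattice) F < \<infinity>"
    using e by (auto simp: ennreal_mult_less_top)
  then show ?thesis
    by (auto simp: F_def emeasure_count_space split: if_splits)
qed

section \<open>Poisson summation\<close>

definition chi :: "real \<Rightarrow> complex" where
  "chi r = exp (- 2 * of_real pi * \<i> * of_real r)"

lemma fourier_chi: "fourier \<phi> t = (\<integral>x. \<phi> x * chi (t \<bullet> x) \<partial>lborel)"
  by (simp add: fourier_def chi_def)

lemma chi_0 [simp]: "chi 0 = 1"
  and norm_chi [simp]: "cmod (chi r) = 1"
  and chi_add: "chi (r + s) = chi r * chi s"
  by (simp_all add: chi_def norm_exp_eq_Re exp_add[symmetric] ring_distribs)

lemma chi_uminus: "chi (- r) = cnj (chi r)"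
  by (simp add: chi_def exp_cnj)

lemma chi_diff: "chi (r - s) = chi r * cnj (chi s)"
  using chi_add[of r "- s"] by (simp add: chi_uminus)

lemma chi_mult_cnj [simp]: "chi r * cnj (chi r) = 1" "cnj (chi r) * chi r = 1"
  using chi_diff[of r r] by (simp_all add: mult.commute)

lemma chi_cos_sin: "chi r = complex_of_real (cos (2 * pi * r)) - \<i> * complex_of_real (sin (2 * pi * r))"
proof -
  have "chi r = cis (- (2 * pi * r))" by (simp add: chi_def cis_conv_exp mult_ac)
  then show ?thesis by (simp add: cis.ctr Complex_eq)
qed

lemma chi_Ints [simp]: "r \<in> \<int> \<Longrightarrow> chi r = 1"
  by (elim Ints_cases) (simp add: chi_cos_sin cos_int_2pin sin_int_2pin)

lemma continuous_on_chi [continuous_intros]: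
  "continuous_on S f \<Longrightarrow> continuous_on S (\<lambda>x. chi (f x))"
  unfolding chi_def by (intro continuous_intros)

lemma chi_measurable [measurable]: "chi \<in> borel_measurable borel"
  by (intro borel_measurable_continuous_onI continuous_intros)

lemma continuous_on_integral_dominated:
  fixes F :: "'a::metric_space \<Rightarrow> 'b \<Rightarrow> 'c::{banach, second_countable_topology}"
  assumes m: "\<And>y. y \<in> Y \<Longrightarrow> F y \<in> borel_measurable M"
    and c: "\<And>x. x \<in> space M \<Longrightarrow> continuous_on Y (\<lambda>y. F y x)"
    and w: "integrable M w"
    and le: "\<And>y x. y \<in> Y \<Longrightarrow> x \<in> space M \<Longrightarrow> norm (F y x) \<le> w x"
  shows "continuous_on Y (\<lambda>y. \<integral>x. F y x \<partial>M)"
  unfolding continuous_on_sequentially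
proof (intro allI ballI impI, elim conjE)
  fix s :: "nat \<Rightarrow> 'a" and y assume y: "y \<in> Y" "\<forall>n. s n \<in> Y" "s \<longlonglongrightarrow> y"
  have "(\<lambda>n. \<integral>x. F (s n) x \<partial>M) \<longlonglongrightarrow> (\<integral>x. F y x \<partial>M)"
  proof (rule integral_dominated_convergence[OF _ _ w])
    show "AE x in M. (\<lambda>n. F (s n) x) \<longlonglongrightarrow> F y x"
      using c y by (intro AE_I2) (auto simp: continuous_on_sequentially o_def)
  qed (use m le y in auto)
  then show "((\<lambda>y. \<integral>x. F y x \<partial>M) \<circ> s) \<longlonglongrightarrow> (\<integral>x. F y x \<partial>M)" by (simp add: o_def)
qed

lemma continuous_on_all_balls:
  fixes f :: "'a::real_normed_vector \<Rightarrow> 'b::topological_space"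
  assumes "\<And>R. continuous_on (ball 0 R) f"
  shows "continuous_on UNIV f"
proof -
  have "continuous_on (\<Union>R\<in>UNIV. ball 0 R) f"
    using assms by (intro continuous_on_open_UN) auto
  moreover have "(\<Union>R\<in>UNIV. ball (0::'a) R) = UNIV" by (auto intro: gt_ex)
  ultimately show ?thesis by simp
qed

lemma continuous_on_fourier:
  assumes "integrable lborel f"
  shows "continuous_on S (fourier f)"
proof -
  have [measurable]: "f \<in> borel_measurable borel" using assms by (auto dest: borel_measurable_integrable)
  show ?thesis
    unfolding fourier_chi[abs_def]
    by (rule continuous_on_integral_dominated[where w="\<lambda>x. cmod (f x)"])
       (auto intro!: continuous_intros integrable_norm assms simp: norm_mult)
qed

lemma integral_lborel_prod:
  fixes F :: "'a::euclidean_space \<Rightarrow> real \<Rightarrow> complex"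
  assumes "\<And>b. b \<in> Basis \<Longrightarrow> integrable lborel (F b)"
  shows "integrable lborel (\<lambda>x. \<Prod>b\<in>Basis. F b (x \<bullet> b))"
    and "(\<integral>x. (\<Prod>b\<in>Basis. F b (x \<bullet> b)) \<partial>lborel) = (\<Prod>b\<in>Basis. \<integral>x. F b x \<partial>lborel)"
proof -
  interpret product_sigma_finite "\<lambda>_::'a. lborel :: real measure"
    by (simp add: product_sigma_finite_def sigma_finite_lborel)
  have [measurable]: "F b \<in> borel_measurable borel" if "b \<in> Basis" for b
    using assms[OF that] by (auto dest: borel_measurable_integrable)
  have m: "(\<lambda>x. \<Prod>b\<in>Basis. F b (x \<bullet> b)) \<in> borel_measurable borel" by measurable
  have t: "(\<lambda>f. \<Sum>b\<in>Basis. f b *\<^sub>R b :: 'a) \<in> (\<Pi>\<^sub>M b\<in>Basis. lborel) \<rightarrow>\<^sub>M borel"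
    by measurable
  have eq: "(\<Prod>b\<in>Basis. F b ((\<Sum>c\<in>Basis. f c *\<^sub>R c :: 'a) \<bullet> b)) = (\<Prod>b\<in>Basis. F b (f b))" for f
    by (intro prod.cong) auto
  show "integrable lborel (\<lambda>x. \<Prod>b\<in>Basis. F b (x \<bullet> b))"
    by (subst lborel_eq, subst integrable_distr_eq[OF t m])
       (simp add: eq product_integrable_prod assms)
  show "(\<integral>x. (\<Prod>b\<in>Basis. F b (x \<bullet> b)) \<partial>lborel) = (\<Prod>b\<in>Basis. \<integral>x. F b x \<partial>lborel)"
    by (subst lborel_eq, subst integral_distr[OF t m])
       (simp add: eq product_integral_prod assms)
qed

section \<open>Uniqueness of Fourier coefficients of continuous periodic functions\<close>

lemma integral_chi_interval:
  assumes "m \<noteq> 0" "a \<le> b"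
  shows "(\<integral>x. indicator {a..b} x *\<^sub>R chi (m * x) \<partial>lborel) = (chi (m * b) - chi (m * a)) / (- 2 * of_real pi * \<i> * of_real m)"
proof -
  let ?c = "- 2 * of_real pi * \<i> * complex_of_real m"
  have c: "?c \<noteq> 0" using assms by simp
  have "(\<integral>x. indicator {a..b} x *\<^sub>R chi (m * x) \<partial>lborel) = chi (m * b) / ?c - chi (m * a) / ?c"
  proof (rule integral_FTC_Icc)
    show "continuous_on {a..b} (\<lambda>x. chi (m * x))" by (intro continuous_intros)
    fix x
    have "((\<lambda>z. exp (?c * z) / ?c) has_field_derivative exp (?c * of_real x)) (at (of_real x))"
      using c by (auto intro!: derivative_eq_intros simp: field_simps)
    then have "((\<lambda>x. exp (?c * of_real x) / ?c) has_vector_derivative exp (?c * of_real x)) (at x within {a..b})"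
      by (rule has_vector_derivative_real_field)
    then show "((\<lambda>x. chi (m * x) / ?c) has_vector_derivative chi (m * x)) (at x within {a..b})"
      by (simp add: chi_def mult_ac)
  qed (use assms in auto)
  then show ?thesis by (simp add: diff_divide_distrib)
qed

lemma integrable_unit_cube:
  fixes E :: "'a::euclidean_space \<Rightarrow> complex"
  assumes "continuous_on UNIV E"
  shows "integrable lborel (\<lambda>x. E x * indicator unit_cube x)"
proof -
  have "integrable lborel (\<lambda>x. indicator (cbox 0 One) x *\<^sub>R E x)"
    by (intro borel_integrable_compact compact_cbox continuous_on_subset[OF assms]) auto
  then have "set_integrable lborel (cbox 0 One) E" by (simp add: set_integrable_def)
  then have "set_integrable lborel unit_cube E"
    by (rule set_integrable_subset) (auto simp: unit_cube_def mem_box less_imp_le)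
  then show ?thesis by (simp add: set_integrable_def scaleR_conv_of_real mult.commute of_real_indicator)
qed

lemma integral_chi_unit_cube:
  fixes m :: "'a::euclidean_space"
  assumes m: "m \<in> int_lattice"
  shows "(\<integral>u. chi (m \<bullet> u) * indicator unit_cube u \<partial>lborel) = (if m = 0 then 1 else 0)"
proof -
  have ae: "AE x::real in lborel. x \<noteq> 1" by (rule AE_lborel_singleton)
  let ?F = "\<lambda>b x. indicator {0..<1} x *\<^sub>R chi ((m \<bullet> b) * x)"
  have eq1: "(\<integral>x. ?F b x \<partial>lborel) = (\<integral>x. indicator {0..1} x *\<^sub>R chi ((m \<bullet> b) * x) \<partial>lborel)" for b
    using ae by (intro integral_cong_AE) (auto split: split_indicator)
  have int: "integrable lborel (?F b)" for b
  proof -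
    have "set_integrable lborel {0..1} (\<lambda>x. chi ((m \<bullet> b) * x))"
      by (intro borel_integrable_atLeastAtMost') (intro continuous_intros)
    then have "set_integrable lborel {0..<1} (\<lambda>x. chi ((m \<bullet> b) * x))"
      by (rule set_integrable_subset) auto
    then show ?thesis by (simp add: set_integrable_def)
  qed
  have prod: "chi (m \<bullet> u) * indicator unit_cube u = (\<Prod>b\<in>Basis. ?F b (u \<bullet> b))" for u
  proof (cases "u \<in> unit_cube")
    case True
    have "chi (\<Sum>b\<in>A. (m \<bullet> b) * (u \<bullet> b)) = (\<Prod>b\<in>A. chi ((m \<bullet> b) * (u \<bullet> b)))" if "finite A" for A
      using that by induction (auto simp: chi_add)
    then have "chi (m \<bullet> u) = (\<Prod>b\<in>Basis. chi ((m \<bullet> b) * (u \<bullet> b)))"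
      by (simp add: euclidean_inner[of m u])
    also have "\<dots> = (\<Prod>b\<in>Basis. ?F b (u \<bullet> b))"
      using True by (intro prod.cong) (auto simp: unit_cube_def)
    finally show ?thesis using True by simp
  next
    case False
    then obtain b where "b \<in> Basis" "u \<bullet> b \<notin> {0..<1}" by (auto simp: unit_cube_def)
    then have "(\<Prod>b\<in>Basis. ?F b (u \<bullet> b)) = 0" by (intro prod_zero bexI[of _ b]) auto
    then show ?thesis using False by simp
  qed
  have "(\<integral>u. chi (m \<bullet> u) * indicator unit_cube u \<partial>lborel) = (\<Prod>b\<in>Basis. \<integral>x. ?F b x \<partial>lborel)"
    unfolding prod by (intro integral_lborel_prod(2) int)
  also have "\<dots> = (if m = 0 then 1 else 0)"
  proof (cases "m = 0")
    case True then show ?thesis by (simp add: eq1)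
  next
    case False
    then obtain b where b: "b \<in> Basis" "m \<bullet> b \<noteq> 0" using euclidean_all_zero_iff by blast
    then have "chi (m \<bullet> b) = 1" using m by (auto simp: int_lattice_def)
    then have "(\<integral>x. ?F b x \<partial>lborel) = 0" unfolding eq1
      using integral_chi_interval[of "m \<bullet> b" 0 1] b by simp
    then show ?thesis using b False by (auto intro!: prod_zero)
  qed
  finally show ?thesis .
qed

text \<open>Realises the torus, the space modulo \<open>int_lattice\<close>, as a product of circles
  inside a Euclidean space, where ordinary polynomials become trigonometric polynomials.\<close>

definition torus_map :: "'a::euclidean_space \<Rightarrow> 'a \<times> 'a" where
  "torus_map x = (\<Sum>b\<in>Basis. cos (2 * pi * (x \<bullet> b)) *\<^sub>R b, \<Sum>b\<in>Basis. sin (2 * pi * (x \<bullet> b)) *\<^sub>R b)"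

definition vanishing_coefficients :: "('a::euclidean_space \<Rightarrow> complex) \<Rightarrow> bool" where
  "vanishing_coefficients E \<longleftrightarrow> continuous_on UNIV E \<and>
     (\<forall>k\<in>int_lattice. (\<integral>x. E x * chi (k \<bullet> x) * indicator unit_cube x \<partial>lborel) = 0)"

text \<open>A stand-in for being a trigonometric polynomial. As an invariance property it is closed
  under products by mere composition, so polynomials in \<open>torus_map\<close> are handled by
  induction without expansion into characters; the characters themselves only shift the index of a
  coefficient.\<close>

definition coefficient_multiplier :: "('a::euclidean_space \<Rightarrow> complex) \<Rightarrow> bool" where
  "coefficient_multiplier p \<longleftrightarrow>
     (\<forall>E. vanishing_coefficients E \<longrightarrow> vanishing_coefficients (\<lambda>x. E x * p x))"

lemma vanishing_coefficients_add:
  assumes "vanishing_coefficients E" "vanishing_coefficients F"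
  shows "vanishing_coefficients (\<lambda>x. E x + F x)"
  unfolding vanishing_coefficients_def
proof (intro conjI ballI)
  show c: "continuous_on UNIV (\<lambda>x. E x + F x)"
    using assms by (auto simp: vanishing_coefficients_def intro: continuous_intros)
  fix k :: 'a assume k: "k \<in> int_lattice"
  have i: "integrable lborel (\<lambda>x. E x * chi (k \<bullet> x) * indicator unit_cube x)"
    "integrable lborel (\<lambda>x. F x * chi (k \<bullet> x) * indicator unit_cube x)"
    using assms by (auto simp: vanishing_coefficients_def intro!: integrable_unit_cube continuous_intros)
  show "(\<integral>x. (E x + F x) * chi (k \<bullet> x) * indicator unit_cube x \<partial>lborel) = 0"
    using assms k by (simp add: ring_distribs Bochner_Integration.integral_add[OF i] vanishing_coefficients_def)
qed

lemma coefficient_multiplier_const: "coefficient_multiplier (\<lambda>x. c)"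
  unfolding coefficient_multiplier_def vanishing_coefficients_def
proof (intro allI impI, elim conjE, intro conjI ballI)
  fix E :: "'a \<Rightarrow> complex" and k :: 'a
  assume "continuous_on UNIV E" and E: "\<forall>k\<in>int_lattice. (\<integral>x. E x * chi (k \<bullet> x) * indicator unit_cube x \<partial>lborel) = 0"
  then show "continuous_on UNIV (\<lambda>x. E x * c)" by (intro continuous_intros)
  assume "k \<in> int_lattice"
  then have "c * (\<integral>x. E x * chi (k \<bullet> x) * indicator unit_cube x \<partial>lborel) = 0" using E by simp
  then show "(\<integral>x. E x * c * chi (k \<bullet> x) * indicator unit_cube x \<partial>lborel) = 0"
    by (subst (asm) integral_mult_right_zero[symmetric]) (simp add: mult_ac)
qed

lemma coefficient_multiplier_add:
  "coefficient_multiplier p \<Longrightarrow> coefficient_multiplier q \<Longrightarrow> coefficient_multiplier (\<lambda>x. p x + q x)"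
  unfolding coefficient_multiplier_def by (simp add: distrib_left vanishing_coefficients_add)

lemma coefficient_multiplier_mult:
  "coefficient_multiplier p \<Longrightarrow> coefficient_multiplier q \<Longrightarrow> coefficient_multiplier (\<lambda>x. p x * q x)"
  unfolding coefficient_multiplier_def by (simp add: mult.assoc[symmetric])

lemma coefficient_multiplier_sum:
  assumes "finite B" "\<And>b. b \<in> B \<Longrightarrow> coefficient_multiplier (p b)"
  shows "coefficient_multiplier (\<lambda>x. \<Sum>b\<in>B. p b x)"
  using assms by induction (auto intro: coefficient_multiplier_add coefficient_multiplier_const)

lemma coefficient_multiplier_chi:
  assumes m: "m \<in> int_lattice"
  shows "coefficient_multiplier (\<lambda>x. chi (m \<bullet> x))"
  unfolding coefficient_multiplier_def vanishing_coefficients_def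
proof (intro allI impI, elim conjE, intro conjI ballI)
  fix E :: "'a \<Rightarrow> complex" and k :: 'a
  assume "continuous_on UNIV E" and E: "\<forall>k\<in>int_lattice. (\<integral>x. E x * chi (k \<bullet> x) * indicator unit_cube x \<partial>lborel) = 0"
  then show "continuous_on UNIV (\<lambda>x. E x * chi (m \<bullet> x))" by (intro continuous_intros)
  assume "k \<in> int_lattice"
  then have "m + k \<in> int_lattice" using m by (rule int_lattice_add[rotated])
  then show "(\<integral>x. E x * chi (m \<bullet> x) * chi (k \<bullet> x) * indicator unit_cube x \<partial>lborel) = 0"
    using E by (auto simp: inner_add_left chi_add mult.assoc)
qed

lemma Basis_in_int_lattice: "b \<in> Basis \<Longrightarrow> b \<in> int_lattice"
  by (auto simp: int_lattice_def inner_Basis)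

lemma coefficient_multiplier_cos_sin:
  assumes b: "(b::'a::euclidean_space) \<in> Basis"
  shows "coefficient_multiplier (\<lambda>x. of_real (cos (2 * pi * (x \<bullet> b))))"
    and "coefficient_multiplier (\<lambda>x. of_real (sin (2 * pi * (x \<bullet> b))))"
proof -
  have m: "coefficient_multiplier (\<lambda>x. chi (b \<bullet> x))" "coefficient_multiplier (\<lambda>x. chi ((- b) \<bullet> x))"
    by (intro coefficient_multiplier_chi int_lattice_uminus Basis_in_int_lattice b)+
  have "coefficient_multiplier (\<lambda>x. (chi (b \<bullet> x) + chi ((- b) \<bullet> x)) * (1 / 2))"
    by (intro coefficient_multiplier_mult coefficient_multiplier_add coefficient_multiplier_const m)
  also have "(\<lambda>x. (chi (b \<bullet> x) + chi ((- b) \<bullet> x)) * (1 / 2)) = (\<lambda>x. of_real (cos (2 * pi * (x \<bullet> b))))"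
    by (simp add: fun_eq_iff chi_cos_sin inner_commute)
  finally show "coefficient_multiplier (\<lambda>x. of_real (cos (2 * pi * (x \<bullet> b))))" .
  have "coefficient_multiplier (\<lambda>x. (chi (b \<bullet> x) + (- 1) * chi ((- b) \<bullet> x)) * (\<i> / 2))"
    by (intro coefficient_multiplier_mult coefficient_multiplier_add coefficient_multiplier_const m)
  also have "(\<lambda>x. (chi (b \<bullet> x) + (- 1) * chi ((- b) \<bullet> x)) * (\<i> / 2)) = (\<lambda>x. of_real (sin (2 * pi * (x \<bullet> b))))"
    by (simp add: fun_eq_iff chi_cos_sin inner_commute field_simps)
  finally show "coefficient_multiplier (\<lambda>x. of_real (sin (2 * pi * (x \<bullet> b))))" .
qed

lemma coefficient_multiplier_polynomial:
  fixes g :: "'a::euclidean_space \<times> 'a \<Rightarrow> real"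
  assumes "real_polynomial_function g"
  shows "coefficient_multiplier (\<lambda>x. of_real (g (torus_map x)))"
  using assms
proof induction
  case (linear f)
  interpret f: bounded_linear f by fact
  have "f (torus_map x) = (\<Sum>b\<in>Basis. cos (2 * pi * (x \<bullet> b)) * f (b, 0)) + (\<Sum>b\<in>Basis. sin (2 * pi * (x \<bullet> b)) * f (0, b))" for x :: 'a
  proof -
    have "torus_map x = (\<Sum>b\<in>Basis. cos (2 * pi * (x \<bullet> b)) *\<^sub>R (b, 0)) + (\<Sum>b\<in>Basis. sin (2 * pi * (x \<bullet> b)) *\<^sub>R (0, b))"
      by (simp add: torus_map_def prod_eq_iff fst_sum snd_sum)
    then show ?thesis by (simp only: f.add f.sum f.scaleR real_scaleR_def)
  qed
  then have eq: "(\<lambda>x. complex_of_real (f (torus_map x))) =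
     (\<lambda>x. (\<Sum>b\<in>Basis. of_real (cos (2 * pi * (x \<bullet> b))) * of_real (f (b, 0))) + (\<Sum>b\<in>Basis. of_real (sin (2 * pi * (x \<bullet> b))) * of_real (f (0, b))))"
    by (simp add: fun_eq_iff)
  show ?case unfolding eq
    by (intro coefficient_multiplier_add coefficient_multiplier_sum coefficient_multiplier_mult
        coefficient_multiplier_cos_sin coefficient_multiplier_const) auto
qed (simp_all add: coefficient_multiplier_add coefficient_multiplier_mult coefficient_multiplier_const)

lemma continuous_on_torus_map: "continuous_on S torus_map"
  unfolding torus_map_def[abs_def] by (intro continuous_intros)

lemma torus_map_eqD:
  assumes "torus_map x = torus_map y"
  shows "x - y \<in> int_lattice"
  unfolding int_lattice_def
proof (safe)
  fix b :: 'a assume b: "b \<in> Basis"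
  have "fst (torus_map x) \<bullet> b = fst (torus_map y) \<bullet> b" "snd (torus_map x) \<bullet> b = snd (torus_map y) \<bullet> b"
    using assms by auto
  then have "cos (2 * pi * (x \<bullet> b)) = cos (2 * pi * (y \<bullet> b))" "sin (2 * pi * (x \<bullet> b)) = sin (2 * pi * (y \<bullet> b))"
    using b by (simp_all add: torus_map_def)
  then obtain n :: int where "2 * pi * (x \<bullet> b) = 2 * pi * (y \<bullet> b) + 2 * pi * of_int n"
    using sin_cos_eq_iff[of "2 * pi * (x \<bullet> b)" "2 * pi * (y \<bullet> b)"] by (auto simp: mult_ac)
  then have "2 * pi * (x \<bullet> b) = 2 * pi * (y \<bullet> b + of_int n)" by (simp add: ring_distribs)
  then have "(x - y) \<bullet> b = of_int n" by (simp add: inner_diff_left)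
  then show "(x - y) \<bullet> b \<in> \<int>" by simp
qed

text \<open>A periodic continuous function descends to the compact torus, where it can be approximated
  by polynomials, that is, by trigonometric polynomials upstairs.\<close>

lemma trigonometric_approximation:
  fixes D :: "'a::euclidean_space \<Rightarrow> complex"
  assumes cont: "continuous_on UNIV D" and per: "\<And>l x. l \<in> int_lattice \<Longrightarrow> D (l + x) = D x"
    and e: "e > 0"
  obtains p where "coefficient_multiplier p" "continuous_on UNIV p" "\<And>x. x \<in> unit_cube \<Longrightarrow> cmod (cnj (D x) - p x) < e"
proof -
  define K where "K = cbox 0 (One::'a)"
  \<comment> \<open>\<open>inv_into\<close> may pick any preimage in \<open>K\<close>: two preimages
    differ by a lattice vector, so by periodicity \<open>f\<close> does not depend on the
    choice.\<close>
  define f where "f z = D (inv_into K torus_map z)" for z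
  have f: "f (torus_map x) = D x" if "x \<in> K" for x
  proof -
    have "torus_map (inv_into K torus_map (torus_map x)) = torus_map x"
      using that by (intro f_inv_into_f) auto
    from torus_map_eqD[OF this] per[of "inv_into K torus_map (torus_map x) - x" x]
    show ?thesis by (simp add: f_def)
  qed
  have K: "compact K" by (simp add: K_def)
  have comp: "compact (torus_map ` K)"
    by (intro compact_continuous_image continuous_on_torus_map K)
  \<comment> \<open>By compactness of \<open>K\<close>, \<open>torus_map\<close> sends closed
    subsets of \<open>K\<close> to closed sets, so continuity passes to the quotient.\<close>
  have "continuous_on (torus_map ` K) f"
    unfolding continuous_on_closed_vimage[OF compact_imp_closed[OF comp]]
  proof (intro allI impI)
    fix B :: "complex set" assume B: "closed B"
    have "f -` B \<inter> torus_map ` K = torus_map ` (D -` B \<inter> K)" using f by auto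
    moreover have "closed (D -` B)" using cont B by (auto simp: continuous_on_closed_vimage)
    ultimately show "closed (f -` B \<inter> torus_map ` K)"
      using K by (simp add: closed_Int_compact compact_continuous_image continuous_on_torus_map compact_imp_closed)
  qed
  from Stone_Weierstrass_polynomial_function[OF comp this e]
  obtain g where g: "polynomial_function g" "\<And>x. x \<in> K \<Longrightarrow> cmod (D x - g (torus_map x)) < e"
    using f by auto
  have poly: "real_polynomial_function (\<lambda>z. Re (g z))" "real_polynomial_function (\<lambda>z. Im (g z))"
    using g(1) bounded_linear_Re bounded_linear_Im by (auto simp: polynomial_function_def o_def)
  \<comment> \<open>The conjugate is wanted because pairing it with \<open>D\<close> is to produce
    the squared modulus.\<close>
  define p where "p x = of_real (Re (g (torus_map x))) + (- \<i>) * of_real (Im (g (torus_map x)))" for x :: 'a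
  have p: "p x = cnj (g (torus_map x))" for x by (simp add: p_def complex_eq_iff)
  show thesis
  proof
    show "coefficient_multiplier p" unfolding p_def[abs_def]
      by (intro coefficient_multiplier_add coefficient_multiplier_mult coefficient_multiplier_const
          coefficient_multiplier_polynomial poly)
    have "continuous_on UNIV (\<lambda>x. g (torus_map x))"
      using g(1) continuous_on_compose2[OF continuous_on_polymonial_function[of g UNIV] continuous_on_torus_map] by auto
    then show "continuous_on UNIV p" unfolding p[abs_def] by (intro continuous_intros)
    fix x :: 'a assume "x \<in> unit_cube"
    then have "x \<in> K" by (auto simp: K_def unit_cube_def mem_box less_imp_le)
    moreover have "cmod (cnj (D x) - p x) = cmod (D x - g (torus_map x))"
      unfolding p by (metis complex_cnj_diff complex_mod_cnj)
    ultimately show "cmod (cnj (D x) - p x) < e" using g(2) by simp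
  qed
qed

text \<open>\<open>D\<close> is orthogonal to trigonometric polynomials, among them uniform
  approximants of its own conjugate on the cube, so the integral of its squared modulus vanishes.
  Continuity and periodicity turn this into pointwise vanishing.\<close>

theorem fourier_coefficients_unique:
  fixes D :: "'a::euclidean_space \<Rightarrow> complex"
  assumes D: "vanishing_coefficients D" and per: "\<And>l x. l \<in> int_lattice \<Longrightarrow> D (l + x) = D x"
  shows "D x = 0"
proof -
  have cont: "continuous_on UNIV D" using D by (simp add: vanishing_coefficients_def)
  define I where "I = (\<integral>x. D x * cnj (D x) * indicator unit_cube x \<partial>lborel)"
  define M where "M = (\<integral>x. cmod (D x * indicator unit_cube x) \<partial>lborel)"
  have M: "M \<ge> 0" unfolding M_def by (intro Bochner_Integration.integral_nonneg) auto
  have int: "integrable lborel (\<lambda>x. D x * indicator unit_cube x)"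
    by (rule integrable_unit_cube[OF cont])
  have le: "cmod I \<le> M * e" if e: "e > 0" for e
  proof -
    obtain p where p: "coefficient_multiplier p" "continuous_on UNIV p" "\<And>x. x \<in> unit_cube \<Longrightarrow> cmod (cnj (D x) - p x) < e"
      using trigonometric_approximation[OF cont per e] by blast
    have "vanishing_coefficients (\<lambda>x. D x * p x)" using p(1) D by (simp add: coefficient_multiplier_def)
    then have z: "(\<integral>x. D x * p x * indicator unit_cube x \<partial>lborel) = 0"
      using int_lattice_0 by (fastforce simp: vanishing_coefficients_def)
    have "I = (\<integral>x. D x * cnj (D x) * indicator unit_cube x - D x * p x * indicator unit_cube x \<partial>lborel)"
      unfolding I_def using cont p(2)
      by (subst Bochner_Integration.integral_diff) (auto simp: z intro!: integrable_unit_cube continuous_intros)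
    also have "cmod \<dots> \<le> (\<integral>x. cmod (D x * indicator unit_cube x) * e \<partial>lborel)"
    proof (rule order_trans[OF integral_norm_bound], rule integral_mono_AE')
      show "integrable lborel (\<lambda>x. cmod (D x * indicator unit_cube x) * e)"
        using int by (intro integrable_mult_left integrable_norm)
      show "AE x in lborel. cmod (D x * cnj (D x) * indicator unit_cube x - D x * p x * indicator unit_cube x)
          \<le> cmod (D x * indicator unit_cube x) * e"
      proof (rule AE_I2)
        fix x :: 'a
        have "D x * cnj (D x) * indicator unit_cube x - D x * p x * indicator unit_cube x
           = D x * indicator unit_cube x * ((cnj (D x) - p x) * indicator unit_cube x)"
          by (auto simp: algebra_simps split: split_indicator)
        moreover have "cmod ((cnj (D x) - p x) * indicator unit_cube x) \<le> e"
          using p(3)[of x] e by (auto simp: less_imp_le split: split_indicator)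
        ultimately show "cmod (D x * cnj (D x) * indicator unit_cube x - D x * p x * indicator unit_cube x)
          \<le> cmod (D x * indicator unit_cube x) * e"
          by (metis norm_mult mult_left_mono norm_ge_zero)
      qed
      show "AE x in lborel. 0 \<le> cmod (D x * indicator unit_cube x) * e" using e by auto
    qed
    finally show ?thesis by (simp add: M_def)
  qed
  have "cmod I \<le> 0"
  proof (rule field_le_epsilon)
    fix e :: real assume "e > 0"
    then have "cmod I \<le> M * (e / (M + 1))" using M by (intro le) auto
    also have "\<dots> \<le> e" using M \<open>e > 0\<close> by (simp add: field_simps)
    finally show "cmod I \<le> 0 + e" by simp
  qed
  moreover have "I = of_real (\<integral>x. (cmod (D x))\<^sup>2 * indicator unit_cube x \<partial>lborel)"
    unfolding I_def by (subst integral_complex_of_real[symmetric])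
      (auto intro!: Bochner_Integration.integral_cong simp: complex_norm_square[symmetric] split: split_indicator)
  ultimately have zero: "(\<integral>x. (cmod (D x))\<^sup>2 * indicator unit_cube x \<partial>lborel) = 0" by (metis norm_le_zero_iff of_real_eq_0_iff)
  let ?h = "\<lambda>x. (cmod (D x))\<^sup>2"
  have conth: "continuous_on UNIV ?h" using cont by (intro continuous_intros)
  \<comment> \<open>The half-open cube lies between the open and the closed box; on the closed box a
    continuous nonnegative function with zero integral vanishes identically.\<close>
  have cube: "box 0 One \<subseteq> (unit_cube :: 'a set)" "(unit_cube :: 'a set) \<subseteq> cbox 0 One"
    by (auto simp: unit_cube_def mem_box less_imp_le)
  have intc: "integrable lborel (\<lambda>x. indicator (cbox 0 (One::'a)) x *\<^sub>R ?h x)"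
    by (intro borel_integrable_compact compact_cbox continuous_on_subset[OF conth]) auto
  then have si: "set_integrable lborel (cbox 0 One) ?h" by (simp add: set_integrable_def)
  have sb: "set_integrable lborel (box 0 One) ?h" "set_integrable lborel unit_cube ?h"
    using cube by (auto intro!: set_integrable_subset[OF si] box_subset_cbox)
  have "set_lebesgue_integral lborel (box 0 One) ?h \<le> (\<integral>x. ?h x * indicator unit_cube x \<partial>lborel)"
    unfolding set_lebesgue_integral_def using sb cube(1)
    by (intro integral_mono) (auto simp: set_integrable_def mult.commute split: split_indicator)
  then have "integral (box 0 One) ?h \<le> 0"
    using set_borel_integral_eq_integral(2)[OF sb(1)] zero by simp
  moreover have "0 \<le> integral (cbox 0 (One::'a)) ?h" by (intro integral_nonneg integrable_continuous continuous_on_subset[OF conth]) auto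
  ultimately have "integral (cbox 0 (One::'a)) ?h = 0"
    by (simp add: integral_open_interval)
  then have z: "D x = 0" if "x \<in> cbox 0 One" for x
    using integral_cbox_eq_0_iff[OF continuous_on_subset[OF conth], of 0 One] that by (auto simp: box_eq_empty)
  have "x - lattice_floor x \<in> unit_cube" by (simp add: diff_in_unit_cube_iff lattice_floor_in)
  then have "D (x - lattice_floor x) = 0" using z cube by blast
  then show ?thesis using per[OF lattice_floor_in, of x "x - lattice_floor x"] by simp
qed


section \<open>Periodisation and Poisson's formula\<close>

lemma integral_int_lattice_translate:
  fixes G :: "'a::euclidean_space \<Rightarrow> complex"
  assumes "a \<in> int_lattice"
  shows "(\<integral>l. G (l + a) \<partial>count_space int_lattice) = (\<integral>l. G l \<partial>count_space int_lattice)"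
proof (rule integral_bij_count_space)
  show "bij_betw (\<lambda>l. l + a) int_lattice int_lattice"
    by (rule bij_betw_byWitness[where f'="\<lambda>l. l - a"])
       (use assms in \<open>auto intro: int_lattice_add int_lattice_diff\<close>)
qed

lemma continuous_on_lattice_sum:
  fixes G :: "'a::euclidean_space \<Rightarrow> complex"
  assumes cont: "continuous_on UNIV G" and le: "\<And>x. cmod (G x) \<le> K * weight x"
  shows "continuous_on UNIV (\<lambda>u. \<integral>l. G (l + u) \<partial>count_space int_lattice)"
proof -
  have "0 \<le> cmod (G 0)" by simp
  with le[of 0] have "0 \<le> K * weight (0::'a)" by linarith
  then have K: "K \<ge> 0" using weight_pos[of "0::'a"] by (simp add: zero_le_mult_iff)
  have "continuous_on (ball 0 R) (\<lambda>u. \<integral>l. G (l + u) \<partial>count_space int_lattice)" for R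
  proof (rule continuous_on_integral_dominated)
    \<comment> \<open>The factor by which a shift of norm below \<open>R\<close> can raise the
      weight, from \<open>weight_mult_le\<close> applied to \<open>l + u\<close> and
      \<open>- u\<close>.\<close>
    define c where "c = K * (2 ^ DIM('a) * (1 + R\<^sup>2) ^ DIM('a))"
    show "integrable (count_space int_lattice) (\<lambda>l. c * weight (l::'a))"
      by (intro integrable_mult_right integrable_lattice_weight)
    fix u l :: 'a assume u: "u \<in> ball 0 R"
    have "1 / (1 + R\<^sup>2) ^ DIM('a) \<le> 1 / (1 + (norm (- u))\<^sup>2) ^ DIM('a)"
      using u by (intro divide_left_mono power_mono add_left_mono mult_pos_pos zero_less_power add_pos_nonneg) auto
    also have "\<dots> \<le> weight (- u)" by (rule weight_lower)
    finally have "weight (l + u) * (1 / (1 + R\<^sup>2) ^ DIM('a)) \<le> weight (l + u) * weight (- u)"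
      using weight_pos[of "l + u"] by (intro mult_left_mono) auto
    also have "\<dots> \<le> 2 ^ DIM('a) * weight l" using weight_mult_le[of "l + u" "- u"] by simp
    finally have "weight (l + u) \<le> 2 ^ DIM('a) * weight l * (1 + R\<^sup>2) ^ DIM('a)"
      by (simp add: divide_le_eq add_pos_nonneg)
    from mult_left_mono[OF this K] have "K * weight (l + u) \<le> c * weight l"
      unfolding c_def by (simp add: mult_ac)
    then show "norm (G (l + u)) \<le> c * weight l" using le[of "l + u"] by linarith
  next
    fix l :: 'a
    show "continuous_on (ball 0 R) (\<lambda>y. G (l + y))"
      by (rule continuous_on_compose2[OF cont]) (auto intro!: continuous_intros)
  qed auto
  then show ?thesis by (rule continuous_on_all_balls)
qed

lemma integrable_le_weight:
  fixes G :: "'a::euclidean_space \<Rightarrow> complex"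
  assumes "G \<in> borel_measurable borel" "\<And>x. cmod (G x) \<le> K * weight x"
  shows "integrable lborel G"
  by (rule Bochner_Integration.integrable_bound[OF integrable_mult_right[OF integrable_weight, of K]])
     (use assms in \<open>auto intro: order_trans[OF _ abs_ge_self]\<close>)

text \<open>\<open>P\<close> is the periodisation and \<open>Q\<close> its prospective Fourier
  series. Both are continuous and periodic with coefficients \<open>fourier G k\<close>, so they
  coincide, and the formula is their value at 0. The hypotheses ask for decay and summability rather
  than smoothness, because the window function is not shown to be smooth.\<close>

theorem poisson_summation:
  fixes G :: "'a::euclidean_space \<Rightarrow> complex"
  assumes cont: "continuous_on UNIV G" and le: "\<And>x. cmod (G x) \<le> K * weight x"
    and int: "integrable (count_space int_lattice) (fourier G)"
  shows "(\<integral>l. G l \<partial>count_space int_lattice) = (\<integral>k. fourier G k \<partial>count_space int_lattice)"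
proof -
  define P where "P u = (\<integral>l. G (l + u) \<partial>count_space int_lattice)" for u
  define Q where "Q u = (\<integral>k. fourier G k * cnj (chi (k \<bullet> u)) \<partial>count_space int_lattice)" for u :: 'a
  have Gm [measurable]: "G \<in> borel_measurable borel" by (rule borel_measurable_continuous_onI[OF cont])
  have Gi: "integrable lborel G" by (rule integrable_le_weight[OF Gm le])
  have Pc: "continuous_on UNIV P" unfolding P_def by (rule continuous_on_lattice_sum[OF cont le])
  have Qc: "continuous_on UNIV Q" unfolding Q_def
    by (rule continuous_on_integral_dominated[where w="\<lambda>k. cmod (fourier G k)"])
       (auto intro!: continuous_intros integrable_norm int simp: norm_mult)
  have inner_Ints: "k \<bullet> l \<in> \<int>" if "k \<in> int_lattice" "l \<in> int_lattice" for k l :: 'a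
    using that by (subst euclidean_inner) (auto simp: int_lattice_def intro!: Ints_sum Ints_mult)
  have coeffP: "(\<integral>u. P u * chi (k \<bullet> u) * indicator unit_cube u \<partial>lborel) = fourier G k" if k: "k \<in> int_lattice" for k
  proof -
    have "P u * chi (k \<bullet> u) = (\<integral>l. G (l + u) * chi (k \<bullet> (l + u)) \<partial>count_space int_lattice)" for u
    proof -
      have "P u * chi (k \<bullet> u) = (\<integral>l. G (l + u) * chi (k \<bullet> u) \<partial>count_space int_lattice)"
        unfolding P_def by simp
      also have "\<dots> = (\<integral>l. G (l + u) * chi (k \<bullet> (l + u)) \<partial>count_space int_lattice)"
        using inner_Ints[OF k] by (intro Bochner_Integration.integral_cong) (auto simp: inner_add_right chi_add)
      finally show ?thesis .
    qed
    then have "(\<integral>u. P u * chi (k \<bullet> u) * indicator unit_cube u \<partial>lborel) = (\<integral>x. G x * chi (k \<bullet> x) \<partial>lborel)"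
    proof (simp only:, intro integral_tiling)
      show "integrable lborel (\<lambda>x. G x * chi (k \<bullet> x))"
        by (rule Bochner_Integration.integrable_bound[OF Gi]) (auto simp: norm_mult)
    qed
    then show ?thesis by (simp add: fourier_chi)
  qed
  have coeffQ: "(\<integral>u. Q u * chi (k \<bullet> u) * indicator unit_cube u \<partial>lborel) = fourier G k" if k: "k \<in> int_lattice" for k
  proof -
    have "(\<integral>u. Q u * chi (k \<bullet> u) * indicator unit_cube u \<partial>lborel)
      = (\<integral>u. (\<integral>j. fourier G j * (chi ((k - j) \<bullet> u) * indicator unit_cube u) \<partial>count_space int_lattice) \<partial>lborel)"
    proof (intro Bochner_Integration.integral_cong refl)
      fix u
      have "Q u * (chi (k \<bullet> u) * indicator unit_cube u)
        = (\<integral>j. fourier G j * cnj (chi (j \<bullet> u)) * (chi (k \<bullet> u) * indicator unit_cube u) \<partial>count_space int_lattice)"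
        unfolding Q_def by (rule integral_mult_left_zero[symmetric])
      then show "Q u * chi (k \<bullet> u) * indicator unit_cube u
        = (\<integral>j. fourier G j * (chi ((k - j) \<bullet> u) * indicator unit_cube u) \<partial>count_space int_lattice)"
        by (simp add: inner_diff_left chi_diff mult_ac)
    qed
    also have "\<dots> = (\<integral>j. (\<integral>u. fourier G j * (chi ((k - j) \<bullet> u) * indicator unit_cube u) \<partial>lborel) \<partial>count_space int_lattice)"
    proof (intro integral_count_space_swap(3)[symmetric] countable_int_lattice sigma_finite_lborel)
      have "(\<integral>\<^sup>+u. ennreal (cmod (fourier G j * (chi ((k - j) \<bullet> u) * indicator unit_cube u))) \<partial>lborel)
        = ennreal (cmod (fourier G j))" for j
      proof -
        have "(\<integral>\<^sup>+u. ennreal (cmod (fourier G j * (chi ((k - j) \<bullet> u) * indicator unit_cube u))) \<partial>lborel)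
          = (\<integral>\<^sup>+u. ennreal (cmod (fourier G j)) * indicator (unit_cube::'a set) u \<partial>lborel)"
          by (intro nn_integral_cong) (auto simp: norm_mult split: split_indicator)
        then show ?thesis by (simp add: nn_integral_cmult_indicator emeasure_unit_cube)
      qed
      then show "(\<integral>\<^sup>+j. \<integral>\<^sup>+u. ennreal (cmod (fourier G j * (chi ((k - j) \<bullet> u) * indicator unit_cube u)))
          \<partial>lborel \<partial>count_space int_lattice) < \<infinity>"
        using int by (simp add: integrable_iff_bounded)
    qed measurable
    also have "\<dots> = (\<integral>j. fourier G k * indicator {k} j \<partial>count_space int_lattice)"
    proof (intro Bochner_Integration.integral_cong refl)
      fix j :: 'a assume "j \<in> space (count_space int_lattice)"
      then have "k - j \<in> int_lattice" using int_lattice_diff[OF k] by simp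
      from integral_chi_unit_cube[OF this]
      have "(\<integral>u. fourier G j * (chi ((k - j) \<bullet> u) * indicator unit_cube u) \<partial>lborel)
        = fourier G j * (if k - j = 0 then 1 else 0)"
        by (simp only: integral_mult_right_zero)
      then show "(\<integral>u. fourier G j * (chi ((k - j) \<bullet> u) * indicator unit_cube u) \<partial>lborel)
        = fourier G k * indicator {k} j"
        by (auto split: split_indicator)
    qed
    also have "\<dots> = fourier G k" by (rule integral_count_space_indicator[OF k])
    finally show ?thesis .
  qed
  define D where "D u = P u - Q u" for u
  have "vanishing_coefficients D"
    unfolding vanishing_coefficients_def
  proof (intro conjI ballI)
    show "continuous_on UNIV D" unfolding D_def by (intro continuous_intros Pc Qc)
    fix k :: 'a assume k: "k \<in> int_lattice"
    show "(\<integral>x. D x * chi (k \<bullet> x) * indicator unit_cube x \<partial>lborel) = 0"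
      unfolding D_def left_diff_distrib using Pc Qc
      by (subst Bochner_Integration.integral_diff)
         (auto simp: coeffP[OF k] coeffQ[OF k] intro!: integrable_unit_cube continuous_intros)
  qed
  moreover have "D (l + x) = D x" if l: "l \<in> int_lattice" for l x
  proof -
    have "P (l + x) = P x"
      using integral_int_lattice_translate[OF l, of "\<lambda>j. G (j + x)"] by (simp add: P_def add_ac)
    moreover have "Q (l + x) = Q x"
      unfolding Q_def using inner_Ints[OF _ l]
      by (intro Bochner_Integration.integral_cong) (auto simp: inner_add_right chi_add)
    ultimately show ?thesis by (simp add: D_def)
  qed
  ultimately have "D 0 = 0" by (rule fourier_coefficients_unique)
  then show ?thesis by (simp add: D_def P_def Q_def)
qed

section \<open>Schwartz functions\<close>

text \<open>The orders 0 and \<open>4 * DIM('a)\<close> suffice, since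
  \<open>(1 + r\<^sup>2) ^ m \<le> 2 ^ m * (1 + r ^ (2 * m))\<close> and
  \<open>m = 2 * DIM('a)\<close> is the power in the lower bound for the squared weight.\<close>

lemma rapid_decay_weight:
  fixes g :: "'a::euclidean_space \<Rightarrow> complex"
  assumes "\<And>k::nat. bounded (range (\<lambda>x. norm x ^ k *\<^sub>R g x))"
  shows "\<exists>K. \<forall>x. cmod (g x) \<le> K * (weight x)\<^sup>2"
proof -
  let ?n = "2 * DIM('a)"
  obtain A where A: "\<And>x. cmod (g x) \<le> A" using assms[of 0] by (auto simp: bounded_iff)
  obtain B where B: "\<And>x. norm x ^ (2 * ?n) * cmod (g x) \<le> B" using assms[of "2 * ?n"] by (auto simp: bounded_iff)
  have "cmod (g x) \<le> 2 ^ ?n * (A + B) * (weight x)\<^sup>2" for x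
  proof -
    have "(1 + (norm x)\<^sup>2) ^ ?n \<le> 2 ^ ?n * (1 + norm x ^ (2 * ?n))"
    proof (cases "norm x \<le> 1")
      case True
      then have "(norm x)\<^sup>2 \<le> 1" by (simp add: power_le_one)
      then have "(1 + (norm x)\<^sup>2) ^ ?n \<le> 2 ^ ?n" by (intro power_mono) auto
      also have "\<dots> \<le> 2 ^ ?n * (1 + norm x ^ (2 * ?n))" by simp
      finally show ?thesis .
    next
      case False
      then have "1 \<le> (norm x)\<^sup>2" by (simp add: one_le_power)
      then have "(1 + (norm x)\<^sup>2) ^ ?n \<le> (2 * (norm x)\<^sup>2) ^ ?n" by (intro power_mono) auto
      also have "\<dots> = 2 ^ ?n * norm x ^ (2 * ?n)" by (simp only: power_mult_distrib power_mult)
      also have "\<dots> \<le> 2 ^ ?n * (1 + norm x ^ (2 * ?n))" by simp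
      finally show ?thesis .
    qed
    then have "cmod (g x) * (1 + (norm x)\<^sup>2) ^ ?n \<le> cmod (g x) * (2 ^ ?n * (1 + norm x ^ (2 * ?n)))"
      by (rule mult_left_mono) simp
    also have "\<dots> = 2 ^ ?n * (cmod (g x) + norm x ^ (2 * ?n) * cmod (g x))" by (simp add: algebra_simps)
    also have "\<dots> \<le> 2 ^ ?n * (A + B)" using A[of x] B[of x] by (intro mult_left_mono add_mono) auto
    finally have "cmod (g x) * (1 + (norm x)\<^sup>2) ^ ?n * (weight x)\<^sup>2 \<le> 2 ^ ?n * (A + B) * (weight x)\<^sup>2"
      by (rule mult_right_mono) simp
    moreover have "cmod (g x) * 1 \<le> cmod (g x) * ((1 + (norm x)\<^sup>2) ^ ?n * (weight x)\<^sup>2)"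
      by (intro mult_left_mono weight_Sup_norm) auto
    ultimately show ?thesis by (simp add: mult.assoc)
  qed
  then show ?thesis by blast
qed

lemma weight_square_le: "(weight x)\<^sup>2 \<le> weight x"
  using weight_pos[of x] weight_le_1[of x] by (simp add: power2_eq_square mult_left_le)

lemma schwartz_decay:
  assumes "schwartz f"
  obtains K where "\<And>x. cmod (f x) \<le> K * (weight x)\<^sup>2"
proof -
  have "bounded (range (\<lambda>x. norm x ^ k *\<^sub>R f x))" for k
    using assms unfolding schwartz_def by (auto dest: spec[of _ "[]"])
  from rapid_decay_weight[OF this] that show thesis by blast
qed

lemma schwartz_differentiable:
  assumes "schwartz f"
  shows "f differentiable (at x)"
proof -
  have "f differentiable_on UNIV"
    using assms unfolding schwartz_def by (auto dest: spec[of _ "[]"])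
  then show ?thesis by (simp add: differentiable_on_def)
qed

lemma schwartz_continuous: "schwartz f \<Longrightarrow> continuous_on S f"
  by (meson continuous_at_imp_continuous_on differentiable_imp_continuous_within schwartz_differentiable)

lemma schwartz_measurable: "schwartz f \<Longrightarrow> f \<in> borel_measurable borel"
  by (intro borel_measurable_continuous_onI schwartz_continuous)

lemma weighted_square_bound_nonneg:
  fixes x :: "'a::euclidean_space"
  assumes "cmod z \<le> K * (weight x)\<^sup>2"
  shows "K \<ge> 0"
proof -
  have "0 \<le> K * (weight x)\<^sup>2" using assms norm_ge_zero[of z] by linarith
  then show ?thesis using weight_pos[of x] by (simp add: zero_le_mult_iff)
qed

lemma integrable_le_weight_square:
  fixes f :: "'a::euclidean_space \<Rightarrow> complex"
  assumes "f \<in> borel_measurable borel" and le: "\<And>x. cmod (f x) \<le> K * (weight x)\<^sup>2"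
  shows "integrable lborel f"
proof (rule integrable_le_weight[OF assms(1)])
  have "K \<ge> 0" using weighted_square_bound_nonneg[OF le[of 0]] .
  then show "cmod (f x) \<le> K * weight x" for x
    using le[of x] mult_left_mono[OF weight_square_le[of x]] by (rule_tac order_trans) auto
qed

lemma schwartz_integrable: "schwartz f \<Longrightarrow> integrable lborel f"
  using integrable_le_weight_square[OF schwartz_measurable] schwartz_decay by metis

text \<open>The head of the list is differentiated last, so an innermost derivative sits at its end;
  closure of the Schwartz class under derivatives rests on this.\<close>

lemma iterated_deriv_snoc:
  "iterated_deriv (vs @ [v]) f = iterated_deriv vs (iterated_deriv [v] f)"
  by (induction vs) auto

lemma schwartz_deriv:
  assumes f: "schwartz f" and v: "v \<in> Basis"
  shows "schwartz (\<lambda>x. frechet_derivative f (at x) v)"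
  unfolding schwartz_def
proof (intro allI impI)
  fix vs :: "'a list" assume "set vs \<subseteq> Basis"
  then have "set (vs @ [v]) \<subseteq> Basis" using v by auto
  moreover have "iterated_deriv vs (\<lambda>x. frechet_derivative f (at x) v) = iterated_deriv (vs @ [v]) f"
    by (simp add: iterated_deriv_snoc)
  ultimately show "iterated_deriv vs (\<lambda>x. frechet_derivative f (at x) v) differentiable_on UNIV \<and>
     (\<forall>k. bounded (range (\<lambda>x. norm x ^ k *\<^sub>R iterated_deriv vs (\<lambda>x. frechet_derivative f (at x) v) x)))"
    using f unfolding schwartz_def by metis
qed

lemma schwartz_has_derivative_line:
  assumes "schwartz f"
  shows "((\<lambda>s. f (x + s *\<^sub>R v)) has_derivative (\<lambda>h. h *\<^sub>R frechet_derivative f (at (x + s *\<^sub>R v)) v)) (at s)"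
proof -
  have d: "(f has_derivative frechet_derivative f (at (x + s *\<^sub>R v))) (at (x + s *\<^sub>R v))"
    using schwartz_differentiable[OF assms] frechet_derivative_works by blast
  have "((\<lambda>s. x + s *\<^sub>R v) has_derivative (\<lambda>h. h *\<^sub>R v)) (at s)"
    by (auto intro!: derivative_eq_intros)
  from has_derivative_compose[OF this d]
  show ?thesis by (simp add: linear_scale[OF linear_frechet_derivative[OF schwartz_differentiable[OF assms]]])
qed

lemma weight_segment:
  fixes x v :: "'a::euclidean_space"
  assumes "norm v \<le> 1"
  shows "weight (x + v) \<le> 4 ^ DIM('a) * weight x"
proof -
  have "(norm v)\<^sup>2 \<le> 1" using assms by (simp add: power_le_one)
  then have "1 / 2 ^ DIM('a) \<le> 1 / (1 + (norm (- v))\<^sup>2) ^ DIM('a)"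
    by (intro divide_left_mono power_mono mult_pos_pos zero_less_power add_pos_nonneg) auto
  also have "\<dots> \<le> weight (- v)" by (rule weight_lower)
  finally have "weight (x + v) * (1 / 2 ^ DIM('a)) \<le> weight (x + v) * weight (- v)"
    using weight_pos[of "x + v"] by (intro mult_left_mono) auto
  also have "\<dots> \<le> 2 ^ DIM('a) * weight x" using weight_mult_le[of "x + v" "- v"] by simp
  finally have "weight (x + v) \<le> 2 ^ DIM('a) * 2 ^ DIM('a) * weight x" by (simp add: divide_le_eq mult_ac)
  then show ?thesis by (simp add: power_mult_distrib[symmetric])
qed

section \<open>Decay of Fourier transforms of Schwartz functions\<close>

lemma has_vector_derivative_quotient:
  fixes g :: "real \<Rightarrow> 'b::real_normed_vector"
  assumes "(g has_vector_derivative d) (at 0)"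
  shows "((\<lambda>s. (g s - g 0) /\<^sub>R s) \<longlongrightarrow> d) (at 0)"
proof -
  have "((\<lambda>s. norm (g s - g 0 - s *\<^sub>R d) / \<bar>s\<bar>) \<longlongrightarrow> 0) (at 0)"
    using assms unfolding has_vector_derivative_def has_derivative_iff_norm by simp
  moreover have "\<forall>\<^sub>F s in at 0. norm (g s - g 0 - s *\<^sub>R d) / \<bar>s\<bar> = norm ((g s - g 0) /\<^sub>R s - d)"
  proof (rule eventually_at_topological[THEN iffD2], intro exI[of _ UNIV] conjI ballI impI)
    fix s :: real assume "s \<noteq> 0"
    then have "(g s - g 0) /\<^sub>R s - d = (g s - g 0 - s *\<^sub>R d) /\<^sub>R s" by (simp add: scaleR_diff_right)
    then show "norm (g s - g 0 - s *\<^sub>R d) / \<bar>s\<bar> = norm ((g s - g 0) /\<^sub>R s - d)"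
      by (simp add: divide_inverse mult.commute)
  qed auto
  ultimately have "((\<lambda>s. norm ((g s - g 0) /\<^sub>R s - d)) \<longlongrightarrow> 0) (at 0)"
    by (rule Lim_transform_eventually)
  then show ?thesis by (simp add: tendsto_norm_zero_iff LIM_zero_iff)
qed
text \<open>Translation invariance replaces integration by parts: the transform of a difference
  quotient is computed exactly by a shift, and then the step size tends to 0, by dominated
  convergence on one side and by differentiating a character on the other.\<close>

lemma fourier_deriv:
  fixes f :: "'a::euclidean_space \<Rightarrow> complex"
  assumes f: "schwartz f" and v: "v \<in> Basis"
  shows "fourier (\<lambda>x. frechet_derivative f (at x) v) t = 2 * of_real pi * \<i> * of_real (t \<bullet> v) * fourier f t"
proof -
  let ?d = "\<lambda>x. frechet_derivative f (at x) v"
  define h where "h n = inverse (real (Suc n))" for n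
  have h: "h n > 0" "h n \<le> 1" for n by (auto simp: h_def field_simps)
  have h0: "h \<longlonglongrightarrow> 0" unfolding h_def by (rule LIMSEQ_inverse_real_of_nat)
  have hat: "filterlim h (at 0) sequentially"
    unfolding filterlim_at using h0 h(1) by (simp add: less_imp_neq[THEN not_sym])
  obtain K where K: "\<And>x. cmod (?d x) \<le> K * (weight x)\<^sup>2" using schwartz_decay[OF schwartz_deriv[OF f v]] by blast
  have K0: "K \<ge> 0" using weighted_square_bound_nonneg[OF K] .
  have fm [measurable]: "f \<in> borel_measurable borel" by (rule schwartz_measurable[OF f])
  have dm [measurable]: "?d \<in> borel_measurable borel" by (rule schwartz_measurable[OF schwartz_deriv[OF f v]])
  define q where "q n x = (f (x + h n *\<^sub>R v) - f x) / of_real (h n)" for n x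
  have lim1: "(\<lambda>n. \<integral>x. q n x * chi (t \<bullet> x) \<partial>lborel) \<longlonglongrightarrow> (\<integral>x. ?d x * chi (t \<bullet> x) \<partial>lborel)"
  proof (rule integral_dominated_convergence[where w="\<lambda>x. K * (4 ^ DIM('a) * weight x)"])
    show "integrable lborel (\<lambda>x::'a. K * (4 ^ DIM('a) * weight x))"
      by (intro integrable_mult_right integrable_weight)
    show "AE x in lborel. (\<lambda>n. q n x * chi (t \<bullet> x)) \<longlonglongrightarrow> ?d x * chi (t \<bullet> x)"
    proof (intro AE_I2 tendsto_mult tendsto_const)
      fix x :: 'a
      have "((\<lambda>s. f (x + s *\<^sub>R v)) has_vector_derivative ?d x) (at 0)"
        using schwartz_has_derivative_line[OF f, of x v 0] by (simp add: has_vector_derivative_def)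
      then have "((\<lambda>s. (f (x + s *\<^sub>R v) - f x) /\<^sub>R s) \<longlongrightarrow> ?d x) (at 0)"
        using has_vector_derivative_quotient by fastforce
      from filterlim_compose[OF this hat]
      show "(\<lambda>n. q n x) \<longlonglongrightarrow> ?d x" by (simp add: q_def scaleR_conv_of_real divide_inverse mult.commute)
    qed
    fix n
    show "AE x in lborel. norm (q n x * chi (t \<bullet> x)) \<le> K * (4 ^ DIM('a) * weight x)"
    proof (rule AE_I2)
      fix x :: 'a
      \<comment> \<open>The mean value inequality puts the difference quotient below the derivative
        at a point within distance 1, where \<open>weight_segment\<close> compares weights uniformly
        in \<open>n\<close>.\<close>
      have "\<exists>s\<in>{0<..<h n}. norm (f (x + h n *\<^sub>R v) - f (x + 0 *\<^sub>R v)) \<le> norm ((h n - 0) *\<^sub>R ?d (x + s *\<^sub>R v))"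
        using h(1)[of n]
      proof (rule mvt_general)
        show "continuous_on {0..h n} (\<lambda>s. f (x + s *\<^sub>R v))"
          by (intro continuous_on_compose2[OF schwartz_continuous[OF f, of UNIV]] continuous_intros) auto
      qed (rule schwartz_has_derivative_line[OF f])
      then obtain s where s: "0 < s" "s < h n" "norm (f (x + h n *\<^sub>R v) - f x) \<le> h n * norm (?d (x + s *\<^sub>R v))"
        using h(1)[of n] by auto
      have "norm (q n x * chi (t \<bullet> x)) \<le> norm (?d (x + s *\<^sub>R v))"
        using s h(1)[of n] by (simp add: q_def norm_mult norm_divide divide_le_eq mult.commute)
      also have "\<dots> \<le> K * weight (x + s *\<^sub>R v)"
        using K[of "x + s *\<^sub>R v"] mult_left_mono[OF weight_square_le[of "x + s *\<^sub>R v"] K0] by linarith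
      also have "\<dots> \<le> K * (4 ^ DIM('a) * weight x)"
        using s h(2)[of n] v K0 by (intro mult_left_mono weight_segment) auto
      finally show "norm (q n x * chi (t \<bullet> x)) \<le> K * (4 ^ DIM('a) * weight x)" .
    qed
  qed (auto simp: q_def)
  have fi: "integrable lborel (\<lambda>x. f x * chi (t \<bullet> x))"
    by (rule Bochner_Integration.integrable_bound[OF schwartz_integrable[OF f]]) (auto simp: norm_mult)
  have q: "(\<integral>x. q n x * chi (t \<bullet> x) \<partial>lborel) = (chi (- (h n * (t \<bullet> v))) - 1) / of_real (h n) * fourier f t" for n
  proof -
    define F where "F x = f x * (chi (t \<bullet> x) * chi (- (h n * (t \<bullet> v))))" for x
    have F: "f (x + h n *\<^sub>R v) * chi (t \<bullet> x) = F (h n *\<^sub>R v + x)" for x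
      by (simp add: F_def chi_add[symmetric] inner_add_right add.commute)
    have Fi: "integrable lborel F"
      unfolding F_def by (rule Bochner_Integration.integrable_bound[OF schwartz_integrable[OF f]]) (auto simp: norm_mult)
    have Fi': "integrable lborel (\<lambda>x. F (h n *\<^sub>R v + x))"
      using Fi by (subst (asm) lborel_distr_plus[of "h n *\<^sub>R v", symmetric])
        (simp add: integrable_distr_eq F_def[abs_def])
    have "(\<integral>x. q n x * chi (t \<bullet> x) \<partial>lborel) = (\<integral>x. (F (h n *\<^sub>R v + x) - f x * chi (t \<bullet> x)) / of_real (h n) \<partial>lborel)"
      by (intro Bochner_Integration.integral_cong refl) (simp add: q_def F[symmetric] left_diff_distrib)
    also have "\<dots> = ((\<integral>x. F (h n *\<^sub>R v + x) \<partial>lborel) - fourier f t) / of_real (h n)"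
      by (simp add: Bochner_Integration.integral_diff[OF Fi' fi] fourier_chi)
    also have "(\<integral>x. F (h n *\<^sub>R v + x) \<partial>lborel) = (\<integral>x. F x \<partial>lborel)"
      by (intro integral_lborel_translate) (auto simp: F_def[abs_def])
    also have "\<dots> = fourier f t * chi (- (h n * (t \<bullet> v)))"
      unfolding F_def fourier_chi mult.assoc[symmetric] by (rule integral_mult_left_zero)
    finally show ?thesis by (simp add: field_simps)
  qed
  have "((\<lambda>s. chi (- (s * (t \<bullet> v)))) has_vector_derivative 2 * of_real pi * \<i> * of_real (t \<bullet> v)) (at 0)"
  proof -
    have "((\<lambda>z. exp (2 * of_real pi * \<i> * of_real (t \<bullet> v) * z)) has_field_derivative 2 * of_real pi * \<i> * of_real (t \<bullet> v)) (at (of_real 0))"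
      by (auto intro!: derivative_eq_intros)
    from has_vector_derivative_real_field[OF this] show ?thesis by (simp add: chi_def mult_ac)
  qed
  then have "((\<lambda>s. (chi (- (s * (t \<bullet> v))) - 1) /\<^sub>R s) \<longlongrightarrow> 2 * of_real pi * \<i> * of_real (t \<bullet> v)) (at 0)"
    using has_vector_derivative_quotient by fastforce
  from filterlim_compose[OF this hat]
  have "(\<lambda>n. (chi (- (h n * (t \<bullet> v))) - 1) / of_real (h n) * fourier f t) \<longlonglongrightarrow> 2 * of_real pi * \<i> * of_real (t \<bullet> v) * fourier f t"
    by (intro tendsto_mult tendsto_const) (simp add: scaleR_conv_of_real divide_inverse mult.commute)
  then have "(\<lambda>n. \<integral>x. q n x * chi (t \<bullet> x) \<partial>lborel) \<longlonglongrightarrow> 2 * of_real pi * \<i> * of_real (t \<bullet> v) * fourier f t"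
    by (simp add: q)
  from LIMSEQ_unique[OF lim1 this] show ?thesis by (simp add: fourier_chi)
qed

lemma fourier_norm_le: "cmod (fourier f t) \<le> (\<integral>x. cmod (f x) \<partial>lborel)"
  unfolding fourier_chi using integral_norm_bound[of lborel "\<lambda>x. f x * chi (t \<bullet> x)"] by (simp add: norm_mult)

lemma fourier_component_decay:
  fixes f :: "'a::euclidean_space \<Rightarrow> complex"
  assumes f: "schwartz f" and v: "v \<in> Basis"
  shows "\<exists>C. \<forall>t. \<bar>t \<bullet> v\<bar> ^ k * cmod (fourier f t) \<le> C"
  using f
proof (induction k arbitrary: f)
  case 0 then show ?case using fourier_norm_le by auto
next
  case (Suc k)
  from Suc.IH[OF schwartz_deriv[OF Suc.prems v]]
  obtain C where C: "\<And>t. \<bar>t \<bullet> v\<bar> ^ k * cmod (fourier (\<lambda>x. frechet_derivative f (at x) v) t) \<le> C" by blast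
  have "\<bar>t \<bullet> v\<bar> ^ Suc k * cmod (fourier f t) \<le> C / (2 * pi)" for t
    using C[of t] unfolding fourier_deriv[OF Suc.prems v]
    by (simp add: norm_mult field_simps)
  then show ?case by blast
qed

lemma fourier_decay:
  fixes f :: "'a::euclidean_space \<Rightarrow> complex"
  assumes f: "schwartz f"
  obtains K where "\<And>t. cmod (fourier f t) \<le> K * (weight t)\<^sup>2"
proof -
  have "bounded (range (\<lambda>t. norm t ^ k *\<^sub>R fourier f t))" for k
  proof -
    obtain C where C: "\<And>v t. v \<in> Basis \<Longrightarrow> \<bar>t \<bullet> v\<bar> ^ k * cmod (fourier f t) \<le> C v"
      using fourier_component_decay[OF f, of _ k] by metis
    have "norm (norm t ^ k *\<^sub>R fourier f t) \<le> real DIM('a) ^ k * (\<Sum>v\<in>Basis. C v)" for t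
    proof -
      \<comment> \<open>The largest coordinate controls the norm up to the factor
        \<open>DIM('a)\<close>, which reduces powers of the norm to powers of one
        coordinate.\<close>
      define M where "M = Max ((\<lambda>b. \<bar>t \<bullet> b\<bar>) ` Basis)"
      have "M \<in> (\<lambda>b. \<bar>t \<bullet> b\<bar>) ` Basis" unfolding M_def by (intro Max_in) auto
      then obtain b where b: "b \<in> Basis" "M = \<bar>t \<bullet> b\<bar>" by auto
      have "norm t \<le> (\<Sum>b\<in>Basis. \<bar>t \<bullet> b\<bar>)" by (rule norm_le_l1)
      also have "\<dots> \<le> (\<Sum>b\<in>(Basis::'a set). M)" unfolding M_def by (intro sum_mono Max_ge) auto
      finally have "norm t ^ k \<le> (real DIM('a) * M) ^ k" by (intro power_mono) auto
      then have "norm t ^ k * cmod (fourier f t) \<le> real DIM('a) ^ k * (M ^ k * cmod (fourier f t))"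
        using mult_right_mono[of "norm t ^ k" "(real DIM('a) * M) ^ k" "cmod (fourier f t)"]
        by (simp add: power_mult_distrib mult.assoc)
      also have "M ^ k * cmod (fourier f t) \<le> C b" using C[OF b(1), of t] b(2) by simp
      also have "C b \<le> (\<Sum>v\<in>Basis. C v)"
      proof (rule member_le_sum[OF b(1)])
        show "0 \<le> C v" if "v \<in> Basis - {b}" for v
          using C[of v 0] that by (rule_tac order_trans[of _ "\<bar>0 \<bullet> v\<bar> ^ k * cmod (fourier f 0)"]) auto
      qed auto
      finally show ?thesis by (simp add: mult_left_mono)
    qed
    then show ?thesis by (auto simp: bounded_iff)
  qed
  from rapid_decay_weight[OF this] that show thesis by blast
qed

lemma fourier_measurable: "integrable lborel f \<Longrightarrow> fourier f \<in> borel_measurable borel"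
  by (intro borel_measurable_continuous_onI continuous_on_fourier)

section \<open>The cut-and-project scheme\<close>

lemma integral_lborel_affine:
  fixes g :: "'a::euclidean_space \<Rightarrow> complex"
  assumes [measurable]: "g \<in> borel_measurable borel" and c: "c > 0"
  shows "(\<integral>x. g x \<partial>lborel) = of_real (c ^ DIM('a)) * (\<integral>x. g (a + c *\<^sub>R x) \<partial>lborel)"
proof -
  have "(\<integral>x. g x \<partial>lborel) = (\<integral>x. g x \<partial>density (distr lborel borel (\<lambda>x. a + c *\<^sub>R x)) (\<lambda>_. ennreal (\<bar>c\<bar> ^ DIM('a))))"
    using c by (subst lborel_affine[of c a]) auto
  also have "\<dots> = (\<integral>x. \<bar>c\<bar> ^ DIM('a) *\<^sub>R g x \<partial>distr lborel borel (\<lambda>x. a + c *\<^sub>R x))"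
    by (subst integral_density) auto
  also have "\<dots> = (\<integral>x. \<bar>c\<bar> ^ DIM('a) *\<^sub>R g (a + c *\<^sub>R x) \<partial>lborel)"
    by (subst integral_distr) auto
  finally show ?thesis using c by (simp add: scaleR_conv_of_real)
qed

lemma weight_uminus [simp]: "weight (- x) = weight x"
  by (simp add: weight_def)

lemma weight_le_scaleR:
  fixes x :: "'a::euclidean_space"
  shows "weight x \<le> (1 + t\<^sup>2) ^ DIM('a) * weight (t *\<^sub>R x)"
proof -
  have "weight x \<le> (\<Prod>b\<in>(Basis::'a set). (1 + t\<^sup>2) * (1 / (1 + ((t *\<^sub>R x) \<bullet> b)\<^sup>2)))"
    unfolding weight_def
  proof (intro prod_mono conjI)
    fix b :: 'a
    define y where "y = x \<bullet> b"
    have "0 < 1 + y\<^sup>2" "0 < 1 + (t * y)\<^sup>2" by (simp_all add: add_pos_nonneg)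
    moreover have "1 + (t * y)\<^sup>2 \<le> (1 + t\<^sup>2) * (1 + y\<^sup>2)" by (simp add: power_mult_distrib algebra_simps)
    ultimately have "1 / (1 + y\<^sup>2) \<le> (1 + t\<^sup>2) * (1 / (1 + (t * y)\<^sup>2))" by (simp add: field_simps)
    then show "1 / (1 + (x \<bullet> b)\<^sup>2) \<le> (1 + t\<^sup>2) * (1 / (1 + ((t *\<^sub>R x) \<bullet> b)\<^sup>2))" by (simp add: y_def)
  qed auto
  also have "\<dots> = (1 + t\<^sup>2) ^ DIM('a) * weight (t *\<^sub>R x)"
    by (simp only: weight_def prod.distrib prod_constant)
  finally show ?thesis .
qed

lemma weight_scaleR_le:
  fixes x :: "'a::euclidean_space"
  assumes "1 \<le> t"
  shows "weight (t *\<^sub>R x) \<le> weight x"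
  unfolding weight_def
proof (intro prod_mono conjI)
  fix b :: 'a
  have "1 * (x \<bullet> b)\<^sup>2 \<le> t\<^sup>2 * (x \<bullet> b)\<^sup>2" using assms by (intro mult_right_mono) (auto simp: one_le_power)
  then show "1 / (1 + ((t *\<^sub>R x) \<bullet> b)\<^sup>2) \<le> 1 / (1 + (x \<bullet> b)\<^sup>2)"
    by (intro divide_left_mono mult_pos_pos add_pos_nonneg) (auto simp: power_mult_distrib)
qed auto

lemma weight_Pair: "weight (u, w) = weight u * weight w" for u w :: "'a::euclidean_space"
proof -
  have "weight (u, w) = (\<Prod>b\<in>(\<lambda>b. (b, 0)) ` Basis \<union> (\<lambda>b. (0, b)) ` Basis. 1 / (1 + ((u, w) \<bullet> b)\<^sup>2))"
    by (simp add: weight_def Basis_prod_def)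
  also have "\<dots> = weight u * weight w"
    by (subst prod.union_disjoint) (auto simp: prod.reindex inj_on_def weight_def)
  finally show ?thesis .
qed

lemma int_lattice_Pair: "(u, w) \<in> int_lattice \<longleftrightarrow> u \<in> int_lattice \<and> w \<in> int_lattice"
  for u w :: "'a::euclidean_space"
  by (simp add: int_lattice_def Basis_prod_def ball_Un)

text \<open>The cut-and-project scheme: up to the factor \<open>1 + \<tau>\<^sup>2\<close>, the two maps below are the
  coordinates of a pair with respect to two orthogonal irrational subspaces.\<close>

definition phys :: "real \<Rightarrow> 'a::euclidean_space \<times> 'a \<Rightarrow> 'a" where
  "phys \<tau> z = snd z - \<tau> *\<^sub>R fst z"

definition int_coord :: "real \<Rightarrow> 'a::euclidean_space \<times> 'a \<Rightarrow> 'a" where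
  "int_coord \<tau> z = fst z + \<tau> *\<^sub>R snd z"

lemma continuous_on_phys [continuous_intros]: "continuous_on S f \<Longrightarrow> continuous_on S (\<lambda>x. phys \<tau> (f x))"
  and continuous_on_int_coord [continuous_intros]: "continuous_on S f \<Longrightarrow> continuous_on S (\<lambda>x. int_coord \<tau> (f x))"
  unfolding phys_def int_coord_def by (intro continuous_intros; assumption)+

lemma phys_diff: "phys \<tau> (z - z') = phys \<tau> z - phys \<tau> z'"
  and int_coord_diff: "int_coord \<tau> (z - z') = int_coord \<tau> z - int_coord \<tau> z'"
  by (simp_all add: phys_def int_coord_def algebra_simps)

lemma pos_one_plus_square: "0 < 1 + (\<tau>::real)\<^sup>2"
  by (simp add: add_pos_nonneg)

text \<open>The two coordinate maps together are a rotation times the square root of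
  \<open>1 + \<tau>\<^sup>2\<close>, inverted here; this is the source of the factor
  \<open>1 + \<tau>\<^sup>2\<close> everywhere below.\<close>

lemma pair_from_coords:
  fixes z :: "'a::euclidean_space \<times> 'a"
  shows "(1 + \<tau>\<^sup>2) *\<^sub>R z = (int_coord \<tau> z - \<tau> *\<^sub>R phys \<tau> z, phys \<tau> z + \<tau> *\<^sub>R int_coord \<tau> z)"
  by (simp add: prod_eq_iff phys_def int_coord_def algebra_simps power2_eq_square)

text \<open>Each component of \<open>z\<close> is a combination \<open>a + t *\<^sub>R b\<close> of
  the rescaled coordinates, so its weight dominates the product of their weights up to a constant.
  Two components use that product twice, hence the squares.\<close>

lemma weight_coords_le:
  fixes z :: "'a::euclidean_space \<times> 'a" and \<tau> :: real
  defines "c \<equiv> 1 + \<tau>\<^sup>2"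
  shows "(weight (int_coord \<tau> z /\<^sub>R c))\<^sup>2 * (weight (phys \<tau> z /\<^sub>R c))\<^sup>2
     \<le> ((2 * c) ^ DIM('a))\<^sup>2 * weight z"
proof -
  define y s where "y = int_coord \<tau> z /\<^sub>R c" and "s = phys \<tau> z /\<^sub>R c"
  have c: "c > 0" unfolding c_def by (rule pos_one_plus_square)
  have z: "z = (y - \<tau> *\<^sub>R s, s + \<tau> *\<^sub>R y)"
  proof -
    have "c *\<^sub>R z = c *\<^sub>R (y - \<tau> *\<^sub>R s, s + \<tau> *\<^sub>R y)"
      using pair_from_coords[of \<tau> z] c unfolding c_def[symmetric] y_def s_def scaleR_Pair
      by (simp add: scaleR_diff_right scaleR_add_right mult.commute)
    then show ?thesis using c by (simp only: scaleR_cancel_left) simp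
  qed
  have aux: "weight a * weight b \<le> (2 * c) ^ DIM('a) * weight (a + t *\<^sub>R b)" if "t\<^sup>2 = \<tau>\<^sup>2" for a b :: 'a and t
  proof -
    have "weight b \<le> c ^ DIM('a) * weight (t *\<^sub>R b)" using weight_le_scaleR[of b t] that by (simp add: c_def)
    then have "weight a * weight b \<le> weight a * (c ^ DIM('a) * weight (t *\<^sub>R b))"
      using weight_pos[of a] by (intro mult_left_mono) auto
    also have "\<dots> = c ^ DIM('a) * (weight a * weight (t *\<^sub>R b))" by simp
    also have "\<dots> \<le> c ^ DIM('a) * (2 ^ DIM('a) * weight (a + t *\<^sub>R b))"
      using c by (intro mult_left_mono weight_mult_le) auto
    finally show ?thesis by (simp add: power_mult_distrib mult_ac)
  qed
  have "(weight y * weight s) * (weight s * weight y)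
     \<le> ((2 * c) ^ DIM('a) * weight (y + (- \<tau>) *\<^sub>R s)) * ((2 * c) ^ DIM('a) * weight (s + \<tau> *\<^sub>R y))"
  proof (rule mult_mono)
    show "weight y * weight s \<le> (2 * c) ^ DIM('a) * weight (y + (- \<tau>) *\<^sub>R s)" by (rule aux) simp
    show "weight s * weight y \<le> (2 * c) ^ DIM('a) * weight (s + \<tau> *\<^sub>R y)" by (rule aux) simp
  qed (use c in \<open>auto intro!: mult_nonneg_nonneg simp: less_imp_le[OF weight_pos]\<close>)
  then show ?thesis unfolding y_def[symmetric] s_def[symmetric]
    by (subst z) (simp add: weight_Pair power2_eq_square mult_ac)
qed

lemma weight_coords_unscaled_le:
  fixes z :: "'a::euclidean_space \<times> 'a"
  shows "(weight (int_coord \<tau> z))\<^sup>2 * (weight (phys \<tau> z))\<^sup>2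
     \<le> ((2 * (1 + \<tau>\<^sup>2)) ^ DIM('a))\<^sup>2 * weight z"
proof -
  have c: "1 \<le> 1 + \<tau>\<^sup>2" by simp
  have le: "weight x \<le> weight (x /\<^sub>R (1 + \<tau>\<^sup>2))" for x :: 'a
    using weight_scaleR_le[OF c, of "x /\<^sub>R (1 + \<tau>\<^sup>2)"] pos_one_plus_square[of \<tau>] by simp
  have "(weight (int_coord \<tau> z))\<^sup>2 * (weight (phys \<tau> z))\<^sup>2
    \<le> (weight (int_coord \<tau> z /\<^sub>R (1 + \<tau>\<^sup>2)))\<^sup>2 * (weight (phys \<tau> z /\<^sub>R (1 + \<tau>\<^sup>2)))\<^sup>2"
    by (intro mult_mono power_mono le) (auto simp: less_imp_le[OF weight_pos])
  then show ?thesis using weight_coords_le[of \<tau> z] by linarith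
qed

text \<open>A tensor product in the rotated coordinates. The division by
  \<open>1 + \<tau>\<^sup>2\<close> makes its transform a product in the undivided coordinates, and
  is the reason why the spectrum is scaled.\<close>

definition cp_function :: "real \<Rightarrow> ('a::euclidean_space \<Rightarrow> complex) \<Rightarrow> ('a \<Rightarrow> complex) \<Rightarrow> 'a \<times> 'a \<Rightarrow> complex" where
  "cp_function \<tau> A f z = A (int_coord \<tau> z /\<^sub>R (1 + \<tau>\<^sup>2)) * f (phys \<tau> z /\<^sub>R (1 + \<tau>\<^sup>2))"

lemma cp_function_le:
  fixes A f :: "'a::euclidean_space \<Rightarrow> complex"
  assumes A: "\<And>y. cmod (A y) \<le> K * (weight y)\<^sup>2" and f: "\<And>x. cmod (f x) \<le> L * (weight x)\<^sup>2"
  shows "cmod (cp_function \<tau> A f z) \<le> K * L * ((2 * (1 + \<tau>\<^sup>2)) ^ DIM('a))\<^sup>2 * weight z"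
proof -
  have K: "K \<ge> 0" and L: "L \<ge> 0" using weighted_square_bound_nonneg A f by blast+
  let ?y = "int_coord \<tau> z /\<^sub>R (1 + \<tau>\<^sup>2)" and ?s = "phys \<tau> z /\<^sub>R (1 + \<tau>\<^sup>2)"
  have "cmod (cp_function \<tau> A f z) \<le> (K * (weight ?y)\<^sup>2) * (L * (weight ?s)\<^sup>2)"
    unfolding cp_function_def norm_mult using A f K by (intro mult_mono) auto
  also have "\<dots> = K * L * ((weight ?y)\<^sup>2 * (weight ?s)\<^sup>2)" by simp
  also have "\<dots> \<le> K * L * (((2 * (1 + \<tau>\<^sup>2)) ^ DIM('a))\<^sup>2 * weight z)"
    using K L by (intro mult_left_mono weight_coords_le) auto
  finally show ?thesis by (simp add: mult.assoc)
qed

lemma continuous_on_cp_function: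
  assumes "continuous_on UNIV A" "continuous_on UNIV f"
  shows "continuous_on UNIV (cp_function \<tau> A f)"
  unfolding cp_function_def[abs_def]
  by (intro continuous_on_mult continuous_on_compose2[OF assms(1)] continuous_on_compose2[OF assms(2)]
      continuous_intros) auto

text \<open>The rotation is carried out in two substitutions, each in one block of variables: at
  fixed \<open>w\<close> put \<open>u = - \<tau> *\<^sub>R w + c *\<^sub>R t\<close>, exchange the
  integrals, then translate \<open>w\<close> by \<open>\<tau> *\<^sub>R t\<close> at fixed
  \<open>t\<close>. The Jacobian \<open>c ^ DIM('a)\<close> comes from the first one.\<close>

lemma fourier_cp_function:
  fixes A f :: "'a::euclidean_space \<Rightarrow> complex"
  assumes Ac: "continuous_on UNIV A" and fc: "continuous_on UNIV f"
    and A: "\<And>y. cmod (A y) \<le> K * (weight y)\<^sup>2" and f: "\<And>x. cmod (f x) \<le> L * (weight x)\<^sup>2"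
  shows "fourier (cp_function \<tau> A f) z
    = of_real ((1 + \<tau>\<^sup>2) ^ DIM('a)) * fourier A (int_coord \<tau> z) * fourier f (phys \<tau> z)"
proof -
  obtain p r where z: "z = (p, r)" by (cases z)
  define c where "c = 1 + \<tau>\<^sup>2"
  have c: "c > 0" unfolding c_def by (rule pos_one_plus_square)
  have [measurable]: "A \<in> borel_measurable borel" "f \<in> borel_measurable borel"
    using Ac fc by (auto intro: borel_measurable_continuous_onI)
  have Ai: "integrable lborel A" and fi: "integrable lborel f"
    using A f by (auto intro!: integrable_le_weight_square)
  define H where "H u w = cp_function \<tau> A f (u, w) * chi (p \<bullet> u + r \<bullet> w)" for u w
  have Fm: "cp_function \<tau> A f \<in> borel_measurable borel"
    using Ac fc by (intro borel_measurable_continuous_onI continuous_on_cp_function)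
  have Fi: "integrable lborel (cp_function \<tau> A f)"
    by (rule integrable_le_weight[OF Fm cp_function_le[OF A f]])
  have Hi: "integrable (lborel \<Otimes>\<^sub>M lborel) (\<lambda>(u, w). H u w)"
  proof -
    have "(\<lambda>(u, w). H u w) = (\<lambda>x. cp_function \<tau> A f x * chi (z \<bullet> x))" by (auto simp: H_def z fun_eq_iff)
    moreover have "integrable lborel (\<lambda>x. cp_function \<tau> A f x * chi (z \<bullet> x))"
      by (rule Bochner_Integration.integrable_bound[OF Fi]) (use Fm in \<open>auto simp: norm_mult\<close>)
    ultimately show ?thesis by (simp add: lborel_prod)
  qed
  have H: "H (- \<tau> *\<^sub>R w + c *\<^sub>R t) w = A t * (f (- \<tau> *\<^sub>R t + w) * chi (p \<bullet> (- \<tau> *\<^sub>R w + c *\<^sub>R t) + r \<bullet> w))" for w t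
  proof -
    have "int_coord \<tau> (- \<tau> *\<^sub>R w + c *\<^sub>R t, w) = c *\<^sub>R t" by (simp add: int_coord_def)
    moreover have "phys \<tau> (- \<tau> *\<^sub>R w + c *\<^sub>R t, w) = c *\<^sub>R (- \<tau> *\<^sub>R t + w)"
      by (simp add: phys_def c_def algebra_simps power2_eq_square)
    ultimately show ?thesis using c by (simp add: H_def cp_function_def c_def[symmetric] mult.assoc)
  qed
  define J where "J t w = A t * (f (- \<tau> *\<^sub>R t + w) * chi (p \<bullet> (- \<tau> *\<^sub>R w + c *\<^sub>R t) + r \<bullet> w))" for t w
  have Ji: "integrable (lborel \<Otimes>\<^sub>M lborel) (\<lambda>(t, w). J t w)"
  proof (rule lborel_pair.Fubini_integrable)
    show "(\<lambda>(t, w). J t w) \<in> borel_measurable (lborel \<Otimes>\<^sub>M lborel)"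
      unfolding J_def by measurable
    have "(\<integral>w. norm (case (t, w) of (t, w) \<Rightarrow> J t w) \<partial>lborel) = cmod (A t) * (\<integral>x. cmod (f x) \<partial>lborel)" for t
      using integral_lborel_translate[of "\<lambda>w. cmod (f w)" "- \<tau> *\<^sub>R t"]
      by (simp add: J_def norm_mult)
    then show "integrable lborel (\<lambda>t. \<integral>w. norm (case (t, w) of (t, w) \<Rightarrow> J t w) \<partial>lborel)"
      using Ai by simp
    show "AE t in lborel. integrable lborel (\<lambda>w. case (t, w) of (t, w) \<Rightarrow> J t w)"
    proof (rule AE_I2)
      fix t
      have "integrable lborel (\<lambda>w. A t * f (- \<tau> *\<^sub>R t + w))"
        using fi by (subst (asm) lborel_distr_plus[of "- \<tau> *\<^sub>R t", symmetric]) (simp add: integrable_distr_eq)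
      then show "integrable lborel (\<lambda>w. case (t, w) of (t, w) \<Rightarrow> J t w)"
        by (rule Bochner_Integration.integrable_bound) (auto simp: J_def norm_mult)
    qed
  qed
  have "fourier (cp_function \<tau> A f) z = (\<integral>x. (case x of (u, w) \<Rightarrow> H u w) \<partial>(lborel \<Otimes>\<^sub>M lborel))"
    by (simp add: fourier_chi H_def z lborel_prod case_prod_beta inner_prod_def)
  also have "\<dots> = (\<integral>w. (\<integral>u. H u w \<partial>lborel) \<partial>lborel)"
    using lborel_pair.integral_snd[OF Hi] by simp
  also have "\<dots> = (\<integral>w. of_real (c ^ DIM('a)) * (\<integral>t. J t w \<partial>lborel) \<partial>lborel)"
  proof (intro Bochner_Integration.integral_cong refl)
    fix w :: 'a
    have [measurable]: "(\<lambda>u. H u w) \<in> borel_measurable borel"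
      unfolding H_def cp_function_def int_coord_def phys_def fst_conv snd_conv by measurable
    show "(\<integral>u. H u w \<partial>lborel) = of_real (c ^ DIM('a)) * (\<integral>t. J t w \<partial>lborel)"
      by (subst integral_lborel_affine[OF _ c, of _ "- \<tau> *\<^sub>R w"]) (simp_all only: H J_def, measurable)
  qed
  also have "\<dots> = of_real (c ^ DIM('a)) * (\<integral>t. (\<integral>w. J t w \<partial>lborel) \<partial>lborel)"
    using lborel_pair.Fubini_integral[OF Ji] by simp
  also have "(\<lambda>t. \<integral>w. J t w \<partial>lborel) = (\<lambda>t. A t * chi (int_coord \<tau> z \<bullet> t) * fourier f (phys \<tau> z))"
  proof
    fix t
    define G where "G x = f x * chi (phys \<tau> z \<bullet> x) * (A t * chi (int_coord \<tau> z \<bullet> t))" for x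
    have "J t w = G (- \<tau> *\<^sub>R t + w)" for w
    proof -
      have "p \<bullet> (- \<tau> *\<^sub>R w + c *\<^sub>R t) + r \<bullet> w = phys \<tau> z \<bullet> (- \<tau> *\<^sub>R t + w) + int_coord \<tau> z \<bullet> t"
        by (simp add: z phys_def int_coord_def c_def inner_add_left inner_add_right inner_diff_left
            algebra_simps power2_eq_square)
      then show ?thesis by (simp add: J_def G_def chi_add)
    qed
    then have "(\<integral>w. J t w \<partial>lborel) = (\<integral>x. G x \<partial>lborel)"
      using integral_lborel_translate[of G "- \<tau> *\<^sub>R t"] by (simp add: G_def[abs_def])
    also have "\<dots> = fourier f (phys \<tau> z) * (A t * chi (int_coord \<tau> z \<bullet> t))"
      unfolding G_def fourier_chi by (rule integral_mult_left_zero)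
    finally show "(\<integral>w. J t w \<partial>lborel) = A t * chi (int_coord \<tau> z \<bullet> t) * fourier f (phys \<tau> z)" by simp
  qed
  also have "(\<integral>t. A t * chi (int_coord \<tau> z \<bullet> t) * fourier f (phys \<tau> z) \<partial>lborel)
     = fourier A (int_coord \<tau> z) * fourier f (phys \<tau> z)"
    unfolding fourier_chi[of A] by (rule integral_mult_left_zero)
  finally show ?thesis by (simp add: c_def mult.assoc)
qed

section \<open>Measures carried by the projected lattice\<close>

lemma inj_on_phys:
  assumes "\<tau> \<notin> \<rat>"
  shows "inj_on (phys \<tau>) (int_lattice :: ('a::euclidean_space \<times> 'a) set)"
proof -
  have "z = 0" if z: "z \<in> int_lattice" "phys \<tau> z = 0" for z :: "'a \<times> 'a"
  proof -
    obtain p r where pr: "z = (p, r)" by (cases z)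
    have "p \<bullet> b = 0 \<and> r \<bullet> b = 0" if b: "b \<in> Basis" for b
    proof -
      have "(r - \<tau> *\<^sub>R p) \<bullet> b = 0" using z pr by (simp add: phys_def)
      then have eq: "r \<bullet> b = \<tau> * (p \<bullet> b)" by (simp add: inner_diff_left)
      have "p \<bullet> b \<in> \<int>" "r \<bullet> b \<in> \<int>" using z(1)[unfolded pr int_lattice_Pair] b by (auto simp: int_lattice_def)
      then have rat: "p \<bullet> b \<in> \<rat>" "r \<bullet> b \<in> \<rat>" using Ints_subset_Rats by auto
      have "p \<bullet> b = 0"
      proof (rule ccontr)
        assume "p \<bullet> b \<noteq> 0"
        then have "\<tau> = (r \<bullet> b) / (p \<bullet> b)" using eq by simp
        then show False using rat assms by (auto intro: Rats_divide)
      qed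
      then show ?thesis using eq by simp
    qed
    then show ?thesis using pr by (simp add: prod_eq_iff) (metis euclidean_eqI inner_zero_left)
  qed
  then show ?thesis
    by (intro inj_onI) (metis eq_iff_diff_eq_0 int_lattice_diff phys_diff)
qed

text \<open>\<open>atomic_on\<close> demands nonzero masses, so lattice pairs of mass zero are
  dropped from the support; sums may nevertheless be taken over the full lattice.\<close>

lemma integral_image_support:
  fixes W :: "'i \<Rightarrow> complex" and h :: "'a \<Rightarrow> complex"
  assumes inj: "inj_on X Z"
  defines "S \<equiv> X ` {z \<in> Z. W z \<noteq> 0}" and "a \<equiv> \<lambda>x. W (inv_into Z X x)"
  shows "(\<integral>x. a x * h x \<partial>count_space S) = (\<integral>z. W z * h (X z) \<partial>count_space Z)"
    and "integrable (count_space S) (\<lambda>x. a x * h x) \<longleftrightarrow> integrable (count_space Z) (\<lambda>z. W z * h (X z))"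
proof -
  let ?Z = "{z \<in> Z. W z \<noteq> 0}"
  have bij: "bij_betw X ?Z S" unfolding S_def by (intro inj_on_imp_bij_betw inj_on_subset[OF inj]) auto
  have a: "a (X z) = W z" if "z \<in> ?Z" for z using that inj by (simp add: a_def inv_into_f_f)
  have r: "count_space ?Z = restrict_space (count_space Z) ?Z"
    by (simp add: restrict_count_space Int_absorb2 Collect_mono_iff)
  have eq: "indicator ?Z z *\<^sub>R (W z * h (X z)) = W z * h (X z)" if "z \<in> Z" for z
    using that by (auto split: split_indicator)
  have "(\<integral>x. a x * h x \<partial>count_space S) = (\<integral>z. a (X z) * h (X z) \<partial>count_space ?Z)"
    using integral_bij_count_space[OF bij, of "\<lambda>x. a x * h x"] by simp
  also have "\<dots> = (\<integral>z. W z * h (X z) \<partial>count_space ?Z)"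
    using a by (intro Bochner_Integration.integral_cong) auto
  also have "\<dots> = (\<integral>z. indicator ?Z z *\<^sub>R (W z * h (X z)) \<partial>count_space Z)"
    unfolding r by (subst integral_restrict_space) auto
  also have "\<dots> = (\<integral>z. W z * h (X z) \<partial>count_space Z)"
    using eq by (intro Bochner_Integration.integral_cong) auto
  finally show "(\<integral>x. a x * h x \<partial>count_space S) = (\<integral>z. W z * h (X z) \<partial>count_space Z)" .
  have "integrable (count_space S) (\<lambda>x. a x * h x) \<longleftrightarrow> integrable (count_space ?Z) (\<lambda>z. a (X z) * h (X z))"
    using integrable_bij_count_space[OF bij, of "\<lambda>x. a x * h x"] by simp
  also have "\<dots> \<longleftrightarrow> integrable (count_space ?Z) (\<lambda>z. W z * h (X z))"
    using a by (intro Bochner_Integration.integrable_cong) auto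
  also have "\<dots> \<longleftrightarrow> integrable (count_space Z) (\<lambda>z. indicator ?Z z *\<^sub>R (W z * h (X z)))"
    unfolding r by (subst integrable_restrict_space) auto
  also have "\<dots> \<longleftrightarrow> integrable (count_space Z) (\<lambda>z. W z * h (X z))"
    using eq by (intro Bochner_Integration.integrable_cong) auto
  finally show "integrable (count_space S) (\<lambda>x. a x * h x) \<longleftrightarrow> integrable (count_space Z) (\<lambda>z. W z * h (X z))" .
qed

lemma integral_nonneg_Reals:
  fixes f :: "'b \<Rightarrow> complex"
  assumes "\<And>x. f x \<in> \<real>\<^sub>\<ge>\<^sub>0"
  shows "(\<integral>x. f x \<partial>M) \<in> \<real>\<^sub>\<ge>\<^sub>0"
proof -
  have f: "f x = of_real (Re (f x))" "Re (f x) \<ge> 0" for x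
    using assms[of x] by (auto simp: nonneg_Reals_def)
  have "(\<integral>x. f x \<partial>M) = (\<integral>x. of_real (Re (f x)) \<partial>M)" using f(1) by simp
  also have "\<dots> = of_real (\<integral>x. Re (f x) \<partial>M)" by (rule integral_complex_of_real)
  also have "\<dots> \<in> \<real>\<^sub>\<ge>\<^sub>0" using f(2) by (simp add: Bochner_Integration.integral_nonneg)
  finally show ?thesis .
qed

definition cp_support :: "real \<Rightarrow> ('a::euclidean_space \<times> 'a \<Rightarrow> complex) \<Rightarrow> real \<Rightarrow> 'a set" where
  "cp_support \<tau> W t = (\<lambda>z. t *\<^sub>R phys \<tau> z) ` {z \<in> int_lattice. W z \<noteq> 0}"

text \<open>\<open>inv_into\<close> recovers the lattice pair above a point, which is unique for
  irrational \<open>\<tau>\<close>. The scale \<open>t\<close> will be 1 for the measure and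
  \<open>1 / (1 + \<tau>\<^sup>2)\<close> for its transform.\<close>

definition cp_measure :: "real \<Rightarrow> ('a::euclidean_space \<times> 'a \<Rightarrow> complex) \<Rightarrow> real \<Rightarrow> 'a set \<Rightarrow> complex" where
  "cp_measure \<tau> W t = atomic_measure (cp_support \<tau> W t)
     (\<lambda>x. W (inv_into int_lattice (\<lambda>z. t *\<^sub>R phys \<tau> z) x))"

context
  fixes \<tau> t K :: real and W :: "'a::euclidean_space \<times> 'a \<Rightarrow> complex"
  assumes irr: "\<tau> \<notin> \<rat>" and t: "t \<noteq> 0"
    and W: "\<And>z. cmod (W z) * (weight (t *\<^sub>R phys \<tau> z))\<^sup>2 \<le> K * weight z"
begin

lemma inj_on_scaled_phys: "inj_on (\<lambda>z. t *\<^sub>R phys \<tau> z) (int_lattice :: ('a \<times> 'a) set)"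
  using inj_on_phys[OF irr] t by (auto simp: inj_on_def)

lemma countable_cp_support: "countable (cp_support \<tau> W t)"
  unfolding cp_support_def by (intro countable_image countable_subset[OF _ countable_int_lattice]) auto

lemma cp_weighted: "integrable (count_space (cp_support \<tau> W t))
   (\<lambda>x. W (inv_into int_lattice (\<lambda>z. t *\<^sub>R phys \<tau> z) x) * of_real ((weight x)\<^sup>2))"
  unfolding cp_support_def
proof (subst integral_image_support(2)[OF inj_on_scaled_phys])
  show "integrable (count_space int_lattice) (\<lambda>z. W z * complex_of_real ((weight (t *\<^sub>R phys \<tau> z))\<^sup>2))"
  proof (rule Bochner_Integration.integrable_bound)
    show "integrable (count_space int_lattice) (\<lambda>z::'a \<times> 'a. K * weight z)"
      by (intro integrable_mult_right integrable_lattice_weight)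
    show "AE z in count_space int_lattice. norm (W z * complex_of_real ((weight (t *\<^sub>R phys \<tau> z))\<^sup>2)) \<le> norm (K * weight z)"
    proof (rule AE_I2)
      fix z :: "'a \<times> 'a"
      show "norm (W z * complex_of_real ((weight (t *\<^sub>R phys \<tau> z))\<^sup>2)) \<le> norm (K * weight z)"
        using W[of z] by (simp add: norm_mult norm_power)
    qed
  qed auto
qed

lemma temperate_cp_measure: "temperate_measure (cp_measure \<tau> W t)"
  unfolding cp_measure_def by (rule temperate_atomic_measure[OF countable_cp_support cp_weighted])

lemma atomic_on_cp_measure: "atomic_on (cp_measure \<tau> W t) (cp_support \<tau> W t)"
  unfolding cp_measure_def
proof (rule atomic_on_atomic_measure[OF countable_cp_support cp_weighted])
  show "W (inv_into int_lattice (\<lambda>z. t *\<^sub>R phys \<tau> z) x) \<noteq> 0" if "x \<in> cp_support \<tau> W t" for x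
    using that inv_into_f_f[OF inj_on_scaled_phys] by (auto simp: cp_support_def)
qed

lemma cintegral_cp_measure:
  assumes "f \<in> borel_measurable borel"
  shows "cintegral (cp_measure \<tau> W t) f = (\<integral>z. W z * f (t *\<^sub>R phys \<tau> z) \<partial>count_space int_lattice)"
  unfolding cp_measure_def
  by (subst cintegral_atomic_measure[OF countable_cp_support cp_weighted assms])
     (simp add: cp_support_def integral_image_support(1)[OF inj_on_scaled_phys])

end

text \<open>Poisson summation for \<open>cp_function \<tau> A \<phi>\<close>: its lattice sum is
  \<open>\<nu>\<close> paired with \<open>\<phi>\<close>, the lattice sum of its transform is
  \<open>\<mu>\<close> paired with \<open>fourier \<phi>\<close>, both up to the factor
  \<open>(1 + \<tau>\<^sup>2) ^ DIM('a)\<close>. Positive-definiteness can then be read off from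
  \<open>A \<ge> 0\<close>.\<close>

theorem cp_fourier_pair:
  fixes A :: "'a::euclidean_space \<Rightarrow> real"
  assumes irr: "\<tau> \<notin> \<rat>" and cont: "continuous_on UNIV A" and nonneg: "\<And>y. 0 \<le> A y"
    and A: "\<And>y. A y \<le> K * (weight y)\<^sup>2"
    and FA: "\<And>x. cmod (fourier (\<lambda>y. of_real (A y)) x) \<le> L * (weight x)\<^sup>2"
  defines "\<mu> \<equiv> cp_measure \<tau> (\<lambda>z. fourier (\<lambda>y. of_real (A y)) (int_coord \<tau> z)) 1"
    and "\<nu> \<equiv> cp_measure \<tau> (\<lambda>z. of_real (A (int_coord \<tau> z /\<^sub>R (1 + \<tau>\<^sup>2)) / (1 + \<tau>\<^sup>2) ^ DIM('a))) (1 / (1 + \<tau>\<^sup>2))"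
    and "\<Lambda> \<equiv> cp_support \<tau> (\<lambda>z. fourier (\<lambda>y. of_real (A y)) (int_coord \<tau> z)) 1"
    and "S \<equiv> cp_support \<tau> (\<lambda>z. of_real (A (int_coord \<tau> z /\<^sub>R (1 + \<tau>\<^sup>2)) / (1 + \<tau>\<^sup>2) ^ DIM('a))) (1 / (1 + \<tau>\<^sup>2))"
  shows "temperate_measure \<mu>" "atomic_on \<mu> \<Lambda>" "temperate_measure \<nu>" "atomic_on \<nu> S" "countable S"
    "has_fourier_transform \<mu> \<nu>" "positive_definite \<mu>"
proof -
  define c where "c = 1 + \<tau>\<^sup>2"
  have c: "c > 0" "1 \<le> c" unfolding c_def by (auto intro: pos_one_plus_square)
  let ?A = "\<lambda>y. complex_of_real (A y)"
  let ?M = "((2 * c) ^ DIM('a))\<^sup>2"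
  have Ac: "continuous_on UNIV ?A" by (intro continuous_intros cont)
  have A': "cmod (?A y) \<le> K * (weight y)\<^sup>2" for y using A[of y] nonneg[of y] by simp
  have KL: "K \<ge> 0" "L \<ge> 0" using weighted_square_bound_nonneg A' FA by blast+
  have Wmu: "cmod (fourier ?A (int_coord \<tau> z)) * (weight (1 *\<^sub>R phys \<tau> z))\<^sup>2 \<le> L * ?M * weight z" for z :: "'a \<times> 'a"
  proof -
    have "cmod (fourier ?A (int_coord \<tau> z)) * (weight (1 *\<^sub>R phys \<tau> z))\<^sup>2
       \<le> L * ((weight (int_coord \<tau> z))\<^sup>2 * (weight (phys \<tau> z))\<^sup>2)"
      using mult_right_mono[OF FA] by (simp add: mult.assoc)
    also have "\<dots> \<le> L * (?M * weight z)"
      using KL weight_coords_unscaled_le[of \<tau> z] by (intro mult_left_mono) (auto simp: c_def)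
    finally show ?thesis by (simp add: mult.assoc)
  qed
  have Wnu: "cmod (of_real (A (int_coord \<tau> z /\<^sub>R c) / c ^ DIM('a))) * (weight ((1 / c) *\<^sub>R phys \<tau> z))\<^sup>2
      \<le> K * ?M * weight z" for z :: "'a \<times> 'a"
  proof -
    have "A (int_coord \<tau> z /\<^sub>R c) / c ^ DIM('a) \<le> A (int_coord \<tau> z /\<^sub>R c)"
      using nonneg c by (intro divide_left_mono[where b=1, simplified]) (auto simp: one_le_power)
    then have "cmod (of_real (A (int_coord \<tau> z /\<^sub>R c) / c ^ DIM('a))) * (weight ((1 / c) *\<^sub>R phys \<tau> z))\<^sup>2
      \<le> (K * (weight (int_coord \<tau> z /\<^sub>R c))\<^sup>2) * (weight ((1 / c) *\<^sub>R phys \<tau> z))\<^sup>2"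
      using A[of "int_coord \<tau> z /\<^sub>R c"] nonneg c by (intro mult_right_mono) (auto simp: norm_divide norm_power)
    also have "\<dots> = K * ((weight (int_coord \<tau> z /\<^sub>R c))\<^sup>2 * (weight (phys \<tau> z /\<^sub>R c))\<^sup>2)"
      by (simp add: inverse_eq_divide)
    also have "\<dots> \<le> K * (?M * weight z)"
      using KL weight_coords_le[of \<tau> z] by (intro mult_left_mono) (auto simp: c_def)
    finally show ?thesis by (simp add: mult.assoc)
  qed
  have t: "(1::real) \<noteq> 0" "1 / c \<noteq> 0" using c by auto
  note mu = irr t(1) Wmu and nu = irr t(2) Wnu
  show "temperate_measure \<mu>" "atomic_on \<mu> \<Lambda>"
    unfolding \<mu>_def \<Lambda>_def by (rule temperate_cp_measure[OF mu] atomic_on_cp_measure[OF mu])+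
  show "temperate_measure \<nu>" "atomic_on \<nu> S" "countable S"
    unfolding \<nu>_def S_def c_def[symmetric]
    by (rule temperate_cp_measure[OF nu] atomic_on_cp_measure[OF nu] countable_cp_support[OF nu])+
  have cnu: "cintegral \<nu> \<phi> = (\<integral>z. of_real (A (int_coord \<tau> z /\<^sub>R c) / c ^ DIM('a)) * \<phi> ((1 / c) *\<^sub>R phys \<tau> z) \<partial>count_space int_lattice)"
    if "schwartz \<phi>" for \<phi>
    unfolding \<nu>_def c_def[symmetric] by (rule cintegral_cp_measure[OF nu schwartz_measurable[OF that]])
  have eq: "fourier_distr \<mu> \<phi> = cintegral \<nu> \<phi>" if \<phi>: "schwartz \<phi>" for \<phi>
  proof -
    obtain B where B: "\<And>x. cmod (\<phi> x) \<le> B * (weight x)\<^sup>2" using schwartz_decay[OF \<phi>] by blast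
    obtain B' where B': "\<And>x. cmod (fourier \<phi> x) \<le> B' * (weight x)\<^sup>2" using fourier_decay[OF \<phi>] by blast
    let ?F = "cp_function \<tau> ?A \<phi>"
    note four = fourier_cp_function[OF Ac schwartz_continuous[OF \<phi>] A' B, of \<tau>, folded c_def]
    have B'0: "B' \<ge> 0" using weighted_square_bound_nonneg[OF B'] .
    \<comment> \<open>Here the decay assumed in \<open>FA\<close> enters; for a band-limited window
      it is automatic.\<close>
    have int: "integrable (count_space int_lattice) (fourier ?F)"
    proof (rule Bochner_Integration.integrable_bound)
      show "integrable (count_space int_lattice) (\<lambda>z::'a \<times> 'a. (c ^ DIM('a) * B' * (L * ?M)) * weight z)"
        by (intro integrable_mult_right integrable_lattice_weight)
      show "AE z in count_space int_lattice. norm (fourier ?F z) \<le> norm (c ^ DIM('a) * B' * (L * ?M) * weight z)"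
      proof (rule AE_I2)
        fix z :: "'a \<times> 'a"
        have "norm (fourier ?F z) = c ^ DIM('a) * (cmod (fourier ?A (int_coord \<tau> z)) * cmod (fourier \<phi> (phys \<tau> z)))"
          unfolding four using c by (simp add: norm_mult norm_power)
        also have "\<dots> \<le> c ^ DIM('a) * (cmod (fourier ?A (int_coord \<tau> z)) * (B' * (weight (phys \<tau> z))\<^sup>2))"
          using c B' by (intro mult_left_mono) auto
        also have "\<dots> = c ^ DIM('a) * B' * (cmod (fourier ?A (int_coord \<tau> z)) * (weight (1 *\<^sub>R phys \<tau> z))\<^sup>2)" by simp
        also have "\<dots> \<le> c ^ DIM('a) * B' * (L * ?M * weight z)"
          using c B'0 by (intro mult_left_mono Wmu) auto
        finally show "norm (fourier ?F z) \<le> norm (c ^ DIM('a) * B' * (L * ?M) * weight z)" by simp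
      qed
    qed auto
    have "fourier_distr \<mu> \<phi> = (\<integral>z. fourier ?A (int_coord \<tau> z) * fourier \<phi> (1 *\<^sub>R phys \<tau> z) \<partial>count_space int_lattice)"
      unfolding fourier_distr_def \<mu>_def
      by (rule cintegral_cp_measure[OF mu fourier_measurable[OF schwartz_integrable[OF \<phi>]]])
    also have "\<dots> = (\<integral>z. fourier ?F z / of_real (c ^ DIM('a)) \<partial>count_space int_lattice)"
      unfolding four using c by simp
    also have "\<dots> = (\<integral>z. ?F z \<partial>count_space int_lattice) / of_real (c ^ DIM('a))"
      unfolding poisson_summation[OF continuous_on_cp_function[OF Ac schwartz_continuous[OF \<phi>]] cp_function_le[OF A' B] int]
      by simp
    also have "\<dots> = (\<integral>z. ?F z / of_real (c ^ DIM('a)) \<partial>count_space int_lattice)" by simp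
    also have "\<dots> = cintegral \<nu> \<phi>"
      unfolding cnu[OF \<phi>] cp_function_def c_def[symmetric] by (simp add: inverse_eq_divide)
    finally show ?thesis .
  qed
  then show "has_fourier_transform \<mu> \<nu>" by (simp add: has_fourier_transform_def)
  show "positive_definite \<mu>"
    unfolding positive_definite_def
  proof (intro allI impI, elim conjE)
    fix \<phi> :: "'a \<Rightarrow> complex" assume \<phi>: "schwartz \<phi>" "\<forall>x. \<phi> x \<in> \<real>\<^sub>\<ge>\<^sub>0"
    show "fourier_distr \<mu> \<phi> \<in> \<real>\<^sub>\<ge>\<^sub>0"
      unfolding eq[OF \<phi>(1)] cnu[OF \<phi>(1)]
      using \<phi>(2) nonneg c by (intro integral_nonneg_Reals nonneg_Reals_mult_I) auto
  qed
qed

section \<open>Band-limited functions\<close>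

definition nsinc :: "real \<Rightarrow> real" where
  "nsinc t = (if t = 0 then 1 else sin (pi * t) / (pi * t))"

text \<open>The transform of the indicator of an interval of length 1: continuity, the bound 1 and
  the effect on bandwidths are all read off from this integral.\<close>

lemma nsinc_integral: "complex_of_real (nsinc t) = (\<integral>s. indicator {-1/2..1/2} s *\<^sub>R chi (t * s) \<partial>lborel)"
proof (cases "t = 0")
  case False
  have "chi (t * (1/2)) - chi (t * (- 1/2)) = - 2 * \<i> * of_real (sin (pi * t))"
    by (simp add: chi_cos_sin)
  then have "(\<integral>s. indicator {-1/2..1/2} s *\<^sub>R chi (t * s) \<partial>lborel)
     = (- 2 * \<i> * of_real (sin (pi * t))) / (- 2 * of_real pi * \<i> * of_real t)"
    using integral_chi_interval[OF False, of "-1/2" "1/2"] by simp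
  then show ?thesis using False by (simp add: nsinc_def field_simps)
qed (simp add: nsinc_def)

lemma integrable_chi_interval: "integrable lborel (\<lambda>s. indicator {-1/2..1/2::real} s *\<^sub>R chi (t * s))"
proof -
  have "set_integrable lborel {-1/2..1/2} (\<lambda>s. chi (t * s))"
    by (intro borel_integrable_atLeastAtMost' continuous_intros)
  then show ?thesis by (simp add: set_integrable_def)
qed

lemma continuous_on_nsinc: "continuous_on S nsinc"
proof -
  have "continuous_on UNIV (\<lambda>t. \<integral>s. indicator {-1/2..1/2::real} s *\<^sub>R chi (t * s) \<partial>lborel)"
  proof (rule continuous_on_integral_dominated[where w="\<lambda>s. indicator {-1/2..1/2} s"])
    show "continuous_on UNIV (\<lambda>t. indicator {-1/2..1/2::real} s *\<^sub>R chi (t * s))" for s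
      by (intro continuous_intros)
  qed auto
  then have "continuous_on UNIV (\<lambda>t. Re (of_real (nsinc t)))"
    unfolding nsinc_integral by (intro continuous_intros)
  then show ?thesis by (auto intro: continuous_on_subset)
qed

lemma continuous_on_nsinc' [continuous_intros]:
  "continuous_on S f \<Longrightarrow> continuous_on S (\<lambda>x. nsinc (f x))"
  by (rule continuous_on_compose2[OF continuous_on_nsinc[of UNIV]]) auto

lemma nsinc_measurable [measurable]: "nsinc \<in> borel_measurable borel"
  by (intro borel_measurable_continuous_onI continuous_on_nsinc)

lemma abs_nsinc_le_1: "\<bar>nsinc t\<bar> \<le> 1"
proof -
  have "cmod (of_real (nsinc t)) \<le> (\<integral>s. norm (indicator {-1/2..1/2::real} s *\<^sub>R chi (t * s)) \<partial>lborel)"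
    unfolding nsinc_integral by (rule integral_norm_bound)
  then show ?thesis by simp
qed

lemma nsinc_0 [simp]: "nsinc 0 = 1" by (simp add: nsinc_def)

lemma nsinc_square_le_inverse: "t \<noteq> 0 \<Longrightarrow> (nsinc t)\<^sup>2 \<le> 1 / t\<^sup>2"
proof -
  assume t: "t \<noteq> 0"
  have "(sin (pi * t))\<^sup>2 \<le> 1" by (simp add: power_le_one abs_square_le_1)
  moreover have "1 \<le> pi\<^sup>2" using pi_gt3 by (simp add: one_le_power)
  ultimately have "(sin (pi * t))\<^sup>2 \<le> pi\<^sup>2" by linarith
  then show ?thesis using t by (simp add: nsinc_def power_divide power_mult_distrib field_simps)
qed

lemma nsinc_square_le_1: "(nsinc t)\<^sup>2 \<le> 1"
  using abs_nsinc_le_1[of t] by (simp add: abs_square_le_1)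

lemma nsinc_square_le: "(nsinc t)\<^sup>2 \<le> 2 / (1 + t\<^sup>2)"
proof (cases "t\<^sup>2 \<le> 1")
  case True
  then have "1 \<le> 2 / (1 + t\<^sup>2)" by (simp add: field_simps add_pos_nonneg)
  then show ?thesis using nsinc_square_le_1[of t] by linarith
next
  case False
  then have "2 / (2 * t\<^sup>2) \<le> 2 / (1 + t\<^sup>2)" by (intro divide_left_mono mult_pos_pos add_pos_nonneg) auto
  then have "1 / t\<^sup>2 \<le> 2 / (1 + t\<^sup>2)" by simp
  moreover have "t \<noteq> 0" using False by auto
  ultimately show ?thesis using nsinc_square_le_inverse[of t] by linarith
qed

lemma weight_real: "weight (t::real) = 1 / (1 + t\<^sup>2)"
  by (simp add: weight_def)

text \<open>Multiplication by a sinc averages the transform, up to unimodular phases, over the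
  interval of length \<open>e\<close> around \<open>x\<close>. An inequality is kept, rather than
  vanishing, because the lemma is also applied to Gaussians, whose transforms are merely small far
  out.\<close>

lemma fourier_mult_nsinc_le:
  fixes \<Phi> :: "real \<Rightarrow> complex"
  assumes \<Phi>: "integrable lborel \<Phi>" and e: "e > 0"
    and m: "\<And>y. \<bar>x\<bar> - e / 2 \<le> \<bar>y\<bar> \<Longrightarrow> cmod (fourier \<Phi> y) \<le> m"
  shows "cmod (fourier (\<lambda>t. \<Phi> t * of_real (nsinc (e * (t - v)))) x) \<le> m"
proof -
  have [measurable]: "\<Phi> \<in> borel_measurable borel" using \<Phi> by (auto dest: borel_measurable_integrable)
  let ?I = "{-1/2..1/2::real}"
  define H where "H s t = indicator ?I s *\<^sub>R (\<Phi> t * chi ((x + e * s) * t) * chi (- (e * s * v)))" for s t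
  have Hi: "integrable (lborel \<Otimes>\<^sub>M lborel) (\<lambda>(s, t). H s t)"
  proof (rule lborel_pair.Fubini_integrable)
    show "(\<lambda>(s, t). H s t) \<in> borel_measurable (lborel \<Otimes>\<^sub>M lborel)"
      unfolding H_def by measurable
    show "integrable lborel (\<lambda>s. \<integral>t. norm (case (s, t) of (s, t) \<Rightarrow> H s t) \<partial>lborel)"
      by (simp add: H_def norm_mult)
    show "AE s in lborel. integrable lborel (\<lambda>t. case (s, t) of (s, t) \<Rightarrow> H s t)"
      unfolding H_def
      by (rule AE_I2, simp, rule Bochner_Integration.integrable_bound[OF \<Phi>], measurable)
         (auto simp: norm_mult split: split_indicator)
  qed
  have "fourier (\<lambda>t. \<Phi> t * of_real (nsinc (e * (t - v)))) x = (\<integral>t. (\<integral>s. H s t \<partial>lborel) \<partial>lborel)"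
    unfolding fourier_chi
  proof (intro Bochner_Integration.integral_cong refl)
    fix t
    have "\<Phi> t * of_real (nsinc (e * (t - v))) * chi (x \<bullet> t)
      = (\<integral>s. indicator ?I s *\<^sub>R chi (e * (t - v) * s) * (\<Phi> t * chi (x * t)) \<partial>lborel)"
      unfolding nsinc_integral by (subst integral_mult_left_zero) simp
    also have "\<dots> = (\<integral>s. H s t \<partial>lborel)"
    proof (intro Bochner_Integration.integral_cong refl)
      fix s
      have "chi (e * (t - v) * s) * chi (x * t) = chi ((x + e * s) * t) * chi (- (e * s * v))"
        by (simp add: chi_add[symmetric] algebra_simps)
      then show "indicator ?I s *\<^sub>R chi (e * (t - v) * s) * (\<Phi> t * chi (x * t)) = H s t"
        by (simp add: H_def mult_ac)
    qed
    finally show "\<Phi> t * of_real (nsinc (e * (t - v))) * chi (x \<bullet> t) = (\<integral>s. H s t \<partial>lborel)" .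
  qed
  also have "\<dots> = (\<integral>s. (\<integral>t. H s t \<partial>lborel) \<partial>lborel)"
    using lborel_pair.Fubini_integral[OF Hi] by simp
  also have "\<dots> = (\<integral>s. indicator ?I s *\<^sub>R (fourier \<Phi> (x + e * s) * chi (- (e * s * v))) \<partial>lborel)"
    by (simp add: H_def fourier_chi)
  finally have eq: "fourier (\<lambda>t. \<Phi> t * of_real (nsinc (e * (t - v)))) x = \<dots>" .
  have "cmod (fourier (\<lambda>t. \<Phi> t * of_real (nsinc (e * (t - v)))) x) \<le> (\<integral>s. indicator ?I s * m \<partial>lborel)"
    unfolding eq
  proof (rule order_trans[OF integral_norm_bound], rule integral_mono_AE')
    show "AE s in lborel. cmod (indicator ?I s *\<^sub>R (fourier \<Phi> (x + e * s) * chi (- (e * s * v)))) \<le> indicator ?I s * m"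
    proof (rule AE_I2)
      fix s
      show "cmod (indicator ?I s *\<^sub>R (fourier \<Phi> (x + e * s) * chi (- (e * s * v)))) \<le> indicator ?I s * m"
      proof (cases "s \<in> ?I")
        case True
        then have "\<bar>s\<bar> \<le> 1 / 2" by auto
        then have "\<bar>e * s\<bar> \<le> e / 2" using mult_left_mono[of "\<bar>s\<bar>" "1/2" e] e by (simp add: abs_mult)
        then have "\<bar>x\<bar> - e / 2 \<le> \<bar>x + e * s\<bar>" by linarith
        from m[OF this] True show ?thesis by (simp add: norm_mult)
      qed simp
    qed
    show "AE s in lborel. 0 \<le> indicator ?I s * m"
      using order_trans[OF norm_ge_zero m[of x]] e by (intro AE_I2) simp
  qed auto
  then show ?thesis by simp
qed

text \<open>Integrability is included because \<open>fourier\<close> of a non-integrable function is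
  0 by default.\<close>

definition bandlimited :: "real \<Rightarrow> (real \<Rightarrow> complex) \<Rightarrow> bool" where
  "bandlimited C \<Phi> \<longleftrightarrow> integrable lborel \<Phi> \<and> (\<forall>x. C < \<bar>x\<bar> \<longrightarrow> fourier \<Phi> x = 0)"

lemma integrable_mult_nsinc:
  fixes \<Phi> :: "real \<Rightarrow> complex"
  assumes "integrable lborel \<Phi>"
  shows "integrable lborel (\<lambda>t. \<Phi> t * of_real (nsinc (e * (t - v))))"
proof (rule Bochner_Integration.integrable_bound[OF assms])
  have [measurable]: "\<Phi> \<in> borel_measurable borel" using assms by (auto dest: borel_measurable_integrable)
  show "(\<lambda>t. \<Phi> t * of_real (nsinc (e * (t - v)))) \<in> borel_measurable lborel" by measurable
  show "AE t in lborel. norm (\<Phi> t * of_real (nsinc (e * (t - v)))) \<le> norm (\<Phi> t)"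
    using abs_nsinc_le_1 by (auto simp: norm_mult mult_left_le)
qed

lemma bandlimited_mult_nsinc:
  assumes "bandlimited C \<Phi>" "e > 0"
  shows "bandlimited (C + e / 2) (\<lambda>t. \<Phi> t * of_real (nsinc (e * (t - v))))"
  unfolding bandlimited_def
proof (intro conjI allI impI)
  have \<Phi>: "integrable lborel \<Phi>" "\<And>x. C < \<bar>x\<bar> \<Longrightarrow> fourier \<Phi> x = 0" using assms by (auto simp: bandlimited_def)
  show "integrable lborel (\<lambda>t. \<Phi> t * of_real (nsinc (e * (t - v))))"
    by (rule integrable_mult_nsinc[OF \<Phi>(1)])
  fix x assume x: "C + e / 2 < \<bar>x\<bar>"
  have "cmod (fourier (\<lambda>t. \<Phi> t * of_real (nsinc (e * (t - v)))) x) \<le> 0"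
    by (rule fourier_mult_nsinc_le[OF \<Phi>(1) assms(2)]) (use \<Phi>(2) x in auto)
  then show "fourier (\<lambda>t. \<Phi> t * of_real (nsinc (e * (t - v)))) x = 0" by simp
qed

section \<open>Gaussian regularisation of the squared sinc\<close>

lemma fourier_gaussian:
  assumes N: "N > 0"
  shows "fourier (\<lambda>t::real. of_real (exp (- (t / N)\<^sup>2 / 2))) y = of_real (N * sqrt (2 * pi) * exp (- (2 * pi * N * y)\<^sup>2 / 2))"
proof -
  define u where "u = - (2 * pi * N * y)"
  have "char std_normal_distribution u = (\<integral>s. std_normal_density s *\<^sub>R exp (\<i> * of_real (u * s)) \<partial>lborel)"
    unfolding char_def by (subst integral_density) (auto simp: normal_density_nonneg)
  then have *: "(\<integral>s. std_normal_density s *\<^sub>R exp (\<i> * of_real (u * s)) \<partial>lborel) = of_real (exp (- (u\<^sup>2) / 2))"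
    by (simp add: char_std_normal_distribution)
  have "fourier (\<lambda>t::real. of_real (exp (- (t / N)\<^sup>2 / 2))) y = (\<integral>t. of_real (exp (- (t / N)\<^sup>2 / 2)) * chi (y * t) \<partial>lborel)"
    by (simp add: fourier_chi)
  also have "\<dots> = of_real N * (\<integral>s. of_real (exp (- ((N * s) / N)\<^sup>2 / 2)) * chi (y * (N * s)) \<partial>lborel)"
    using integral_lborel_affine[of "\<lambda>t. of_real (exp (- (t / N)\<^sup>2 / 2)) * chi (y * t)" N 0] N by simp
  also have "(\<lambda>s. of_real (exp (- ((N * s) / N)\<^sup>2 / 2)) * chi (y * (N * s)))
     = (\<lambda>s. of_real (sqrt (2 * pi)) * (std_normal_density s *\<^sub>R exp (\<i> * of_real (u * s))))"
  proof
    fix s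
    have "chi (y * (N * s)) = exp (\<i> * of_real (u * s))" by (simp add: chi_def u_def mult_ac)
    moreover have "exp (- ((N * s) / N)\<^sup>2 / 2) = sqrt (2 * pi) * std_normal_density s"
      using N by (simp add: std_normal_density_def)
    ultimately show "of_real (exp (- ((N * s) / N)\<^sup>2 / 2)) * chi (y * (N * s))
     = of_real (sqrt (2 * pi)) * (std_normal_density s *\<^sub>R exp (\<i> * of_real (u * s)))"
      by (simp add: scaleR_conv_of_real)
  qed
  also have "(\<integral>s. of_real (sqrt (2 * pi)) * (std_normal_density s *\<^sub>R exp (\<i> * of_real (u * s))) \<partial>lborel)
     = of_real (sqrt (2 * pi)) * of_real (exp (- (u\<^sup>2) / 2))"
    by (subst integral_mult_right_zero) (simp only: *)
  finally show ?thesis by (simp add: u_def)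
qed

text \<open>Fourier inversion for the triangle function, in disguise: a Gaussian regularisation makes the
  transform of \<open>nsinc\<^sup>2\<close> computable.\<close>

lemma bandlimited_nsinc_square: "bandlimited 1 (\<lambda>t. of_real ((nsinc t)\<^sup>2))"
  unfolding bandlimited_def
proof (intro conjI allI impI)
  show int: "integrable lborel (\<lambda>t. complex_of_real ((nsinc t)\<^sup>2))"
  proof (rule integrable_le_weight)
    show "cmod (complex_of_real ((nsinc t)\<^sup>2)) \<le> 2 * weight t" for t
      using nsinc_square_le[of t] by (simp add: weight_real norm_power)
  qed measurable
  fix x :: real assume x: "1 < \<bar>x\<bar>"
  define d where "d = \<bar>x\<bar> - 1"
  have d: "d > 0" using x by (simp add: d_def)
  define \<gamma> where "\<gamma> N t = complex_of_real (exp (- (t / real (Suc N))\<^sup>2 / 2))" for N and t :: real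
  \<comment> \<open>The rate comes from \<open>exp u \<ge> u\<close>: at distance at least
    \<open>d\<close> from 0, the transform of a Gaussian of width \<open>Suc N\<close> is at most a
    constant divided by \<open>Suc N\<close>.\<close>
  define m where "m N = sqrt (2 * pi) / (2 * pi\<^sup>2 * d\<^sup>2) * inverse (real (Suc N))" for N
  have \<gamma>i: "integrable lborel (\<gamma> N)" for N
  proof -
    have "integrable lborel (\<lambda>t::real. normal_density 0 (real (Suc N)) t)"
      by (rule integrable_normal_density) simp
    then have "integrable lborel (\<lambda>t::real. sqrt (2 * pi * (real (Suc N))\<^sup>2) * normal_density 0 (real (Suc N)) t)"
      by (rule integrable_mult_right)
    also have "(\<lambda>t::real. sqrt (2 * pi * (real (Suc N))\<^sup>2) * normal_density 0 (real (Suc N)) t) = (\<lambda>t. exp (- (t / real (Suc N))\<^sup>2 / 2))"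
      by (simp add: normal_density_def power_divide fun_eq_iff del: of_nat_Suc)
    finally show ?thesis unfolding \<gamma>_def by (rule integrable_of_real)
  qed
  have \<gamma>le: "cmod (fourier (\<gamma> N) y) \<le> m N" if y: "d \<le> \<bar>y\<bar>" for N y
  proof -
    define M where "M = real (Suc N)"
    have M: "M > 0" by (simp add: M_def)
    have p: "0 < 2 * pi\<^sup>2 * M\<^sup>2 * d\<^sup>2" using M d by simp
    have "d\<^sup>2 \<le> y\<^sup>2" using y d by (simp add: abs_le_square_iff[symmetric])
    then have "2 * pi\<^sup>2 * M\<^sup>2 * d\<^sup>2 \<le> (2 * pi * M * y)\<^sup>2 / 2"
      using M by (simp add: power_mult_distrib mult_left_mono)
    also have "\<dots> \<le> exp ((2 * pi * M * y)\<^sup>2 / 2)"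
      using exp_ge_add_one_self[of "(2 * pi * M * y)\<^sup>2 / 2"] by linarith
    finally have e: "2 * pi\<^sup>2 * M\<^sup>2 * d\<^sup>2 \<le> exp ((2 * pi * M * y)\<^sup>2 / 2)" .
    have "exp (- (2 * pi * M * y)\<^sup>2 / 2) = 1 / exp ((2 * pi * M * y)\<^sup>2 / 2)"
      by (simp add: exp_minus inverse_eq_divide)
    also have "\<dots> \<le> 1 / (2 * pi\<^sup>2 * M\<^sup>2 * d\<^sup>2)" using e p by (intro divide_left_mono) auto
    finally have "M * sqrt (2 * pi) * exp (- (2 * pi * M * y)\<^sup>2 / 2) \<le> M * sqrt (2 * pi) * (1 / (2 * pi\<^sup>2 * M\<^sup>2 * d\<^sup>2))"
      using M by (intro mult_left_mono) auto
    also have "\<dots> = sqrt (2 * pi) / (2 * pi\<^sup>2 * d\<^sup>2) * inverse M"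
      using M d by (simp add: field_simps power2_eq_square)
    finally have "M * sqrt (2 * pi) * exp (- (2 * pi * M * y)\<^sup>2 / 2) \<le> m N" by (simp add: m_def M_def)
    moreover have "cmod (fourier (\<gamma> N) y) = M * sqrt (2 * pi) * exp (- (2 * pi * M * y)\<^sup>2 / 2)"
      unfolding \<gamma>_def M_def[symmetric] fourier_gaussian[OF M] using M by (simp del: of_real_mult)
    ultimately show ?thesis by simp
  qed
  \<comment> \<open>Written in the pattern of \<open>fourier_mult_nsinc_le\<close>. Each of the two
    sinc factors enlarges the range by 1/2, so the transform of the Gaussian is only evaluated where
    \<open>d \<le> \<bar>y\<bar>\<close>.\<close>
  define F where "F N t = \<gamma> N t * of_real (nsinc (1 * (t - 0))) * of_real (nsinc (1 * (t - 0)))" for N t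
  have le: "cmod (fourier (F N) x) \<le> m N" for N
    unfolding F_def
  proof (rule fourier_mult_nsinc_le[OF integrable_mult_nsinc[OF \<gamma>i]])
    fix y assume y: "\<bar>x\<bar> - 1 / 2 \<le> \<bar>y\<bar>"
    show "cmod (fourier (\<lambda>t. \<gamma> N t * of_real (nsinc (1 * (t - 0)))) y) \<le> m N"
      by (rule fourier_mult_nsinc_le[OF \<gamma>i]) (use y \<gamma>le in \<open>auto simp: d_def\<close>)
  qed auto
  have "m \<longlonglongrightarrow> 0" unfolding m_def
    using tendsto_mult_right_zero[OF LIMSEQ_inverse_real_of_nat] by blast
  then have lim0: "(\<lambda>N. fourier (F N) x) \<longlonglongrightarrow> 0"
    by (rule Lim_null_comparison[rotated]) (use le in auto)
  have "(\<lambda>N. \<integral>t. F N t * chi (x \<bullet> t) \<partial>lborel) \<longlonglongrightarrow> (\<integral>t. of_real ((nsinc t)\<^sup>2) * chi (x \<bullet> t) \<partial>lborel)"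
  proof (rule integral_dominated_convergence[where w="\<lambda>t. (nsinc t)\<^sup>2"])
    show "integrable lborel (\<lambda>t. (nsinc t)\<^sup>2)" using int by (simp only: complex_of_real_integrable_eq)
    show "AE t in lborel. (\<lambda>N. F N t * chi (x \<bullet> t)) \<longlonglongrightarrow> of_real ((nsinc t)\<^sup>2) * chi (x \<bullet> t)"
    proof (rule AE_I2)
      fix t :: real
      have "(\<lambda>N. complex_of_real (exp (- (t * inverse (real (Suc N)))\<^sup>2 / 2))) \<longlonglongrightarrow> of_real (exp (- (t * 0)\<^sup>2 / 2))"
        by (intro tendsto_intros LIMSEQ_inverse_real_of_nat) simp
      moreover have "\<gamma> N t = complex_of_real (exp (- (t * inverse (real (Suc N)))\<^sup>2 / 2))" for N
        unfolding \<gamma>_def by (simp only: divide_inverse)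
      ultimately have "(\<lambda>N. \<gamma> N t) \<longlonglongrightarrow> of_real 1" by simp
      then have "(\<lambda>N. \<gamma> N t * (of_real ((nsinc t)\<^sup>2) * chi (x \<bullet> t))) \<longlonglongrightarrow> of_real 1 * (of_real ((nsinc t)\<^sup>2) * chi (x \<bullet> t))"
        by (rule tendsto_mult_right)
      then show "(\<lambda>N. F N t * chi (x \<bullet> t)) \<longlonglongrightarrow> of_real ((nsinc t)\<^sup>2) * chi (x \<bullet> t)"
        by (simp add: F_def power2_eq_square mult.assoc)
    qed
    show "AE t in lborel. norm (F N t * chi (x \<bullet> t)) \<le> (nsinc t)\<^sup>2" for N
      by (rule AE_I2) (simp add: F_def \<gamma>_def norm_mult power2_eq_square mult_left_le_one_le mult.assoc)
    show "(\<lambda>t. F N t * chi (x \<bullet> t)) \<in> borel_measurable lborel" for N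
      unfolding F_def \<gamma>_def by measurable
  qed measurable
  then have "(\<lambda>N. fourier (F N) x) \<longlonglongrightarrow> fourier (\<lambda>t. of_real ((nsinc t)\<^sup>2)) x" by (simp add: fourier_chi)
  from LIMSEQ_unique[OF this lim0] show "fourier (\<lambda>t. complex_of_real ((nsinc t)\<^sup>2)) x = 0" .
qed

section \<open>Prescribing zeros on sparse sets\<close>

definition separated :: "real \<Rightarrow> real set \<Rightarrow> bool" where
  "separated D V \<longleftrightarrow> (\<forall>v\<in>V. \<forall>v'\<in>V. v \<noteq> v' \<longrightarrow> D \<le> \<bar>v - v'\<bar>)"

text \<open>One factor 4 pays for rounding the points to integers, the other for comparing the sum
  over the integers with the integral.\<close>

definition sep_bound :: real where
  "sep_bound = 16 * (\<integral>y. weight (y::real) \<partial>lborel)"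

lemma sep_bound_nonneg: "0 \<le> sep_bound"
  unfolding sep_bound_def
  by (intro mult_nonneg_nonneg Bochner_Integration.integral_nonneg) (auto simp: less_imp_le[OF weight_pos])

lemma inj_on_floor_separated:
  assumes "separated D V" "D > 0"
  shows "inj_on (\<lambda>v. real_of_int \<lfloor>v / D\<rfloor>) V"
proof (rule inj_onI, rule ccontr)
  fix v w assume vw: "v \<in> V" "w \<in> V" "real_of_int \<lfloor>v / D\<rfloor> = real_of_int \<lfloor>w / D\<rfloor>" "v \<noteq> w"
  then have "D \<le> \<bar>v - w\<bar>" using assms by (auto simp: separated_def)
  then have "1 \<le> \<bar>v / D - w / D\<bar>" using assms(2) by (simp add: diff_divide_distrib[symmetric])
  then show False using vw(3) by linarith
qed

lemma countable_separated:
  assumes "separated D V" "D > 0"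
  shows "countable V"
proof (rule countable_image_inj_on[OF _ inj_on_floor_separated[OF assms]])
  show "countable ((\<lambda>v. real_of_int \<lfloor>v / D\<rfloor>) ` V)"
    by (rule countable_subset[OF _ countable_int]) auto
qed

lemma nn_integral_count_space_subset:
  fixes f :: "'i \<Rightarrow> ennreal"
  assumes "A \<subseteq> B"
  shows "(\<integral>\<^sup>+x. f x \<partial>count_space A) \<le> (\<integral>\<^sup>+x. f x \<partial>count_space B)"
proof -
  have "(\<integral>\<^sup>+x. f x \<partial>count_space A) = (\<integral>\<^sup>+x. f x * indicator A x \<partial>count_space B)"
    using assms by (simp add: nn_integral_restrict_space[symmetric] restrict_count_space Int_absorb2)
  also have "\<dots> \<le> (\<integral>\<^sup>+x. f x \<partial>count_space B)"
    by (intro nn_integral_mono) (auto split: split_indicator)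
  finally show ?thesis .
qed

text \<open>Rounding \<open>v / D\<close> down is injective on a separated set and shifts the
  argument by at most 1, so the sum is dominated by one over all integers. The bound depends neither
  on \<open>t\<close> nor on \<open>V\<close>.\<close>

lemma nn_integral_separated:
  assumes V: "separated D V" and D: "D > 0"
  shows "(\<integral>\<^sup>+v. ennreal (weight ((v - t) / D)) \<partial>count_space V) \<le> ennreal sep_bound"
proof -
  let ?f = "\<lambda>v. real_of_int \<lfloor>v / D\<rfloor>"
  have "(\<integral>\<^sup>+v. ennreal (weight ((v - t) / D)) \<partial>count_space V)
    \<le> (\<integral>\<^sup>+v. 4 * ennreal (weight (?f v + - t / D)) \<partial>count_space V)"
  proof (intro nn_integral_mono)
    fix v
    have "weight ((?f v + - t / D) + (v / D - ?f v)) \<le> 4 ^ DIM(real) * weight (?f v + - t / D)"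
    proof (rule weight_segment)
      show "norm (v / D - ?f v) \<le> 1" unfolding real_norm_def by linarith
    qed
    moreover have "(?f v + - t / D) + (v / D - ?f v) = (v - t) / D" by (simp add: diff_divide_distrib)
    ultimately have "weight ((v - t) / D) \<le> 4 * weight (?f v + - t / D)" by simp
    then have "ennreal (weight ((v - t) / D)) \<le> ennreal (4 * weight (?f v + - t / D))" by (rule ennreal_leI)
    then show "ennreal (weight ((v - t) / D)) \<le> 4 * ennreal (weight (?f v + - t / D))"
      by (simp add: ennreal_mult less_imp_le[OF weight_pos])
  qed
  also have "\<dots> = (\<integral>\<^sup>+l. 4 * ennreal (weight (l + - t / D)) \<partial>count_space (?f ` V))"
    by (rule nn_integral_bij_count_space) (intro inj_on_imp_bij_betw inj_on_floor_separated[OF V D])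
  also have "\<dots> \<le> (\<integral>\<^sup>+l. 4 * ennreal (weight (l + - t / D)) \<partial>count_space int_lattice)"
    by (rule nn_integral_count_space_subset) (auto simp: int_lattice_def)
  also have "\<dots> = 4 * (\<integral>\<^sup>+l. ennreal (weight (l + - t / D)) \<partial>count_space int_lattice)"
    by (rule nn_integral_cmult) auto
  also have "\<dots> \<le> 4 * ennreal (4 ^ DIM(real) * (\<integral>y. weight (y::real) \<partial>lborel))"
    by (intro mult_left_mono nn_integral_weight_int_lattice) auto
  also have "\<dots> = ennreal sep_bound"
    by (simp add: sep_bound_def ennreal_mult'[symmetric] flip: ennreal_numeral)
  finally show ?thesis .
qed

lemma nsinc_far_le:
  assumes e: "e > 0" and D: "D > 0" and far: "D / 2 \<le> \<bar>t - v\<bar>"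
  shows "(nsinc (e * (t - v)))\<^sup>2 \<le> 5 / (e * D)\<^sup>2 * weight ((v - t) / D)"
proof -
  define x where "x = (t - v)\<^sup>2"
  have "(D / 2)\<^sup>2 \<le> \<bar>t - v\<bar>\<^sup>2" using far D by (intro power_mono) auto
  then have x: "D\<^sup>2 \<le> 4 * x" by (simp add: x_def power_divide)
  have D2: "D\<^sup>2 > 0" using D by simp
  then have x0: "x > 0" using x by linarith
  have "(nsinc (e * (t - v)))\<^sup>2 \<le> 1 / (e * (t - v))\<^sup>2"
    using far D e by (intro nsinc_square_le_inverse) auto
  \<comment> \<open>The 5 is chosen because \<open>D\<^sup>2 \<le> 4 * x\<close> gives
    \<open>D\<^sup>2 + x \<le> 5 * x\<close>, and \<open>D\<^sup>2 + x\<close> is the denominator of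
    the rescaled weight.\<close>
  also have "\<dots> = 5 / (e\<^sup>2 * (5 * x))" by (simp add: x_def power_mult_distrib)
  also have "\<dots> \<le> 5 / (e\<^sup>2 * (D\<^sup>2 + x))"
  proof (rule divide_left_mono)
    show "e\<^sup>2 * (D\<^sup>2 + x) \<le> e\<^sup>2 * (5 * x)" using x by (intro mult_left_mono) auto
    have "0 < D\<^sup>2 + x" using D2 x0 by linarith
    then show "0 < e\<^sup>2 * (5 * x) * (e\<^sup>2 * (D\<^sup>2 + x))" using x0 e by simp
  qed simp
  also have "\<dots> = 5 / (e * D)\<^sup>2 * weight ((v - t) / D)"
    using D D2 x0 e by (simp add: weight_real x_def power_divide power_mult_distrib field_simps power2_commute)
  finally show ?thesis .
qed

lemma nn_integral_nsinc_far:
  assumes V: "separated D V" and D: "D > 0" and e: "e > 0"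
    and far: "\<And>v. v \<in> V \<Longrightarrow> P v \<Longrightarrow> D / 2 \<le> \<bar>t - v\<bar>"
  shows "(\<integral>\<^sup>+v. ennreal ((nsinc (e * (t - v)))\<^sup>2) * indicator {v. P v} v \<partial>count_space V)
     \<le> ennreal (5 * sep_bound / (e * D)\<^sup>2)"
proof -
  have "(\<integral>\<^sup>+v. ennreal ((nsinc (e * (t - v)))\<^sup>2) * indicator {v. P v} v \<partial>count_space V)
     \<le> (\<integral>\<^sup>+v. ennreal (5 / (e * D)\<^sup>2) * ennreal (weight ((v - t) / D)) \<partial>count_space V)"
  proof (intro nn_integral_mono)
    fix v assume v: "v \<in> space (count_space V)"
    show "ennreal ((nsinc (e * (t - v)))\<^sup>2) * indicator {v. P v} v
      \<le> ennreal (5 / (e * D)\<^sup>2) * ennreal (weight ((v - t) / D))"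
    proof (cases "P v")
      case True
      have "(nsinc (e * (t - v)))\<^sup>2 \<le> 5 / (e * D)\<^sup>2 * weight ((v - t) / D)"
        using v True by (intro nsinc_far_le e D far) auto
      then show ?thesis using True
        by (simp add: ennreal_mult[symmetric] less_imp_le[OF weight_pos] ennreal_leI)
    qed simp
  qed
  also have "\<dots> = ennreal (5 / (e * D)\<^sup>2) * (\<integral>\<^sup>+v. ennreal (weight ((v - t) / D)) \<partial>count_space V)"
    by (rule nn_integral_cmult) auto
  also have "\<dots> \<le> ennreal (5 / (e * D)\<^sup>2) * ennreal sep_bound"
    by (intro mult_left_mono nn_integral_separated V D) auto
  also have "\<dots> = ennreal (5 * sep_bound / (e * D)\<^sup>2)"
    by (simp add: ennreal_mult[symmetric] sep_bound_nonneg)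
  finally show ?thesis .
qed

text \<open>At most one point of \<open>V\<close> is closer to \<open>t\<close> than
  \<open>D / 2\<close>, and it contributes at most 1; the rest is covered by the far
  estimate.\<close>

lemma nn_integral_nsinc_all:
  assumes V: "separated D V" and D: "D > 0" and e: "e > 0"
  shows "(\<integral>\<^sup>+v. ennreal ((nsinc (e * (t - v)))\<^sup>2) \<partial>count_space V) \<le> ennreal (1 + 5 * sep_bound / (e * D)\<^sup>2)"
proof -
  define U where "U = {v \<in> V. \<bar>t - v\<bar> < D / 2}"
  have "v = w" if "v \<in> U" "w \<in> U" for v w
  proof (rule ccontr)
    assume "v \<noteq> w"
    then have "D \<le> \<bar>v - w\<bar>" using that V by (auto simp: U_def separated_def)
    moreover have "\<bar>t - v\<bar> < D / 2" "\<bar>t - w\<bar> < D / 2" using that by (auto simp: U_def)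
    ultimately show False by linarith
  qed
  then have "U = {} \<or> (\<exists>u. U = {u})" by blast
  moreover have "U \<subseteq> V" by (auto simp: U_def)
  ultimately have U: "emeasure (count_space V) U \<le> 1" by (auto simp: emeasure_count_space)
  have "(\<integral>\<^sup>+v. ennreal ((nsinc (e * (t - v)))\<^sup>2) \<partial>count_space V)
    \<le> (\<integral>\<^sup>+v. indicator U v + ennreal ((nsinc (e * (t - v)))\<^sup>2) * indicator {v. D / 2 \<le> \<bar>t - v\<bar>} v \<partial>count_space V)"
  proof (intro nn_integral_mono)
    fix v assume "v \<in> space (count_space V)"
    then show "ennreal ((nsinc (e * (t - v)))\<^sup>2)
      \<le> indicator U v + ennreal ((nsinc (e * (t - v)))\<^sup>2) * indicator {v. D / 2 \<le> \<bar>t - v\<bar>} v"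
      using nsinc_square_le_1[of "e * (t - v)"]
      by (cases "D / 2 \<le> \<bar>t - v\<bar>") (auto simp: U_def indicator_def)
  qed
  also have "\<dots> = (\<integral>\<^sup>+v. indicator U v \<partial>count_space V)
     + (\<integral>\<^sup>+v. ennreal ((nsinc (e * (t - v)))\<^sup>2) * indicator {v. D / 2 \<le> \<bar>t - v\<bar>} v \<partial>count_space V)"
    by (intro nn_integral_add) auto
  also have "\<dots> \<le> 1 + ennreal (5 * sep_bound / (e * D)\<^sup>2)"
  proof (intro add_mono)
    show "(\<integral>\<^sup>+v. indicator U v \<partial>count_space V) \<le> 1"
      using U by (subst nn_integral_indicator) (auto simp: U_def)
  qed (rule nn_integral_nsinc_far[OF V D e], simp)
  also have "\<dots> = ennreal (1 + 5 * sep_bound / (e * D)\<^sup>2)"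
    by (subst ennreal_plus) (auto simp: sep_bound_nonneg)
  finally show ?thesis .
qed

text \<open>A Neumann series: diagonally dominant infinite systems are solvable in bounded sequences.\<close>

lemma neumann_solution:
  fixes K :: "real \<Rightarrow> real \<Rightarrow> real"
  assumes K: "\<And>w. w \<in> V \<Longrightarrow> (\<integral>\<^sup>+v. ennreal \<bar>K w v\<bar> \<partial>count_space V) \<le> ennreal (1 / 2)"
  obtains c :: "real \<Rightarrow> real" where "\<And>v. \<bar>c v\<bar> \<le> 2"
    "\<And>w. w \<in> V \<Longrightarrow> c w = 1 - (\<integral>v. K w v * c v \<partial>count_space V)"
proof -
  \<comment> \<open>The value 0 off \<open>V\<close> keeps the iterates bounded everywhere, so the
    estimates need no side condition on the argument.\<close>
  define T where "T c w = (if w \<in> V then 1 - (\<integral>v. K w v * c v \<partial>count_space V) else 0)" for c w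
  have Ki: "integrable (count_space V) (K w)" if "w \<in> V" for w
    using le_less_trans[OF K[OF that] ennreal_less_top] by (simp add: integrable_iff_bounded)
  have Kd: "integrable (count_space V) (\<lambda>v. K w v * d v)" if "w \<in> V" and d: "\<And>v. \<bar>d v\<bar> \<le> M" for w d and M :: real
  proof (rule Bochner_Integration.integrable_bound[OF integrable_mult_left[OF Ki[OF that(1)], of M]])
    have "0 \<le> M" using abs_ge_zero d by (rule order_trans)
    then show "AE v in count_space V. norm (K w v * d v) \<le> norm (K w v * M)"
      using d by (intro AE_I2) (simp add: abs_mult mult_left_mono)
  qed auto
  have Kle: "\<bar>\<integral>v. K w v * d v \<partial>count_space V\<bar> \<le> M / 2" if w: "w \<in> V" and d: "\<And>v. \<bar>d v\<bar> \<le> M" for w d and M :: real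
  proof -
    have M: "0 \<le> M" using abs_ge_zero d by (rule order_trans)
    have "ennreal \<bar>\<integral>v. K w v * d v \<partial>count_space V\<bar> \<le> (\<integral>\<^sup>+v. ennreal \<bar>K w v * d v\<bar> \<partial>count_space V)"
      using integral_norm_bound_ennreal[OF Kd[OF w d]] by simp
    also have "\<dots> \<le> (\<integral>\<^sup>+v. ennreal M * ennreal \<bar>K w v\<bar> \<partial>count_space V)"
      using d M by (intro nn_integral_mono) (simp add: ennreal_mult[symmetric] abs_mult mult.commute mult_right_mono ennreal_leI)
    also have "\<dots> = ennreal M * (\<integral>\<^sup>+v. ennreal \<bar>K w v\<bar> \<partial>count_space V)" by (rule nn_integral_cmult) auto
    also have "\<dots> \<le> ennreal M * ennreal (1 / 2)" by (intro mult_left_mono K w) auto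
    also have "\<dots> = ennreal (M / 2)" using M by (subst ennreal_mult[symmetric]) auto
    finally show ?thesis using M by simp
  qed
  define s where "s n = (T ^^ n) (\<lambda>_. 1)" for n
  have s0: "s 0 = (\<lambda>_. 1)" and sS: "s (Suc n) = T (s n)" for n by (simp_all add: s_def)
  \<comment> \<open>2 is the fixed point of \<open>M \<mapsto> 1 + M / 2\<close>. It also yields the
    3 below, as the bound \<open>2 + 1\<close> for the first difference.\<close>
  have s2: "\<bar>s n v\<bar> \<le> 2" for n v
  proof (induction n arbitrary: v)
    case (Suc n)
    show ?case using Kle[of v "s n" 2] Suc by (auto simp: sS T_def abs_le_iff)
  qed (simp add: s0)
  have diff: "\<bar>s (Suc n) v - s n v\<bar> \<le> 3 * (1 / 2) ^ n" for n v
  proof (induction n arbitrary: v)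
    case 0
    show ?case using s2[of "Suc 0" v] by (simp add: s0)
  next
    case (Suc n)
    show ?case
    proof (cases "v \<in> V")
      case True
      have "s (Suc (Suc n)) v - s (Suc n) v = - (\<integral>x. K v x * (s (Suc n) x - s n x) \<partial>count_space V)"
        using True Kd[OF True s2[of "Suc n"]] Kd[OF True s2[of n]]
        by (simp add: sS[of "Suc n"] sS[of n] T_def right_diff_distrib Bochner_Integration.integral_diff)
      then show ?thesis using Kle[OF True Suc] by simp
    qed (simp add: sS T_def)
  qed
  have conv: "convergent (\<lambda>n. s n v)" for v
  proof -
    have "summable (\<lambda>n. s (Suc n) v - s n v)"
      by (rule summable_comparison_test'[of "\<lambda>n. 3 * (1 / 2) ^ n"])
         (use diff in \<open>auto intro!: summable_mult summable_geometric\<close>)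
    then have "convergent (\<lambda>n. \<Sum>i<n. s (Suc i) v - s i v)" by (simp add: summable_iff_convergent)
    then have "convergent (\<lambda>n. s n v - s 0 v)"
      by (simp only: sum_lessThan_telescope[of "\<lambda>n. s n v"])
    from convergent_add[OF this convergent_const[of "s 0 v"]] show ?thesis by simp
  qed
  define c where "c v = lim (\<lambda>n. s n v)" for v
  have c: "(\<lambda>n. s n v) \<longlonglongrightarrow> c v" for v using conv by (simp add: c_def convergent_LIMSEQ_iff)
  show thesis
  proof
    show "\<bar>c v\<bar> \<le> 2" for v
      by (rule LIMSEQ_le_const2[OF tendsto_rabs[OF c]]) (use s2 in auto)
    fix w assume w: "w \<in> V"
    have "(\<lambda>n. \<integral>v. K w v * s n v \<partial>count_space V) \<longlonglongrightarrow> (\<integral>v. K w v * c v \<partial>count_space V)"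
    proof (rule integral_dominated_convergence[where w="\<lambda>v. 2 * \<bar>K w v\<bar>"])
      show "integrable (count_space V) (\<lambda>v. 2 * \<bar>K w v\<bar>)" using Ki[OF w] by auto
      show "AE v in count_space V. norm (K w v * s n v) \<le> 2 * \<bar>K w v\<bar>" for n
        using s2[of n] by (intro AE_I2) (simp add: abs_mult mult.commute[of 2] mult_left_mono)
    qed (auto intro!: tendsto_mult c)
    then have "(\<lambda>n. 1 - (\<integral>v. K w v * s n v \<partial>count_space V)) \<longlonglongrightarrow> 1 - (\<integral>v. K w v * c v \<partial>count_space V)"
      by (intro tendsto_intros)
    then have "(\<lambda>n. s (Suc n) w) \<longlonglongrightarrow> 1 - (\<integral>v. K w v * c v \<partial>count_space V)"
      using w by (simp add: sS T_def)
    from LIMSEQ_unique[OF LIMSEQ_Suc[OF c] this] show "c w = 1 - (\<integral>v. K w v * c v \<partial>count_space V)" .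
  qed
qed

lemma integral_count_space_remove:
  fixes f :: "'i \<Rightarrow> real"
  assumes "integrable (count_space V) f" "w \<in> V"
  shows "(\<integral>v. f v \<partial>count_space V) = f w + (\<integral>v. (if v = w then 0 else f v) \<partial>count_space V)"
proof -
  have i1: "integrable (count_space V) (\<lambda>v. if v = w then 0 else f v)"
    by (rule Bochner_Integration.integrable_bound[OF assms(1)]) auto
  have i2: "integrable (count_space V) (\<lambda>v. if v = w then f v else 0)"
    by (rule Bochner_Integration.integrable_bound[OF assms(1)]) auto
  have "(\<integral>v. f v \<partial>count_space V) = (\<integral>v. (if v = w then f v else 0) + (if v = w then 0 else f v) \<partial>count_space V)"
    by (intro Bochner_Integration.integral_cong) auto
  also have "\<dots> = (\<integral>v. (if v = w then f v else 0) \<partial>count_space V) + (\<integral>v. (if v = w then 0 else f v) \<partial>count_space V)"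
    by (rule Bochner_Integration.integral_add[OF i2 i1])
  also have "(\<integral>v. (if v = w then f v else 0) \<partial>count_space V) = (\<Sum>v\<in>{w}. f v)"
  proof (cases "f w = 0")
    case True
    then have "(\<lambda>v. if v = w then f v else 0) = (\<lambda>_. 0)" by auto
    then show ?thesis using True by simp
  next
    case False
    then have "{a \<in> V. (if a = w then f a else 0) \<noteq> 0} = {w}" using assms(2) by auto
    then show ?thesis by (subst lebesgue_integral_count_space_finite_support) auto
  qed
  finally show ?thesis by simp
qed

text \<open>The diagonal coefficient is the square of \<open>nsinc 0\<close>, that is 1, so
  vanishing at \<open>w\<close> is exactly the equation solved by \<open>neumann_solution\<close>.
  The hypothesis \<open>small\<close> makes the separation large compared with \<open>1 / e\<close>
  and hence the off-diagonal sums small; \<open>away\<close> makes the bumps jointly small for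
  \<open>\<bar>t\<bar> \<le> D\<close>.\<close>

lemma exists_vanishing_multiplier:
  assumes e: "e > 0" and \<eta>: "\<eta> \<le> 1" and D: "D > 0"
    and small: "5 * sep_bound / (e * D)\<^sup>2 \<le> \<eta> / 4"
    and V: "separated D V" and away: "\<And>v. v \<in> V \<Longrightarrow> 2 * D \<le> \<bar>v\<bar>"
  obtains g :: "real \<Rightarrow> real" where "continuous_on UNIV g" "\<And>v. v \<in> V \<Longrightarrow> g v = 0" "\<And>t. \<bar>g t\<bar> \<le> 4"
    "\<And>t. \<bar>t\<bar> \<le> D \<Longrightarrow> \<bar>g t - 1\<bar> \<le> \<eta>"
    "\<And>C \<Phi>. bandlimited C \<Phi> \<Longrightarrow> bandlimited (C + e) (\<lambda>t. \<Phi> t * of_real (g t))"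
proof -
  \<comment> \<open>Bounds the total of all bumps not centred near \<open>t\<close>. With
    \<open>\<bar>c v\<bar> \<le> 2\<close> this gives
    \<open>\<bar>g t - 1\<bar> \<le> 2 * \<kappa>\<close> for \<open>\<bar>t\<bar> \<le> D\<close>,
    and \<open>\<bar>g t\<bar> \<le> 3 + 2 * \<kappa>\<close> in general.\<close>
  define \<kappa> where "\<kappa> = 5 * sep_bound / (e * D)\<^sup>2"
  have \<kappa>: "0 \<le> \<kappa>" "\<kappa> \<le> \<eta> / 4" using small sep_bound_nonneg by (auto simp: \<kappa>_def)
  define h where "h t v = (nsinc (e * (t - v)))\<^sup>2" for t v
  have h0: "0 \<le> h t v" for t v by (simp add: h_def)
  define K where "K w v = (if v = w then 0 else h w v)" for w v
  have "(\<integral>\<^sup>+v. ennreal \<bar>K w v\<bar> \<partial>count_space V) \<le> ennreal (1 / 2)" if w: "w \<in> V" for w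
  proof -
    have "(\<integral>\<^sup>+v. ennreal \<bar>K w v\<bar> \<partial>count_space V)
      = (\<integral>\<^sup>+v. ennreal ((nsinc (e * (w - v)))\<^sup>2) * indicator {v. v \<noteq> w} v \<partial>count_space V)"
      by (intro nn_integral_cong) (auto simp: K_def h_def)
    also have "\<dots> \<le> ennreal \<kappa>" unfolding \<kappa>_def
    proof (rule nn_integral_nsinc_far[OF V D e])
      fix v assume "v \<in> V" "v \<noteq> w"
      then have "D \<le> \<bar>w - v\<bar>" using V w by (auto simp: separated_def)
      then show "D / 2 \<le> \<bar>w - v\<bar>" using D by linarith
    qed
    also have "\<dots> \<le> ennreal (1 / 2)" using \<kappa> \<eta> by (intro ennreal_leI) linarith
    finally show ?thesis .
  qed
  then obtain c :: "real \<Rightarrow> real" where c2: "\<And>v. \<bar>c v\<bar> \<le> 2"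
    and c: "\<And>w. w \<in> V \<Longrightarrow> c w = 1 - (\<integral>v. K w v * c v \<partial>count_space V)"
    using neumann_solution[of V K] by blast
  have cV: "countable V" by (rule countable_separated[OF V D])
  have bound: "(\<integral>\<^sup>+v. ennreal \<bar>c v * h t v\<bar> \<partial>count_space V) \<le> ennreal (2 * m)"
    if m: "(\<integral>\<^sup>+v. ennreal (h t v) \<partial>count_space V) \<le> ennreal m" "0 \<le> m" for t m
  proof -
    have "(\<integral>\<^sup>+v. ennreal \<bar>c v * h t v\<bar> \<partial>count_space V) \<le> (\<integral>\<^sup>+v. ennreal 2 * ennreal (h t v) \<partial>count_space V)"
      using c2 h0 by (intro nn_integral_mono)
        (simp add: ennreal_mult[symmetric] abs_mult mult_right_mono ennreal_leI del: ennreal_numeral)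
    also have "\<dots> = ennreal 2 * (\<integral>\<^sup>+v. ennreal (h t v) \<partial>count_space V)" by (rule nn_integral_cmult) auto
    also have "\<dots> \<le> ennreal 2 * ennreal m" by (intro mult_left_mono m) auto
    also have "\<dots> = ennreal (2 * m)" using m by (simp add: ennreal_mult[symmetric] del: ennreal_numeral)
    finally show ?thesis .
  qed
  have all: "(\<integral>\<^sup>+v. ennreal (h t v) \<partial>count_space V) \<le> ennreal (1 + \<kappa>)" for t
    unfolding h_def \<kappa>_def by (rule nn_integral_nsinc_all[OF V D e])
  have near0: "(\<integral>\<^sup>+v. ennreal (h t v) \<partial>count_space V) \<le> ennreal \<kappa>" if t: "\<bar>t\<bar> \<le> D" for t
  proof -
    have "(\<integral>\<^sup>+v. ennreal (h t v) \<partial>count_space V) = (\<integral>\<^sup>+v. ennreal ((nsinc (e * (t - v)))\<^sup>2) * indicator {v. True} v \<partial>count_space V)"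
      by (simp add: h_def)
    also have "\<dots> \<le> ennreal \<kappa>" unfolding \<kappa>_def
    proof (rule nn_integral_nsinc_far[OF V D e])
      fix v assume "v \<in> V"
      then show "D / 2 \<le> \<bar>t - v\<bar>" using away[of v] t D by linarith
    qed
    finally show ?thesis .
  qed
  have int: "integrable (count_space V) (\<lambda>v. c v * h t v)" for t
    using bound[OF all[of t]] \<kappa> by (auto simp: integrable_iff_bounded intro: le_less_trans)
  define g where "g t = 1 - (\<integral>v. c v * h t v \<partial>count_space V)" for t
  have g_le: "\<bar>g t - 1\<bar> \<le> 2 * m" if "(\<integral>\<^sup>+v. ennreal (h t v) \<partial>count_space V) \<le> ennreal m" "0 \<le> m" for t m
  proof -
    have "ennreal \<bar>\<integral>v. c v * h t v \<partial>count_space V\<bar> \<le> (\<integral>\<^sup>+v. ennreal \<bar>c v * h t v\<bar> \<partial>count_space V)"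
      using integral_norm_bound_ennreal[OF int] by simp
    also have "\<dots> \<le> ennreal (2 * m)" by (rule bound[OF that])
    finally show ?thesis using that(2) by (simp add: g_def)
  qed
  show thesis
  proof
    show "\<bar>g t - 1\<bar> \<le> \<eta>" if "\<bar>t\<bar> \<le> D" for t using g_le[OF near0[OF that]] \<kappa> by linarith
    show "\<bar>g t\<bar> \<le> 4" for t
    proof -
      have "\<bar>g t\<bar> \<le> \<bar>g t - 1\<bar> + 1" by linarith
      moreover have "\<bar>g t - 1\<bar> \<le> 2 + 2 * \<kappa>"
        using g_le[OF all[of t] add_nonneg_nonneg[OF zero_le_one \<kappa>(1)]] by simp
      moreover have "\<kappa> \<le> 1 / 4" using \<kappa>(2) \<eta> by linarith
      ultimately show ?thesis by linarith
    qed
    show "g w = 0" if w: "w \<in> V" for w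
    proof -
      have "(\<integral>v. c v * h w v \<partial>count_space V) = c w * h w w + (\<integral>v. (if v = w then 0 else c v * h w v) \<partial>count_space V)"
        by (rule integral_count_space_remove[OF int w])
      also have "(\<integral>v. (if v = w then 0 else c v * h w v) \<partial>count_space V) = (\<integral>v. K w v * c v \<partial>count_space V)"
        by (intro Bochner_Integration.integral_cong) (auto simp: K_def)
      finally show ?thesis using c[OF w] by (simp add: g_def h_def)
    qed
    show "continuous_on UNIV g"
    proof -
      have "continuous_on (ball 0 R) (\<lambda>t. \<integral>v. c v * h t v \<partial>count_space V)" for R
      proof (rule continuous_on_integral_dominated)
        \<comment> \<open>A dominating function free of \<open>t\<close>: the Peetre inequality
          removes the shift by \<open>t\<close> and a rescaling replaces \<open>e * v\<close> by
          \<open>v / D\<close>. The 8 collects a 2 from \<open>c\<close>, a 2 from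
          \<open>nsinc_square_le\<close> and a 2 from \<open>weight_mult_le\<close>.\<close>
        let ?w = "\<lambda>v. 8 * (1 + (e * R)\<^sup>2) * ((1 + (1 / (e * D))\<^sup>2) * weight ((v - 0) / D))"
        have "integrable (count_space V) (\<lambda>v. weight ((v - 0) / D))"
          using nn_integral_separated[OF V D, of 0]
          by (auto simp: integrable_iff_bounded less_imp_le[OF weight_pos] intro: le_less_trans)
        then show "integrable (count_space V) ?w" by (intro integrable_mult_right)
        fix t v :: real assume t: "t \<in> ball 0 R"
        have "h t v \<le> 2 * weight (e * (t - v))" unfolding h_def weight_real using nsinc_square_le by simp
        moreover have "weight (e * (t - v)) * weight (e * t) \<le> 2 * weight (e * v)"
          using weight_mult_le[of "e * (v - t)" "e * t"] weight_uminus[of "e * (t - v)"] by (simp add: algebra_simps)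
        moreover have "1 / (1 + (e * R)\<^sup>2) \<le> weight (e * t)"
        proof -
          have "\<bar>e * t\<bar> \<le> \<bar>e * R\<bar>" using t e by (auto simp: abs_mult dist_real_def)
          then have "(e * t)\<^sup>2 \<le> (e * R)\<^sup>2" by (simp add: abs_le_square_iff)
          then show ?thesis unfolding weight_real by (intro divide_left_mono mult_pos_pos add_pos_nonneg) auto
        qed
        then have "weight (e * (t - v)) * (1 / (1 + (e * R)\<^sup>2)) \<le> weight (e * (t - v)) * weight (e * t)"
          by (intro mult_left_mono) (auto simp: less_imp_le[OF weight_pos])
        moreover have "weight (e * v) \<le> (1 + (1 / (e * D))\<^sup>2) * weight ((v - 0) / D)"
          using weight_le_scaleR[of "e * v" "1 / (e * D)"] e by simp
        ultimately have "weight (e * (t - v)) * (1 / (1 + (e * R)\<^sup>2)) \<le> 2 * ((1 + (1 / (e * D))\<^sup>2) * weight ((v - 0) / D))"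
          and h: "h t v \<le> 2 * weight (e * (t - v))" by linarith+
        then have "weight (e * (t - v)) \<le> 2 * ((1 + (1 / (e * D))\<^sup>2) * weight ((v - 0) / D)) * (1 + (e * R)\<^sup>2)"
          by (simp add: divide_le_eq add_pos_nonneg)
        then have "2 * h t v \<le> 4 * (2 * ((1 + (1 / (e * D))\<^sup>2) * weight ((v - 0) / D)) * (1 + (e * R)\<^sup>2))"
          using h by linarith
        also have "\<dots> = ?w v" by (simp only: mult_ac)
        finally have "2 * h t v \<le> ?w v" .
        moreover have "norm (c v * h t v) \<le> 2 * h t v"
          using c2[of v] h0[of t v] by (simp add: abs_mult mult_right_mono)
        ultimately show "norm (c v * h t v) \<le> ?w v" by linarith
      next
        show "continuous_on (ball 0 R) (\<lambda>t. c v * h t v)" for v :: real unfolding h_def by (intro continuous_intros)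
      qed auto
      then have "continuous_on UNIV (\<lambda>t. \<integral>v. c v * h t v \<partial>count_space V)" by (rule continuous_on_all_balls)
      then show ?thesis unfolding g_def by (intro continuous_intros)
    qed
    then have [measurable]: "g \<in> borel_measurable borel" by (rule borel_measurable_continuous_onI)
    fix C and \<Phi> :: "real \<Rightarrow> complex" assume bl: "bandlimited C \<Phi>"
    then have \<Phi>: "integrable lborel \<Phi>" and \<Phi>0: "\<And>x. C < \<bar>x\<bar> \<Longrightarrow> fourier \<Phi> x = 0" by (auto simp: bandlimited_def)
    have [measurable]: "\<Phi> \<in> borel_measurable borel" using \<Phi> by (auto dest: borel_measurable_integrable)
    have [measurable]: "(\<lambda>t. h t v) \<in> borel_measurable borel" for v unfolding h_def by measurable
    have gi: "integrable lborel (\<lambda>t. \<Phi> t * of_real (g t))"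
    proof (rule Bochner_Integration.integrable_bound[OF integrable_mult_left[OF \<Phi>, of 4]])
      show "AE t in lborel. norm (\<Phi> t * of_real (g t)) \<le> norm (\<Phi> t * 4)"
        using \<open>\<And>t. \<bar>g t\<bar> \<le> 4\<close> by (intro AE_I2) (simp add: norm_mult mult_left_mono)
    qed measurable
    show "bandlimited (C + e) (\<lambda>t. \<Phi> t * of_real (g t))"
      unfolding bandlimited_def
    proof (intro conjI gi allI impI)
      fix x assume x: "C + e < \<bar>x\<bar>"
      define F where "F v t = \<Phi> t * of_real (h t v) * of_real (c v) * chi (x \<bullet> t)" for v t
      have Fm: "F v \<in> borel_measurable lborel" for v unfolding F_def by measurable
      \<comment> \<open>Absolute convergence holds because the bound \<open>all\<close> on the sum
        of the bumps is uniform in \<open>t\<close>.\<close>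
      have fin: "(\<integral>\<^sup>+v. \<integral>\<^sup>+t. ennreal (cmod (F v t)) \<partial>lborel \<partial>count_space V) < \<infinity>"
      proof -
        have "(\<integral>\<^sup>+v. \<integral>\<^sup>+t. ennreal (cmod (F v t)) \<partial>lborel \<partial>count_space V)
          = (\<integral>\<^sup>+t. \<integral>\<^sup>+v. ennreal (cmod (F v t)) \<partial>count_space V \<partial>lborel)"
          by (rule nn_integral_count_space_swap[OF cV sigma_finite_lborel]) (use Fm in measurable)
        also have "\<dots> \<le> (\<integral>\<^sup>+t. ennreal (cmod (\<Phi> t)) * ennreal (2 * (1 + \<kappa>)) \<partial>lborel)"
        proof (intro nn_integral_mono)
          fix t
          have "(\<integral>\<^sup>+v. ennreal (cmod (F v t)) \<partial>count_space V)
            = (\<integral>\<^sup>+v. ennreal (cmod (\<Phi> t)) * ennreal \<bar>c v * h t v\<bar> \<partial>count_space V)"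
            by (intro nn_integral_cong) (simp add: F_def norm_mult ennreal_mult[symmetric] abs_mult mult_ac)
          also have "\<dots> = ennreal (cmod (\<Phi> t)) * (\<integral>\<^sup>+v. ennreal \<bar>c v * h t v\<bar> \<partial>count_space V)"
            by (rule nn_integral_cmult) auto
          also have "\<dots> \<le> ennreal (cmod (\<Phi> t)) * ennreal (2 * (1 + \<kappa>))"
            using \<kappa> by (intro mult_left_mono bound[OF all]) auto
          finally show "(\<integral>\<^sup>+v. ennreal (cmod (F v t)) \<partial>count_space V) \<le> ennreal (cmod (\<Phi> t)) * ennreal (2 * (1 + \<kappa>))" .
        qed
        also have "\<dots> = (\<integral>\<^sup>+t. ennreal (cmod (\<Phi> t)) \<partial>lborel) * ennreal (2 * (1 + \<kappa>))"
          by (rule nn_integral_multc) measurable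
        also have "\<dots> < \<infinity>" using \<Phi> by (simp add: integrable_iff_bounded ennreal_mult_less_top)
        finally show ?thesis .
      qed
      \<comment> \<open>The square contributes two sinc factors costing \<open>e / 2\<close> each,
        so beyond \<open>C + e\<close> every single summand has vanishing transform.\<close>
      have Fv: "(\<integral>t. F v t \<partial>lborel) = 0" for v
      proof -
        let ?s = "\<lambda>t. complex_of_real (nsinc (e * (t - v)))"
        have "bandlimited (C + e / 2 + e / 2) (\<lambda>t. \<Phi> t * ?s t * ?s t)"
          by (intro bandlimited_mult_nsinc bl e)
        then have "fourier (\<lambda>t. \<Phi> t * ?s t * ?s t) x = 0" using x by (simp add: bandlimited_def)
        then have "of_real (c v) * (\<integral>t. \<Phi> t * ?s t * ?s t * chi (x \<bullet> t) \<partial>lborel) = 0" by (simp add: fourier_chi)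
        then show ?thesis
          by (subst (asm) integral_mult_right_zero[symmetric]) (simp add: F_def h_def power2_eq_square mult_ac)
      qed
      have "(\<integral>t. \<integral>v. F v t \<partial>count_space V \<partial>lborel) = (\<integral>v. \<integral>t. F v t \<partial>lborel \<partial>count_space V)"
        by (rule integral_count_space_swap(3)[OF cV sigma_finite_lborel Fm fin, symmetric])
      then have zero: "(\<integral>t. \<integral>v. F v t \<partial>count_space V \<partial>lborel) = 0" by (simp add: Fv)
      have Fsum: "(\<integral>v. F v t \<partial>count_space V) = \<Phi> t * chi (x \<bullet> t) - \<Phi> t * of_real (g t) * chi (x \<bullet> t)" for t
      proof -
        have "(\<integral>v. F v t \<partial>count_space V) = (\<integral>v. (\<Phi> t * chi (x \<bullet> t)) * of_real (c v * h t v) \<partial>count_space V)"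
          by (intro Bochner_Integration.integral_cong) (simp_all add: F_def mult_ac)
        also have "\<dots> = (\<Phi> t * chi (x \<bullet> t)) * (\<integral>v. of_real (c v * h t v) \<partial>count_space V)"
          by (rule integral_mult_right_zero)
        also have "(\<integral>v. complex_of_real (c v * h t v) \<partial>count_space V) = of_real (1 - g t)"
          unfolding g_def by (subst integral_complex_of_real) simp
        finally show ?thesis by (simp add: algebra_simps)
      qed
      have i1: "integrable lborel (\<lambda>t. \<Phi> t * chi (x \<bullet> t))"
        by (rule Bochner_Integration.integrable_bound[OF \<Phi>]) (auto simp: norm_mult)
      have i2: "integrable lborel (\<lambda>t. \<Phi> t * of_real (g t) * chi (x \<bullet> t))"
        by (rule Bochner_Integration.integrable_bound[OF gi]) (auto simp: norm_mult)
      have "fourier \<Phi> x - fourier (\<lambda>t. \<Phi> t * of_real (g t)) x = 0"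
        using zero unfolding Fsum fourier_chi Bochner_Integration.integral_diff[OF i1 i2] .
      moreover have "fourier \<Phi> x = 0" using \<Phi>0 x e by simp
      ultimately show "fourier (\<lambda>t. \<Phi> t * of_real (g t)) x = 0" by simp
    qed
  qed
qed

section \<open>The window function\<close>

text \<open>Bounding both rotated coordinates bounds the pair. This is the finiteness principle
  behind the sparse intervals, the uniform discreteness of the differences and the exclusion of
  lattices.\<close>

lemma finite_coord_window:
  fixes \<tau> A B :: real
  shows "finite {z \<in> (int_lattice :: ('a::euclidean_space \<times> 'a) set). norm (phys \<tau> z) \<le> A \<and> norm (int_coord \<tau> z) \<le> B}"
proof (rule finite_subset[OF _ finite_int_lattice_norm_le])
  show "{z \<in> (int_lattice :: ('a \<times> 'a) set). norm (phys \<tau> z) \<le> A \<and> norm (int_coord \<tau> z) \<le> B}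
    \<subseteq> {z \<in> int_lattice. norm z \<le> (1 + \<bar>\<tau>\<bar>) * (A + B)}"
  proof safe
    fix z :: "'a \<times> 'a" assume z: "norm (phys \<tau> z) \<le> A" "norm (int_coord \<tau> z) \<le> B"
    have "1 * norm z \<le> (1 + \<tau>\<^sup>2) * norm z" by (intro mult_right_mono) auto
    also have "\<dots> = norm ((1 + \<tau>\<^sup>2) *\<^sub>R z)" using pos_one_plus_square[of \<tau>] by simp
    also have "\<dots> \<le> norm (int_coord \<tau> z - \<tau> *\<^sub>R phys \<tau> z) + norm (phys \<tau> z + \<tau> *\<^sub>R int_coord \<tau> z)"
      unfolding pair_from_coords by (rule norm_Pair_le)
    also have "\<dots> \<le> (B + \<bar>\<tau>\<bar> * A) + (A + \<bar>\<tau>\<bar> * B)"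
    proof (intro add_mono)
      show "norm (int_coord \<tau> z - \<tau> *\<^sub>R phys \<tau> z) \<le> B + \<bar>\<tau>\<bar> * A"
        using z mult_left_mono[OF z(1), of "\<bar>\<tau>\<bar>"] by (intro order_trans[OF norm_triangle_ineq4]) simp
      show "norm (phys \<tau> z + \<tau> *\<^sub>R int_coord \<tau> z) \<le> A + \<bar>\<tau>\<bar> * B"
        using z mult_left_mono[OF z(2), of "\<bar>\<tau>\<bar>"] by (intro order_trans[OF norm_triangle_ineq]) simp
    qed
    finally show "norm z \<le> (1 + \<bar>\<tau>\<bar>) * (A + B)" by (simp add: algebra_simps)
  qed
qed

text \<open>Two finite exclusions. Points with conjugate at most \<open>2 * D\<close> occupy
  finitely many positions \<open>S1\<close>, avoided by shrinking the interval. Nonzero differences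
  with conjugate at most \<open>D\<close> have positions bounded away from 0 by
  \<open>\<delta>\<close>, so an open interval of length at most \<open>\<delta>\<close> has no two
  points with conjugates that close.\<close>

lemma exists_sparse_interval:
  fixes a b D \<tau> :: real
  assumes irr: "\<tau> \<notin> \<rat>" and ab: "a < b"
  defines "c \<equiv> 1 + \<tau>\<^sup>2"
  defines "V \<equiv> \<lambda>a b. (\<lambda>z. int_coord \<tau> z / c) ` {z \<in> int_lattice. a < phys \<tau> z / c \<and> phys \<tau> z / c < b}"
  obtains a' b' where "a \<le> a'" "a' < b'" "b' \<le> b" "separated D (V a' b')" "\<And>v. v \<in> V a' b' \<Longrightarrow> 2 * D \<le> \<bar>v\<bar>"
proof -
  have c: "c > 0" unfolding c_def by (rule pos_one_plus_square)
  have fin: "finite {z \<in> int_lattice. \<bar>phys \<tau> z / c\<bar> \<le> A \<and> \<bar>int_coord \<tau> z / c\<bar> \<le> B}" for A B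
    using finite_coord_window[of \<tau> "A * c" "B * c", where 'a=real] c by (simp add: abs_divide divide_le_eq)
  define S1 where "S1 = (\<lambda>z. phys \<tau> z / c) ` {z \<in> int_lattice. \<bar>phys \<tau> z / c\<bar> \<le> \<bar>a\<bar> + \<bar>b\<bar> \<and> \<bar>int_coord \<tau> z / c\<bar> \<le> 2 * D}"
  define S2 where "S2 = (\<lambda>z. \<bar>phys \<tau> z / c\<bar>) ` {z \<in> int_lattice. (\<bar>phys \<tau> z / c\<bar> \<le> b - a \<and> \<bar>int_coord \<tau> z / c\<bar> \<le> D) \<and> z \<noteq> 0}"
  have f1: "finite S1" unfolding S1_def by (intro finite_imageI fin)
  have f2: "finite S2" unfolding S2_def
    by (intro finite_imageI finite_subset[OF _ fin[of "b - a" D]]) auto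
  \<comment> \<open>The 1 guards against an empty \<open>S2\<close>.\<close>
  define \<delta> where "\<delta> = Min (insert 1 S2)"
  have "x > 0" if "x \<in> insert 1 S2" for x
  proof -
    have "phys \<tau> z \<noteq> 0" if "z \<in> int_lattice" "z \<noteq> 0" for z :: "real \<times> real"
      using inj_onD[OF inj_on_phys[OF irr], of z 0] that int_lattice_0 by (auto simp: phys_def)
    then show ?thesis using that c by (auto simp: S2_def)
  qed
  then have \<delta>: "\<delta> > 0" using f2 by (simp add: \<delta>_def)
  have "infinite ({a<..<b} - S1)" using f1 ab by simp
  then obtain x where x: "x \<in> {a<..<b} - S1" using infinite_imp_nonempty by blast
  have "open ({a<..<b} - S1)" using f1 by (intro open_Diff finite_imp_closed) auto
  then obtain r where r: "r > 0" "ball x r \<subseteq> {a<..<b} - S1" using x open_contains_ball by blast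
  define s where "s = min r (\<delta> / 2)"
  have s: "s > 0" "s \<le> r" "2 * s \<le> \<delta>" using r \<delta> by (auto simp: s_def)
  have sub: "y \<in> {a<..<b} - S1" if "x - s < y" "y < x + s" for y
    using that r(2) s by (intro subsetD[OF r(2)]) (auto simp: dist_real_def)
  show thesis
  proof
    show "x - s < x + s" using s by simp
    show ax: "a \<le> x - s"
    proof (rule ccontr)
      assume "\<not> a \<le> x - s"
      then have "x - s < a" by simp
      moreover have "a < x + s" using x s by auto
      ultimately show False using sub[of a] by auto
    qed
    show bx: "x + s \<le> b"
    proof (rule ccontr)
      assume "\<not> x + s \<le> b"
      moreover have "x - s < b" using x s by auto
      ultimately show False using sub[of b] by auto
    qed
    show "separated D (V (x - s) (x + s))"
      unfolding separated_def
    proof (intro ballI impI, rule ccontr)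
      fix v v' assume v: "v \<in> V (x - s) (x + s)" "v' \<in> V (x - s) (x + s)" "v \<noteq> v'" "\<not> D \<le> \<bar>v - v'\<bar>"
      then obtain z z' where z: "z \<in> int_lattice" "z' \<in> int_lattice" "v = int_coord \<tau> z / c" "v' = int_coord \<tau> z' / c"
        "x - s < phys \<tau> z / c" "phys \<tau> z / c < x + s" "x - s < phys \<tau> z' / c" "phys \<tau> z' / c < x + s"
        by (auto simp: V_def)
      have p: "phys \<tau> (z - z') / c = phys \<tau> z / c - phys \<tau> z' / c" and i: "int_coord \<tau> (z - z') / c = v - v'"
        by (simp_all add: z phys_diff int_coord_diff diff_divide_distrib)
      have lt: "\<bar>phys \<tau> (z - z') / c\<bar> < 2 * s" unfolding p using z by linarith
      have "\<bar>phys \<tau> (z - z') / c\<bar> \<in> S2"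
        unfolding S2_def
      proof (intro imageI CollectI conjI)
        show "z - z' \<in> int_lattice" using z by (intro int_lattice_diff)
        show "\<bar>phys \<tau> (z - z') / c\<bar> \<le> b - a" using lt ax bx by linarith
        show "\<bar>int_coord \<tau> (z - z') / c\<bar> \<le> D" unfolding i using v by linarith
        show "z - z' \<noteq> 0" using v z by auto
      qed
      then have "\<delta> \<le> \<bar>phys \<tau> (z - z') / c\<bar>" unfolding \<delta>_def using f2 by (intro Min_le) auto
      then show False using lt s by linarith
    qed
    fix v assume "v \<in> V (x - s) (x + s)"
    then obtain z where z: "z \<in> int_lattice" "v = int_coord \<tau> z / c" "x - s < phys \<tau> z / c" "phys \<tau> z / c < x + s"
      by (auto simp: V_def)
    show "2 * D \<le> \<bar>v\<bar>"
    proof (rule ccontr)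
      assume "\<not> 2 * D \<le> \<bar>v\<bar>"
      moreover have "\<bar>phys \<tau> z / c\<bar> \<le> \<bar>a\<bar> + \<bar>b\<bar>" using z ax bx by linarith
      ultimately have "phys \<tau> z / c \<in> S1" unfolding S1_def
        using z by (intro imageI CollectI conjI) auto
      then show False using sub[OF z(3,4)] by simp
    qed
  qed
qed

text \<open>The order of choices matters: bandwidth and tolerance determine \<open>D\<close>, and
  only then is the interval shrunk until its conjugates are separated by \<open>D\<close>.\<close>

lemma exists_gap_multiplier:
  fixes a b D0 e \<eta> \<tau> :: real
  assumes irr: "\<tau> \<notin> \<rat>" and ab: "a < b" and e: "e > 0" and \<eta>: "\<eta> > 0" "\<eta> \<le> 1"
  obtains g :: "real \<Rightarrow> real" and D a' b' where "continuous_on UNIV g" "D0 \<le> D" "\<And>t. \<bar>g t\<bar> \<le> 4"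
    "\<And>t. \<bar>t\<bar> \<le> D \<Longrightarrow> \<bar>g t - 1\<bar> \<le> \<eta>"
    "\<And>C \<Phi>. bandlimited C \<Phi> \<Longrightarrow> bandlimited (C + e) (\<lambda>t. \<Phi> t * of_real (g t))"
    "a \<le> a'" "a' < b'" "b' \<le> b"
    "\<And>z. z \<in> int_lattice \<Longrightarrow> a' < phys \<tau> z / (1 + \<tau>\<^sup>2) \<Longrightarrow> phys \<tau> z / (1 + \<tau>\<^sup>2) < b' \<Longrightarrow>
      g (int_coord \<tau> z / (1 + \<tau>\<^sup>2)) = 0"
proof -
  \<comment> \<open>Since \<open>D \<ge> 1\<close>, the linear lower bound in the last term implies
    the quadratic one required for \<open>small\<close>; 20 is the 5 of the far estimate times the 4
    of \<open>\<eta> / 4\<close>.\<close>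
  define D where "D = max (max D0 1) (20 * sep_bound / (e\<^sup>2 * \<eta>))"
  have D: "D0 \<le> D" "1 \<le> D" "20 * sep_bound / (e\<^sup>2 * \<eta>) \<le> D" by (simp_all add: D_def)
  have "20 * sep_bound \<le> D * (e\<^sup>2 * \<eta>)" using D(3) e \<eta> by (simp add: divide_le_eq)
  also have "\<dots> \<le> D\<^sup>2 * (e\<^sup>2 * \<eta>)" using D(2) e \<eta> by (intro mult_right_mono) (auto simp: power2_eq_square)
  finally have small: "5 * sep_bound / (e * D)\<^sup>2 \<le> \<eta> / 4"
    using D(2) e by (simp add: divide_le_eq power_mult_distrib mult_ac)
  obtain a' b' where ab': "a \<le> a'" "a' < b'" "b' \<le> b"
    "separated D ((\<lambda>z. int_coord \<tau> z / (1 + \<tau>\<^sup>2)) ` {z \<in> int_lattice. a' < phys \<tau> z / (1 + \<tau>\<^sup>2) \<and> phys \<tau> z / (1 + \<tau>\<^sup>2) < b'})"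
    "\<And>v. v \<in> (\<lambda>z. int_coord \<tau> z / (1 + \<tau>\<^sup>2)) ` {z \<in> int_lattice. a' < phys \<tau> z / (1 + \<tau>\<^sup>2) \<and> phys \<tau> z / (1 + \<tau>\<^sup>2) < b'} \<Longrightarrow> 2 * D \<le> \<bar>v\<bar>"
    by (rule exists_sparse_interval[OF irr ab, of D]) (rule that)
  have D0: "D > 0" using D(2) by linarith
  obtain g where g: "continuous_on UNIV g"
    "\<And>v. v \<in> (\<lambda>z. int_coord \<tau> z / (1 + \<tau>\<^sup>2)) ` {z \<in> int_lattice. a' < phys \<tau> z / (1 + \<tau>\<^sup>2) \<and> phys \<tau> z / (1 + \<tau>\<^sup>2) < b'} \<Longrightarrow> g v = 0"
    "\<And>t. \<bar>g t\<bar> \<le> 4" "\<And>t. \<bar>t\<bar> \<le> D \<Longrightarrow> \<bar>g t - 1\<bar> \<le> \<eta>"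
    "\<And>C \<Phi>. bandlimited C \<Phi> \<Longrightarrow> bandlimited (C + e) (\<lambda>t. \<Phi> t * of_real (g t))"
    using exists_vanishing_multiplier[OF e \<eta>(2) D0 small ab'(4,5)] by blast
  show thesis by (rule that[OF g(1) D(1) g(3,4,5) ab'(1,2,3)]) (auto intro: g(2))
qed

text \<open>The window is an infinite product of squared multipliers, the \<open>j\<close>-th of which clears the
  spectrum from some interval inside the \<open>j\<close>-th rational interval; it differs appreciably from \<open>1\<close>
  only at distances at which the decay of the first factor can absorb it.\<close>

theorem exists_window:
  fixes \<tau> :: real
  assumes irr: "\<tau> \<notin> \<rat>"
  obtains \<Phi> :: "real \<Rightarrow> real" and K C where "continuous_on UNIV \<Phi>" "\<And>t. 0 \<le> \<Phi> t" "\<And>t. \<Phi> t \<le> K * (weight t)\<^sup>2"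
    "\<Phi> 0 > 0" "bandlimited C (\<lambda>t. of_real (\<Phi> t))"
    "\<And>a b. a < b \<Longrightarrow> \<exists>a' b'. a \<le> a' \<and> a' < b' \<and> b' \<le> b \<and>
       (\<forall>z\<in>int_lattice. a' < phys \<tau> z / (1 + \<tau>\<^sup>2) \<and> phys \<tau> z / (1 + \<tau>\<^sup>2) < b' \<longrightarrow>
          \<Phi> (int_coord \<tau> z / (1 + \<tau>\<^sup>2)) = 0)"
proof -
  \<comment> \<open>All pairs of rationals are enumerated. When \<open>lo j < hi j\<close> fails
    there is nothing to clear, and the multiplier is built for a dummy interval.\<close>
  define lo hi :: "nat \<Rightarrow> real" where "lo j = of_rat (fst (from_nat j :: rat \<times> rat))"
    and "hi j = of_rat (snd (from_nat j :: rat \<times> rat))" for j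
  \<comment> \<open>\<open>4 ^ (j + 1)\<close> is chosen because the squares of the factors up to
    index \<open>j\<close> multiply to at most \<open>16 ^ (j + 1)\<close>, which is below
    \<open>t\<^sup>2\<close> once \<open>\<bar>t\<bar>\<close> exceeds \<open>D\<close>. Tolerances
    and bandwidths are geometric, hence summable.\<close>
  define P where "P j g D a' b' \<longleftrightarrow> continuous_on UNIV g \<and> 4 ^ (j + 1) \<le> D \<and> (\<forall>t. \<bar>g t\<bar> \<le> 4) \<and>
    (\<forall>t. \<bar>t\<bar> \<le> D \<longrightarrow> \<bar>g t - 1\<bar> \<le> (1 / 2) ^ (j + 4)) \<and>
    (\<forall>C \<Phi>. bandlimited C \<Phi> \<longrightarrow> bandlimited (C + (1 / 2) ^ j) (\<lambda>t. \<Phi> t * of_real (g t))) \<and>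
    (lo j < hi j \<longrightarrow> lo j \<le> a' \<and> a' < b' \<and> b' \<le> hi j \<and>
      (\<forall>z\<in>int_lattice. a' < phys \<tau> z / (1 + \<tau>\<^sup>2) \<and> phys \<tau> z / (1 + \<tau>\<^sup>2) < b' \<longrightarrow> g (int_coord \<tau> z / (1 + \<tau>\<^sup>2)) = 0))"
    for j and g :: "real \<Rightarrow> real" and D a' b'
  have "\<exists>g D a' b'. P j g D a' b'" for j
  proof -
    have ab: "(if lo j < hi j then lo j else 0) < (if lo j < hi j then hi j else 1)" by auto
    have 2: "(1 / 2 :: real) ^ j > 0" "(1 / 2 :: real) ^ (j + 4) > 0" "(1 / 2 :: real) ^ (j + 4) \<le> 1"
      by (simp_all add: power_le_one del: power_add)
    show ?thesis
      by (rule exists_gap_multiplier[OF irr ab 2, of "4 ^ (j + 1)"], unfold P_def, intro exI) (auto split: if_splits)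
  qed
  then obtain g D a' b' where P: "\<And>j. P j (g j) (D j) (a' j) (b' j)" by metis
  have gc: "continuous_on UNIV (g j)" and D: "4 ^ (j + 1) \<le> D j" and g4: "\<bar>g j t\<bar> \<le> 4"
    and g1: "\<bar>t\<bar> \<le> D j \<Longrightarrow> \<bar>g j t - 1\<bar> \<le> (1 / 2) ^ (j + 4)"
    and gb: "bandlimited C \<Phi> \<Longrightarrow> bandlimited (C + (1 / 2) ^ j) (\<lambda>t. \<Phi> t * of_real (g j t))"
    for j t C \<Phi> using P[of j] unfolding P_def by blast+
  define G where "G J t = (\<Prod>j<J. (g j t)\<^sup>2)" for J t
  have GS: "G (Suc J) t = G J t * (g J t)\<^sup>2" for J t by (simp add: G_def)
  have G0: "G 0 t = 1" for t by (simp add: G_def)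
  have Gnn: "0 \<le> G J t" for J t unfolding G_def by (intro prod_nonneg) auto
  \<comment> \<open>Factor the difference of squares: \<open>g j t + 1\<close> has modulus at most
    3, and 3 times the tolerance stays below \<open>(1 / 2) ^ (j + 2)\<close>.\<close>
  have sq: "\<bar>(g j t)\<^sup>2 - 1\<bar> \<le> (1 / 2) ^ (j + 2)" if "\<bar>t\<bar> \<le> D j" for j t
  proof -
    have h: "(1 / 2 :: real) ^ (j + 4) \<le> 1" by (intro power_le_one) auto
    have "\<bar>(g j t)\<^sup>2 - 1\<bar> = \<bar>g j t - 1\<bar> * \<bar>(g j t - 1) + 2\<bar>"
      by (simp add: abs_mult[symmetric] power2_eq_square algebra_simps)
    also have "\<dots> \<le> (1 / 2) ^ (j + 4) * 3"
      using g1[OF that] h by (intro mult_mono) auto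
    also have "\<dots> \<le> (1 / 2) ^ (j + 2)" by (simp add: power_add power_divide field_simps)
    finally show ?thesis .
  qed
  \<comment> \<open>The slack \<open>(1 / 2) ^ J\<close> lets the induction close: for
    \<open>q = (1 / 2) ^ J\<close> one has
    \<open>(2 - q) * (1 + q / 4) \<le> 2 - q / 2\<close>.\<close>
  have Gle: "G J t \<le> (2 - (1 / 2) ^ J) * (1 + t\<^sup>2)" for J t
  proof (induction J)
    case (Suc J)
    define q where "q = (1 / 2 :: real) ^ J"
    have q: "0 < q" "q \<le> 1" by (simp_all add: q_def power_le_one)
    have q': "(1 / 2 :: real) ^ Suc J = q / 2" "(1 / 2 :: real) ^ (J + 2) = q / 4" by (simp_all add: q_def power_add)
    show ?case
    proof (cases "\<bar>t\<bar> \<le> D J")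
      case True
      then have "(g J t)\<^sup>2 \<le> 1 + q / 4" using sq[OF True] q' by linarith
      then have "G (Suc J) t \<le> (2 - q) * (1 + t\<^sup>2) * (1 + q / 4)"
        unfolding GS using Suc.IH q Gnn[of J t] by (intro mult_mono) (auto simp: q_def)
      also have "\<dots> = (2 - q) * (1 + q / 4) * (1 + t\<^sup>2)" by simp
      also have "\<dots> \<le> (2 - q / 2) * (1 + t\<^sup>2)"
      proof (intro mult_right_mono)
        have "0 \<le> q * q" by simp
        then show "(2 - q) * (1 + q / 4) \<le> 2 - q / 2" by (simp add: algebra_simps)
      qed auto
      finally show ?thesis unfolding q' .
    next
      \<comment> \<open>Outside radius \<open>D J\<close> the induction hypothesis is discarded: all
        factors together are at most \<open>(4 ^ (J + 1))\<^sup>2\<close>, which is at most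
        \<open>t\<^sup>2\<close>.\<close>
      case False
      have "G (Suc J) t \<le> (\<Prod>j<Suc J. 4\<^sup>2)" unfolding G_def
        using g4 power_mono[OF g4 abs_ge_zero, where n=2] by (intro prod_mono) auto
      also have "\<dots> = (4 ^ (J + 1))\<^sup>2" by (simp only: prod_constant card_lessThan Suc_eq_plus1 power_mult[symmetric] mult.commute)
      also have "\<dots> \<le> \<bar>t\<bar>\<^sup>2" using False D[of J] by (intro power_mono) auto
      also have "\<dots> \<le> 1 * (1 + t\<^sup>2)" by simp
      also have "\<dots> \<le> (2 - q / 2) * (1 + t\<^sup>2)" using q by (intro mult_right_mono) auto
      finally show ?thesis unfolding q' .
    qed
  qed (simp add: G0)
  have Gle2: "G J t \<le> 2 * (1 + t\<^sup>2)" for J t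
    by (rule order_trans[OF Gle], rule mult_right_mono) auto
  \<comment> \<open>The same device from below keeps the value at 0 above 1/2, so that the limit is
    not trivial.\<close>
  have Gge: "1 / 2 + (1 / 2) ^ Suc J \<le> G J 0" for J
  proof (induction J)
    case (Suc J)
    define q where "q = (1 / 2 :: real) ^ J"
    have q: "0 < q" "q \<le> 1" by (simp_all add: q_def power_le_one)
    have q': "(1 / 2 :: real) ^ Suc (Suc J) = q / 4" "(1 / 2 :: real) ^ (J + 2) = q / 4" "(1 / 2 :: real) ^ Suc J = q / 2"
      by (simp_all add: q_def power_add)
    have "\<bar>0::real\<bar> \<le> D J" using D[of J] zero_le_power[of "4::real" "J + 1"] by linarith
    then have "1 - q / 4 \<le> (g J 0)\<^sup>2" using sq[of 0 J] q' by linarith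
    then have "(1 / 2 + q / 2) * (1 - q / 4) \<le> G (Suc J) 0"
      unfolding GS using Suc.IH q Gnn[of J 0] q' by (intro mult_mono) auto
    moreover have "1 / 2 + q / 4 \<le> (1 / 2 + q / 2) * (1 - q / 4)"
    proof -
      have "q * q \<le> 1 * q" using q by (intro mult_right_mono) auto
      then show ?thesis by (simp add: algebra_simps)
    qed
    ultimately show ?case unfolding q' by linarith
  qed (simp add: G0)
  \<comment> \<open>The limit is written as a telescoping series so that the M-test yields locally
    uniform convergence and with it continuity.\<close>
  define L where "L t = 1 + (\<Sum>i. G (Suc i) t - G i t)" for t
  have unif: "uniform_limit (ball 0 R) (\<lambda>J t. \<Sum>i<J. G (Suc i) t - G i t) (\<lambda>t. \<Sum>i. G (Suc i) t - G i t) sequentially" for R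
  proof (rule Weierstrass_m_test_ev)
    show "summable (\<lambda>j. 2 * (1 + R\<^sup>2) * (1 / 2 :: real) ^ (j + 2))"
      by (intro summable_mult) (simp add: power_add summable_divide summable_geometric del: power_one_over)
    \<comment> \<open>From index \<open>J0\<close> on, the whole ball lies within radius
      \<open>D j\<close>, where the factors are close to 1.\<close>
    obtain J0 :: nat where J0: "R < 4 ^ J0" using real_arch_pow[of 4 R] by auto
    show "\<forall>\<^sub>F j in sequentially. \<forall>t\<in>ball 0 R. norm (G (Suc j) t - G j t) \<le> 2 * (1 + R\<^sup>2) * (1 / 2) ^ (j + 2)"
    proof (rule eventually_sequentiallyI[of J0], safe)
      fix j and t :: real assume j: "J0 \<le> j" and t: "t \<in> ball 0 R"
      have "\<bar>t\<bar> \<le> R" using t by (simp add: dist_real_def)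
      moreover have "(4::real) ^ J0 \<le> 4 ^ (j + 1)" using j by (intro power_increasing) auto
      ultimately have tD: "\<bar>t\<bar> \<le> D j" using J0 D[of j] by linarith
      have "t\<^sup>2 \<le> R\<^sup>2" using \<open>\<bar>t\<bar> \<le> R\<close> by (simp add: abs_le_square_iff[symmetric])
      then have Gj: "G j t \<le> 2 * (1 + R\<^sup>2)" by (intro order_trans[OF Gle2[of j t]] mult_left_mono add_left_mono) auto
      have "G (Suc j) t - G j t = G j t * ((g j t)\<^sup>2 - 1)" by (simp add: GS right_diff_distrib)
      then have "norm (G (Suc j) t - G j t) = G j t * \<bar>(g j t)\<^sup>2 - 1\<bar>" using Gnn[of j t] by (simp add: abs_mult)
      also have "\<dots> \<le> 2 * (1 + R\<^sup>2) * (1 / 2) ^ (j + 2)"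
        using Gj sq[OF tD] Gnn[of j t] by (intro mult_mono) auto
      finally show "norm (G (Suc j) t - G j t) \<le> 2 * (1 + R\<^sup>2) * (1 / 2) ^ (j + 2)" .
    qed
  qed
  have tele: "(\<Sum>i<J. G (Suc i) t - G i t) = G J t - 1" for J t
    using sum_lessThan_telescope[of "\<lambda>i. G i t" J] by (simp add: G0)
  have lim: "(\<lambda>J. G J t) \<longlonglongrightarrow> L t" for t
  proof -
    have "(\<lambda>J. G J t - 1) \<longlonglongrightarrow> (\<Sum>i. G (Suc i) t - G i t)"
      using tendsto_uniform_limitI[OF unif[of "\<bar>t\<bar> + 1"], of t] unfolding tele by (simp add: dist_real_def)
    then have "(\<lambda>J. 1 + (G J t - 1)) \<longlonglongrightarrow> 1 + (\<Sum>i. G (Suc i) t - G i t)" by (intro tendsto_intros)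
    then show ?thesis by (simp add: L_def)
  qed
  have Gc: "continuous_on S (G J)" for S J
    unfolding G_def[abs_def] by (intro continuous_intros continuous_on_subset[OF gc]) auto
  have Lc: "continuous_on UNIV L"
  proof -
    have "continuous_on (ball 0 R) (\<lambda>t. \<Sum>i. G (Suc i) t - G i t)" for R
      by (rule uniform_limit_theorem[OF _ unif]) (auto intro!: always_eventually continuous_intros Gc)
    then have "continuous_on UNIV (\<lambda>t. \<Sum>i. G (Suc i) t - G i t)" by (rule continuous_on_all_balls)
    then show ?thesis unfolding L_def[abs_def] by (intro continuous_intros)
  qed
  have Lnn: "0 \<le> L t" for t by (rule LIMSEQ_le_const[OF lim]) (use Gnn in auto)
  have Lle: "L t \<le> 2 * (1 + t\<^sup>2)" for t by (rule LIMSEQ_le_const2[OF lim]) (use Gle2 in auto)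
  have L0: "1 / 2 \<le> L 0"
  proof (rule LIMSEQ_le_const[OF lim])
    have "1 / 2 \<le> G J 0" for J using Gge[of J] zero_le_power[of "1/2::real" "Suc J"] by linarith
    then show "\<exists>N. \<forall>n\<ge>N. 1 / 2 \<le> G n 0" by auto
  qed
  \<comment> \<open>This power lies below a multiple of the cubed weight: one weight pays for the
    quadratic growth of \<open>L\<close>, two are left for the required decay.\<close>
  define B where "B t = (nsinc t) ^ 8" for t
  have Bnn: "0 \<le> B t" for t by (simp add: B_def)
  have Ble: "B t \<le> 8 * (weight t) ^ 3" for t
  proof -
    have "B t = (nsinc t)\<^sup>2 * ((nsinc t)\<^sup>2) ^ 3" by (simp add: B_def power_mult[symmetric] power_add[symmetric])
    also have "\<dots> \<le> 1 * (2 * weight t) ^ 3"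
      using nsinc_square_le_1[of t] nsinc_square_le[of t] by (intro mult_mono power_mono) (auto simp: weight_real)
    finally show ?thesis by (simp add: power_mult_distrib)
  qed
  have Bc: "continuous_on UNIV B" unfolding B_def[abs_def] by (intro continuous_intros)
  have Bb: "bandlimited 4 (\<lambda>t. of_real (B t))"
  proof -
    let ?n = "\<lambda>t. complex_of_real (nsinc (1 * (t - 0)))"
    \<comment> \<open>Band 1 for the square, then 1/2 for each of the six further sinc
      factors.\<close>
    have "bandlimited (1 + 1/2 + 1/2 + 1/2 + 1/2 + 1/2 + 1/2)
      (\<lambda>t. of_real ((nsinc t)\<^sup>2) * ?n t * ?n t * ?n t * ?n t * ?n t * ?n t)"
      by (intro bandlimited_mult_nsinc bandlimited_nsinc_square) auto
    then show ?thesis by (simp add: B_def eval_nat_numeral mult_ac)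
  qed
  have BG: "B t * (2 * (1 + t\<^sup>2)) \<le> 16 * (weight t)\<^sup>2" for t
  proof -
    have "B t * (2 * (1 + t\<^sup>2)) \<le> 8 * (weight t) ^ 3 * (2 * (1 + t\<^sup>2))"
      using Ble[of t] by (intro mult_right_mono) auto
    also have "\<dots> = 16 * (weight t)\<^sup>2 * (weight t * (1 + t\<^sup>2))" by (simp add: eval_nat_numeral)
    also have "weight t * (1 + t\<^sup>2) = 1" using pos_one_plus_square[of t] by (simp add: weight_real)
    finally show ?thesis by simp
  qed
  \<comment> \<open>Each squared multiplier costs its bandwidth twice. These costs sum to at most 4,
    so one common band 8 serves all partial products and survives the dominated limit.\<close>
  have Gb: "bandlimited (4 + (\<Sum>j<J. 2 * (1 / 2) ^ j)) (\<lambda>t. of_real (B t * G J t))" for J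
  proof (induction J)
    case 0 show ?case using Bb by (simp add: G0)
  next
    case (Suc J)
    have "bandlimited (4 + (\<Sum>j<J. 2 * (1 / 2) ^ j) + (1 / 2) ^ J + (1 / 2) ^ J)
       (\<lambda>t. of_real (B t * G J t) * of_real (g J t) * of_real (g J t))"
      by (intro gb Suc.IH)
    then show ?case by (simp add: GS power2_eq_square mult_ac add_ac)
  qed
  have sum_le: "(\<Sum>j<J. 2 * (1 / 2 :: real) ^ j) \<le> 4" for J
  proof -
    have "(\<Sum>j<J. (1 / 2 :: real) ^ j) \<le> (\<Sum>j. (1 / 2) ^ j)" by (intro sum_le_suminf summable_geometric) auto
    also have "\<dots> = 2" by (subst suminf_geometric) auto
    finally show ?thesis by (simp add: sum_distrib_left[symmetric])
  qed
  define \<Phi> where "\<Phi> t = B t * L t" for t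
  have \<Phi>c: "continuous_on UNIV \<Phi>" unfolding \<Phi>_def[abs_def] by (intro continuous_intros Bc Lc)
  have \<Phi>nn: "0 \<le> \<Phi> t" for t by (simp add: \<Phi>_def Bnn Lnn)
  have \<Phi>le: "\<Phi> t \<le> 16 * (weight t)\<^sup>2" for t
    using mult_left_mono[OF Lle[of t] Bnn[of t]] BG[of t] by (simp add: \<Phi>_def)
  have \<Phi>b: "bandlimited 8 (\<lambda>t. of_real (\<Phi> t))"
    unfolding bandlimited_def
  proof (intro conjI allI impI)
    have m: "(\<lambda>t. complex_of_real (\<Phi> t)) \<in> borel_measurable borel"
      by (intro borel_measurable_continuous_onI continuous_intros \<Phi>c)
    show "integrable lborel (\<lambda>t. complex_of_real (\<Phi> t))"
      by (rule integrable_le_weight_square[OF m, of 16]) (use \<Phi>le \<Phi>nn in simp)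
    fix x :: real assume x: "8 < \<bar>x\<bar>"
    have "(\<lambda>J. \<integral>t. of_real (B t * G J t) * chi (x \<bullet> t) \<partial>lborel) \<longlonglongrightarrow> (\<integral>t. of_real (\<Phi> t) * chi (x \<bullet> t) \<partial>lborel)"
    proof (rule integral_dominated_convergence[where w="\<lambda>t. 16 * weight t"])
      show "integrable lborel (\<lambda>t::real. 16 * weight t)" by (intro integrable_mult_right integrable_weight)
      show "AE t in lborel. (\<lambda>J. of_real (B t * G J t) * chi (x \<bullet> t)) \<longlonglongrightarrow> of_real (\<Phi> t) * chi (x \<bullet> t)"
        unfolding \<Phi>_def by (intro AE_I2 tendsto_intros lim)
      have "(\<lambda>t. of_real (B t * G J t) * chi (x \<bullet> t)) \<in> borel_measurable borel" for J
        by (intro borel_measurable_continuous_onI continuous_intros Bc Gc)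
      then show "(\<lambda>t. of_real (B t * G J t) * chi (x \<bullet> t)) \<in> borel_measurable lborel" for J by simp
      have "(\<lambda>t. of_real (\<Phi> t) * chi (x \<bullet> t)) \<in> borel_measurable borel"
        by (intro borel_measurable_continuous_onI continuous_intros \<Phi>c)
      then show "(\<lambda>t. of_real (\<Phi> t) * chi (x \<bullet> t)) \<in> borel_measurable lborel" by simp
      show "AE t in lborel. norm (of_real (B t * G J t) * chi (x \<bullet> t)) \<le> 16 * weight t" for J
      proof (rule AE_I2)
        fix t :: real
        have "B t * G J t \<le> B t * (2 * (1 + t\<^sup>2))" by (intro mult_left_mono Gle2 Bnn)
        then have "B t * G J t \<le> 16 * weight t" using BG[of t] weight_square_le[of t] by linarith
        then show "norm (of_real (B t * G J t) * chi (x \<bullet> t)) \<le> 16 * weight t"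
          using Bnn[of t] Gnn[of J t] by (simp add: norm_mult)
      qed
    qed
    moreover have "(\<integral>t. of_real (B t * G J t) * chi (x \<bullet> t) \<partial>lborel) = 0" for J
    proof -
      have "4 + (\<Sum>j<J. 2 * (1 / 2) ^ j) < \<bar>x\<bar>" using sum_le[of J] x by linarith
      then show ?thesis using Gb[of J] unfolding bandlimited_def fourier_chi by blast
    qed
    ultimately have "(\<lambda>J. 0) \<longlonglongrightarrow> (\<integral>t. of_real (\<Phi> t) * chi (x \<bullet> t) \<partial>lborel)" by simp
    from LIMSEQ_unique[OF this tendsto_const] show "fourier (\<lambda>t. complex_of_real (\<Phi> t)) x = 0"
      by (simp add: fourier_chi)
  qed
  \<comment> \<open>A vanishing factor annihilates all later partial products, hence the
    limit.\<close>
  have zero: "\<Phi> t = 0" if "g j t = 0" for j t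
  proof -
    have "\<forall>\<^sub>F J in sequentially. G J t = 0"
      using that by (intro eventually_sequentiallyI[of "Suc j"]) (auto simp: G_def)
    then have "(\<lambda>J. G J t) \<longlonglongrightarrow> 0" by (rule tendsto_eventually)
    from LIMSEQ_unique[OF lim this] show ?thesis by (simp add: \<Phi>_def)
  qed
  show thesis
  proof (rule that[OF \<Phi>c \<Phi>nn \<Phi>le _ \<Phi>b])
    show "\<Phi> 0 > 0" using L0 by (simp add: \<Phi>_def B_def)
    fix a b :: real assume "a < b"
    then obtain p where p: "a < of_rat p" "of_rat p < b" using of_rat_dense by blast
    then obtain r where r: "of_rat p < (of_rat r :: real)" "of_rat r < b" using of_rat_dense by blast
    define j where "j = to_nat (p, r)"
    have j: "lo j = of_rat p" "hi j = of_rat r" by (simp_all add: lo_def hi_def j_def)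
    have "lo j \<le> a' j \<and> a' j < b' j \<and> b' j \<le> hi j \<and>
      (\<forall>z\<in>int_lattice. a' j < phys \<tau> z / (1 + \<tau>\<^sup>2) \<and> phys \<tau> z / (1 + \<tau>\<^sup>2) < b' j \<longrightarrow> g j (int_coord \<tau> z / (1 + \<tau>\<^sup>2)) = 0)"
      using P[of j] r j by (simp add: P_def)
    then show "\<exists>a' b'. a \<le> a' \<and> a' < b' \<and> b' \<le> b \<and>
       (\<forall>z\<in>int_lattice. a' < phys \<tau> z / (1 + \<tau>\<^sup>2) \<and> phys \<tau> z / (1 + \<tau>\<^sup>2) < b' \<longrightarrow>
          \<Phi> (int_coord \<tau> z / (1 + \<tau>\<^sup>2)) = 0)"
      using zero p r j by (intro exI[of _ "a' j"] exI[of _ "b' j"]) auto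
  qed
qed

section \<open>Geometry of the supports\<close>

definition tensor_power :: "(real \<Rightarrow> real) \<Rightarrow> 'a::euclidean_space \<Rightarrow> real" where
  "tensor_power \<Phi> y = (\<Prod>b\<in>Basis. \<Phi> (y \<bullet> b))"

lemma chi_sum: "finite A \<Longrightarrow> chi (\<Sum>b\<in>A. f b) = (\<Prod>b\<in>A. chi (f b))"
  by (induction rule: finite_induct) (auto simp: chi_add)

lemma fourier_tensor_power:
  fixes x :: "'a::euclidean_space"
  assumes "integrable lborel (\<lambda>t. complex_of_real (\<Phi> t))"
  shows "fourier (\<lambda>y. of_real (tensor_power \<Phi> y)) x = (\<Prod>b\<in>Basis. fourier (\<lambda>t. of_real (\<Phi> t)) (x \<bullet> b))"
proof -
  have [measurable]: "(\<lambda>t. complex_of_real (\<Phi> t)) \<in> borel_measurable borel"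
    using borel_measurable_integrable[OF assms] by simp
  have "fourier (\<lambda>y. of_real (tensor_power \<Phi> y)) x
    = (\<integral>y. (\<Prod>b\<in>Basis. of_real (\<Phi> (y \<bullet> b)) * chi ((x \<bullet> b) * (y \<bullet> b))) \<partial>lborel)"
    unfolding fourier_chi
  proof (intro Bochner_Integration.integral_cong refl)
    fix y :: 'a
    have "chi (x \<bullet> y) = (\<Prod>b\<in>Basis. chi ((x \<bullet> b) * (y \<bullet> b)))"
      by (subst euclidean_inner) (simp add: chi_sum)
    then show "of_real (tensor_power \<Phi> y) * chi (x \<bullet> y)
      = (\<Prod>b\<in>Basis. of_real (\<Phi> (y \<bullet> b)) * chi ((x \<bullet> b) * (y \<bullet> b)))"
      by (simp add: tensor_power_def prod.distrib)
  qed
  also have "\<dots> = (\<Prod>b\<in>Basis. \<integral>t. of_real (\<Phi> t) * chi ((x \<bullet> b) * t) \<partial>lborel)"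
  proof (rule integral_lborel_prod(2))
    show "integrable lborel (\<lambda>t. of_real (\<Phi> t) * chi ((x \<bullet> b) * t))" for b
      by (rule Bochner_Integration.integrable_bound[OF assms]) (auto simp: norm_mult)
  qed
  finally show ?thesis by (simp add: fourier_chi)
qed

lemma tensor_power_le:
  fixes y :: "'a::euclidean_space"
  assumes "\<And>t. 0 \<le> \<Phi> t" "\<And>t. \<Phi> t \<le> K * (weight t)\<^sup>2"
  shows "tensor_power \<Phi> y \<le> K ^ DIM('a) * (weight y)\<^sup>2"
proof -
  have "tensor_power \<Phi> y \<le> (\<Prod>b\<in>(Basis::'a set). K * (weight (y \<bullet> b))\<^sup>2)"
    unfolding tensor_power_def using assms by (intro prod_mono) auto
  also have "\<dots> = K ^ DIM('a) * (\<Prod>b\<in>(Basis::'a set). weight (y \<bullet> b))\<^sup>2"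
    by (simp only: prod.distrib prod_constant prod_power_distrib)
  also have "(\<Prod>b\<in>(Basis::'a set). weight (y \<bullet> b)) = weight y"
    by (simp add: weight_real weight_def[of y])
  finally show ?thesis .
qed

text \<open>Support in a box turns plain boundedness into decay. This supplies the transform-side
  hypothesis of \<open>cp_fourier_pair\<close> with no smoothness of the window.\<close>

lemma weighted_bound_of_box_support:
  fixes F :: "'a::euclidean_space \<Rightarrow> complex"
  assumes M: "\<And>x. cmod (F x) \<le> M" and supp: "\<And>x b. b \<in> Basis \<Longrightarrow> C < \<bar>x \<bullet> b\<bar> \<Longrightarrow> F x = 0"
  shows "cmod (F x) \<le> (1 + C\<^sup>2) ^ (2 * DIM('a)) * M * (weight x)\<^sup>2"
proof (cases "\<forall>b\<in>Basis. \<bar>x \<bullet> b\<bar> \<le> C")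
  case True
  have M0: "0 \<le> M" using norm_ge_zero M by (rule order_trans)
  have "1 = (\<Prod>b\<in>(Basis::'a set). (1 + C\<^sup>2) * (1 / (1 + C\<^sup>2)))"
    using pos_one_plus_square[of C] by simp
  also have "\<dots> \<le> (\<Prod>b\<in>(Basis::'a set). (1 + C\<^sup>2) * (1 / (1 + (x \<bullet> b)\<^sup>2)))"
  proof (intro prod_mono conjI mult_left_mono divide_left_mono)
    fix b :: 'a assume "b \<in> Basis"
    then have "\<bar>x \<bullet> b\<bar> \<le> \<bar>C\<bar>" using True by fastforce
    then show "1 + (x \<bullet> b)\<^sup>2 \<le> 1 + C\<^sup>2" by (simp add: abs_le_square_iff)
  qed (auto simp: pos_one_plus_square)
  also have "\<dots> = (1 + C\<^sup>2) ^ DIM('a) * weight x"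
    by (simp only: weight_def prod.distrib prod_constant)
  finally have "1 \<le> ((1 + C\<^sup>2) ^ DIM('a) * weight x)\<^sup>2" by (simp add: one_le_power)
  then have "1 \<le> (1 + C\<^sup>2) ^ (2 * DIM('a)) * (weight x)\<^sup>2"
    by (simp add: power_mult_distrib power_mult[symmetric] mult.commute)
  from mult_left_mono[OF this M0] M[of x] show ?thesis by (simp add: mult_ac)
next
  case False
  then obtain b where "b \<in> Basis" "C < \<bar>x \<bullet> b\<bar>" by (auto simp: not_le)
  then have "F x = 0" by (rule supp)
  moreover have "0 \<le> M" using norm_ge_zero M by (rule order_trans)
  ultimately show ?thesis by simp
qed

lemma integral_pos_continuous:
  fixes \<Phi> :: "real \<Rightarrow> real"
  assumes "continuous_on UNIV \<Phi>" "\<And>t. 0 \<le> \<Phi> t" "\<Phi> 0 > 0" "integrable lborel \<Phi>"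
  shows "(\<integral>t. \<Phi> t \<partial>lborel) > 0"
proof -
  have "isCont \<Phi> 0" using assms(1) by (simp add: continuous_on_eq_continuous_at)
  then have "\<forall>\<^sub>F t in at 0. \<Phi> 0 / 2 < \<Phi> t"
    using assms(3) unfolding isCont_def by (intro order_tendstoD(1)) auto
  then obtain d where d: "d > 0" "\<And>t. t \<noteq> 0 \<Longrightarrow> \<bar>t\<bar> < d \<Longrightarrow> \<Phi> 0 / 2 < \<Phi> t"
    by (auto simp: eventually_at dist_real_def)
  have "0 < (\<integral>t. indicator {0..d/2} t * (\<Phi> 0 / 2) \<partial>lborel)" using d assms(3) by simp
  also have "\<dots> \<le> (\<integral>t. \<Phi> t \<partial>lborel)"
  proof (rule integral_mono[OF _ assms(4)])
    show "integrable lborel (\<lambda>t. indicator {0..d/2} t * (\<Phi> 0 / 2))"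
      by (intro integrable_mult_left integrable_real_indicator) (auto simp: emeasure_lborel_Icc_eq)
    show "indicator {0..d/2} t * (\<Phi> 0 / 2) \<le> \<Phi> t" for t
      using d(2)[of t] d(1) assms(2)[of t] assms(3) by (cases "t = 0") (auto split: split_indicator)
  qed
  finally show ?thesis .
qed

text \<open>The difference of two points closer than 1 comes from a finite set of pairs, those with
  internal coordinate in the doubled window, so nonzero distances are bounded below.\<close>

lemma uniform_discrete_phys_window:
  fixes \<Lambda> :: "'a::euclidean_space set"
  assumes "\<And>x. x \<in> \<Lambda> \<Longrightarrow> \<exists>z\<in>int_lattice. x = phys \<tau> z \<and> norm (int_coord \<tau> z) \<le> R"
  shows "uniform_discrete \<Lambda>"
proof -
  define F where "F = {z \<in> (int_lattice :: ('a \<times> 'a) set). norm (phys \<tau> z) \<le> 1 \<and> norm (int_coord \<tau> z) \<le> 2 * R}"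
  define N where "N = insert 1 ((\<lambda>z. norm (phys \<tau> z)) ` {z \<in> F. phys \<tau> z \<noteq> 0})"
  have "finite F" unfolding F_def by (rule finite_coord_window)
  then have N: "finite N" "N \<noteq> {}" by (auto simp: N_def)
  have "Min N > 0" using N by (subst Min_gr_iff) (auto simp: N_def)
  moreover have "x = y" if x: "x \<in> \<Lambda>" and y: "y \<in> \<Lambda>" and d: "dist x y < Min N" for x y
  proof (rule ccontr)
    assume ne: "x \<noteq> y"
    obtain z w where z: "z \<in> int_lattice" "x = phys \<tau> z" "norm (int_coord \<tau> z) \<le> R"
      and w: "w \<in> int_lattice" "y = phys \<tau> w" "norm (int_coord \<tau> w) \<le> R" using assms x y by blast
    have "Min N \<le> 1" using N by (intro Min_le) (auto simp: N_def)
    then have "z - w \<in> F" unfolding F_def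
      using z w d norm_triangle_ineq4[of "int_coord \<tau> z" "int_coord \<tau> w"]
      by (auto simp: phys_diff int_coord_diff dist_norm intro: int_lattice_diff)
    moreover have "phys \<tau> (z - w) \<noteq> 0" using ne z w by (simp add: phys_diff)
    ultimately have "norm (phys \<tau> (z - w)) \<in> N" unfolding N_def by (intro insertI2 imageI) simp
    then have "Min N \<le> norm (phys \<tau> (z - w))" using N by (intro Min_le) auto
    then show False using d z w by (simp add: phys_diff dist_norm)
  qed
  ultimately show ?thesis unfolding uniform_discrete_def by blast
qed

text \<open>Compare \<open>x - y\<close> with \<open>y - y\<close>, both of which are
  differences.\<close>

lemma uniform_discrete_of_differences:
  fixes \<Lambda> :: "'a::real_normed_vector set"
  assumes "uniform_discrete {x - y | x y. x \<in> \<Lambda> \<and> y \<in> \<Lambda>}"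
  shows "uniform_discrete \<Lambda>"
proof -
  obtain e where e: "e > 0" "\<And>d d'. d \<in> {x - y | x y. x \<in> \<Lambda> \<and> y \<in> \<Lambda>} \<Longrightarrow>
      d' \<in> {x - y | x y. x \<in> \<Lambda> \<and> y \<in> \<Lambda>} \<Longrightarrow> dist d d' < e \<Longrightarrow> d = d'"
    using assms unfolding uniform_discrete_def by blast
  have "x = y" if "x \<in> \<Lambda>" "y \<in> \<Lambda>" "dist x y < e" for x y
    using e(2)[of "x - y" "y - y"] that by (fastforce simp: dist_norm)
  then show ?thesis using e(1) unfolding uniform_discrete_def by blast
qed

section \<open>Exclusion of finite unions of lattice translates\<close>

lemma int_lattice_real: "x \<in> int_lattice \<longleftrightarrow> x \<in> \<int>" for x :: real
  by (simp add: int_lattice_def)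

lemma int_coord_real_eq_0:
  fixes z :: "real \<times> real"
  assumes "\<tau> \<notin> \<rat>" "z \<in> int_lattice" "int_coord \<tau> z = 0"
  shows "z = 0"
proof -
  obtain p r where z: "z = (p, r)" by (cases z)
  then have pr: "p \<in> \<int>" "r \<in> \<int>" using assms(2) by (auto simp: int_lattice_Pair int_lattice_real)
  have eq: "p = - (\<tau> * r)" using assms(3) z by (simp add: int_coord_def)
  have "r = 0"
  proof (rule ccontr)
    assume "r \<noteq> 0"
    then have "\<tau> = - p / r" using eq by simp
    moreover have "- p / r \<in> \<rat>" using pr Ints_subset_Rats by (intro Rats_divide) auto
    ultimately show False using assms(1) by simp
  qed
  then show ?thesis using eq z by (simp add: zero_prod_def)
qed

text \<open>If there were finitely many, Dirichlet approximation of \<open>\<tau>\<close> would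
  undercut the smallest nonzero internal coordinate.\<close>

lemma infinite_int_coord_small:
  assumes irr: "\<tau> \<notin> \<rat>" and d: "d > 0"
  shows "infinite {z \<in> (int_lattice :: (real \<times> real) set). \<bar>int_coord \<tau> z\<bar> < d}"
proof
  let ?Z = "{z \<in> (int_lattice :: (real \<times> real) set). \<bar>int_coord \<tau> z\<bar> < d}"
  assume fin: "finite ?Z"
  define N where "N = insert d ((\<lambda>z. \<bar>int_coord \<tau> z\<bar>) ` (?Z - {0}))"
  have N: "finite N" "N \<noteq> {}" using fin by (auto simp: N_def)
  have pos: "Min N > 0" using N d int_coord_real_eq_0[OF irr] by (subst Min_gr_iff) (auto simp: N_def)
  obtain m where m: "m > 0" "1 / real m < Min N"
    using reals_Archimedean[OF pos] by (metis inverse_eq_divide zero_less_Suc)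
  obtain h k where hk: "0 < k" "\<bar>of_int k * \<tau> - of_int h\<bar> < 1 / real m"
    using Dirichlet_approx[OF m(1), of \<tau>] by blast
  define z where "z = (- real_of_int h, real_of_int k)"
  have lt: "\<bar>int_coord \<tau> z\<bar> < Min N" using hk m by (simp add: z_def int_coord_def mult.commute)
  have "Min N \<le> d" using N by (intro Min_le) (auto simp: N_def)
  then have "z \<in> ?Z - {0}" using lt hk by (auto simp: z_def int_lattice_Pair int_lattice_real zero_prod_def)
  then have "\<bar>int_coord \<tau> z\<bar> \<in> N" by (auto simp: N_def)
  then have "Min N \<le> \<bar>int_coord \<tau> z\<bar>" using N by (intro Min_le) auto
  then show False using lt by simp
qed

text \<open>Infinitely many points of a line in one class of the lattice would have pairwise rational
  differences; the irrational projection turns this into a bound on their physical coordinate.\<close>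

lemma not_in_finite_lattice_union:
  fixes \<Lambda> :: "(real ^ 'n::finite) set"
  assumes irr: "\<tau> \<notin> \<rat>" and d: "d > 0" and v: "v \<noteq> 0"
    and sub: "\<And>z. z \<in> int_lattice \<Longrightarrow> \<bar>int_coord \<tau> z\<bar> < d \<Longrightarrow> phys \<tau> z *\<^sub>R v \<in> \<Lambda>"
  shows "\<not> (\<exists>L F. euclidean_lattice L \<and> finite F \<and> \<Lambda> \<subseteq> (\<Union>t\<in>F. (\<lambda>x. t + x) ` L))"
proof
  let ?Z = "{z \<in> (int_lattice :: (real \<times> real) set). \<bar>int_coord \<tau> z\<bar> < d}"
  assume "\<exists>L F. euclidean_lattice L \<and> finite F \<and> \<Lambda> \<subseteq> (\<Union>t\<in>F. (\<lambda>x. t + x) ` L)"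
  then obtain L F where L: "euclidean_lattice L" and F: "finite F" and cover: "\<Lambda> \<subseteq> (\<Union>t\<in>F. (\<lambda>x. t + x) ` L)"
    by blast
  obtain T :: "real ^ 'n \<Rightarrow> real ^ 'n" where T: "linear T" "bij T" "L = T ` {k. \<forall>i. k $ i \<in> \<int>}"
    using L unfolding euclidean_lattice_def by blast
  interpret T: linear T by fact
  have "\<forall>z\<in>?Z. \<exists>t\<in>F. phys \<tau> z *\<^sub>R v - t \<in> L"
  proof
    fix z assume "z \<in> ?Z"
    then have "phys \<tau> z *\<^sub>R v \<in> (\<Union>t\<in>F. (\<lambda>x. t + x) ` L)" using sub cover by blast
    then show "\<exists>t\<in>F. phys \<tau> z *\<^sub>R v - t \<in> L" by force
  qed
  \<comment> \<open>One translate receives infinitely many of the points, and differences of those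
    lie in \<open>L\<close> itself.\<close>
  from pigeonhole_infinite_rel[OF infinite_int_coord_small[OF irr d] F this]
  obtain t where "infinite {z \<in> ?Z. phys \<tau> z *\<^sub>R v - t \<in> L}" by blast
  define Y where "Y = {z \<in> ?Z. phys \<tau> z *\<^sub>R v - t \<in> L}"
  have Y: "infinite Y" unfolding Y_def by fact
  then obtain z0 where z0: "z0 \<in> Y" using infinite_imp_nonempty by blast
  have "infinite (Y - {z0})" using Y by simp
  then obtain z1 where z1: "z1 \<in> Y" "z1 \<noteq> z0" using infinite_imp_nonempty by blast
  define \<zeta> where "\<zeta> = z1 - z0"
  have coord: "\<exists>k. (\<forall>i. k $ i \<in> \<int>) \<and> T k = phys \<tau> (z - z0) *\<^sub>R v" if "z \<in> Y" for z
  proof -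
    have "phys \<tau> z *\<^sub>R v - t \<in> T ` {k. \<forall>i. k $ i \<in> \<int>}" "phys \<tau> z0 *\<^sub>R v - t \<in> T ` {k. \<forall>i. k $ i \<in> \<int>}"
      using that z0 unfolding Y_def T(3) by blast+
    then obtain k k0 where k: "k \<in> {k. \<forall>i. k $ i \<in> \<int>}" "phys \<tau> z *\<^sub>R v - t = T k"
      "k0 \<in> {k. \<forall>i. k $ i \<in> \<int>}" "phys \<tau> z0 *\<^sub>R v - t = T k0"
      by (elim imageE)
    have "T (k - k0) = (phys \<tau> z *\<^sub>R v - t) - (phys \<tau> z0 *\<^sub>R v - t)" by (simp only: T.diff k(2,4))
    also have "\<dots> = phys \<tau> (z - z0) *\<^sub>R v" by (simp add: phys_diff scaleR_diff_left)
    finally have "T (k - k0) = phys \<tau> (z - z0) *\<^sub>R v" .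
    then show ?thesis using k by (intro exI[of _ "k - k0"]) auto
  qed
  have \<zeta>: "\<zeta> \<in> int_lattice" "\<zeta> \<noteq> 0" using z0 z1 by (auto simp: \<zeta>_def Y_def intro: int_lattice_diff)
  have d1: "phys \<tau> \<zeta> \<noteq> 0"
    using inj_onD[OF inj_on_phys[OF irr], of \<zeta> 0] \<zeta> int_lattice_0 by (auto simp: phys_def)
  have i1: "int_coord \<tau> \<zeta> \<noteq> 0" using int_coord_real_eq_0[OF irr \<zeta>(1)] \<zeta>(2) by blast
  obtain k1 where k1: "\<forall>i. k1 $ i \<in> \<int>" "T k1 = phys \<tau> \<zeta> *\<^sub>R v" using coord[OF z1(1)] by (auto simp: \<zeta>_def)
  have "k1 \<noteq> 0" using k1(2) d1 v T.zero by auto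
  \<comment> \<open>Since \<open>T\<close> is injective, proportional vectors have proportional
    integer coordinates; coordinate \<open>i\<close> will give an integer relation between the
    physical coordinates of \<open>z - z0\<close> and of \<open>\<zeta>\<close>.\<close>
  then obtain i where i: "k1 $ i \<noteq> 0" by (auto simp: vec_eq_iff)
  have "norm (phys \<tau> (z - z0)) \<le> 2 * d * \<bar>phys \<tau> \<zeta>\<bar> / \<bar>int_coord \<tau> \<zeta>\<bar> \<and> norm (int_coord \<tau> (z - z0)) \<le> 2 * d"
    if z: "z \<in> Y" for z
  proof -
    obtain k where k: "\<forall>i. k $ i \<in> \<int>" "T k = phys \<tau> (z - z0) *\<^sub>R v" using coord[OF z] by blast
    have zl: "z - z0 \<in> int_lattice" using z z0 by (auto simp: Y_def intro: int_lattice_diff)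
    have "T (phys \<tau> (z - z0) *\<^sub>R k1) = T (phys \<tau> \<zeta> *\<^sub>R k)"
      by (simp add: T.scaleR k k1 mult.commute)
    then have "phys \<tau> (z - z0) *\<^sub>R k1 = phys \<tau> \<zeta> *\<^sub>R k" using T(2) by (auto dest: bij_is_inj injD)
    then have eq: "phys \<tau> (z - z0) * k1 $ i = phys \<tau> \<zeta> * k $ i" by (metis vector_scaleR_component real_scaleR_def)
    have mult: "(q *\<^sub>R w) \<in> int_lattice" if "q \<in> \<int>" "w \<in> int_lattice" for q and w :: "real \<times> real"
      using that by (cases w) (auto simp: int_lattice_Pair int_lattice_real)
    \<comment> \<open>Both sides are physical coordinates of lattice pairs, so injectivity of
      \<open>phys\<close> lifts the relation to the pairs and hence to the internal coordinates. As
      these are bounded, so are the physical ones.\<close>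
    have "phys \<tau> ((k1 $ i) *\<^sub>R (z - z0)) = phys \<tau> ((k $ i) *\<^sub>R \<zeta>)"
      using eq by (simp add: phys_def algebra_simps)
    then have "(k1 $ i) *\<^sub>R (z - z0) = (k $ i) *\<^sub>R \<zeta>"
      using inj_onD[OF inj_on_phys[OF irr]] mult zl \<zeta>(1) k(1) k1(1) by blast
    then have "int_coord \<tau> ((k1 $ i) *\<^sub>R (z - z0)) = int_coord \<tau> ((k $ i) *\<^sub>R \<zeta>)" by simp
    then have eqi: "k1 $ i * int_coord \<tau> (z - z0) = k $ i * int_coord \<tau> \<zeta>"
      by (simp add: int_coord_def algebra_simps)
    have le: "\<bar>int_coord \<tau> (z - z0)\<bar> \<le> 2 * d"
      using z z0 by (auto simp: Y_def int_coord_diff)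
    have "phys \<tau> (z - z0) * int_coord \<tau> \<zeta> * k1 $ i = int_coord \<tau> (z - z0) * phys \<tau> \<zeta> * k1 $ i"
      using eq eqi by algebra
    then have "phys \<tau> (z - z0) * int_coord \<tau> \<zeta> = int_coord \<tau> (z - z0) * phys \<tau> \<zeta>" using i by simp
    then have "\<bar>phys \<tau> (z - z0)\<bar> * \<bar>int_coord \<tau> \<zeta>\<bar> = \<bar>int_coord \<tau> (z - z0)\<bar> * \<bar>phys \<tau> \<zeta>\<bar>"
      by (metis abs_mult)
    also have "\<dots> \<le> 2 * d * \<bar>phys \<tau> \<zeta>\<bar>" using le by (rule mult_right_mono) simp
    finally have "\<bar>phys \<tau> (z - z0)\<bar> \<le> 2 * d * \<bar>phys \<tau> \<zeta>\<bar> / \<bar>int_coord \<tau> \<zeta>\<bar>"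
      using i1 by (simp add: le_divide_eq)
    then show ?thesis using le by simp
  qed
  then have "(\<lambda>z. z - z0) ` Y \<subseteq> {z \<in> int_lattice. norm (phys \<tau> z) \<le> 2 * d * \<bar>phys \<tau> \<zeta>\<bar> / \<bar>int_coord \<tau> \<zeta>\<bar>
      \<and> norm (int_coord \<tau> z) \<le> 2 * d}"
    using z0 by (auto simp: Y_def intro: int_lattice_diff)
  then have "finite ((\<lambda>z. z - z0) ` Y)" using finite_coord_window by (rule finite_subset)
  then have "finite Y" by (rule finite_imageD) (auto simp: inj_on_def)
  then show False using Y by simp
qed

text \<open>A one-dimensional gap clears a slab, because \<open>tensor_power\<close> vanishes as
  soon as one coordinate factor does; and inside any ball a slab orthogonal to a basis vector can be
  cleared.\<close>

lemma interior_closure_cp_support_empty: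
  fixes \<Phi> :: "real \<Rightarrow> real" and \<tau> r :: real
  defines "S \<equiv> cp_support \<tau> (\<lambda>z. complex_of_real (tensor_power \<Phi> (int_coord \<tau> z /\<^sub>R (1 + \<tau>\<^sup>2)) / r)) (1 / (1 + \<tau>\<^sup>2))
     :: 'a::euclidean_space set"
  assumes gaps: "\<And>a b. a < b \<Longrightarrow> \<exists>a' b'. a \<le> a' \<and> a' < b' \<and> b' \<le> b \<and>
       (\<forall>z\<in>int_lattice. a' < phys \<tau> z / (1 + \<tau>\<^sup>2) \<and> phys \<tau> z / (1 + \<tau>\<^sup>2) < b' \<longrightarrow>
          \<Phi> (int_coord \<tau> z / (1 + \<tau>\<^sup>2)) = 0)"
  shows "interior (closure S) = {}"
proof (rule ccontr)
  assume "interior (closure S) \<noteq> {}"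
  then obtain x e where e: "e > 0" "ball x e \<subseteq> closure S" by (auto simp: mem_interior)
  obtain b :: 'a where b: "b \<in> Basis" using nonempty_Basis by blast
  obtain l u where lu: "x \<bullet> b - e / 2 \<le> l" "l < u" "u \<le> x \<bullet> b + e / 2"
    and gap: "\<And>z. z \<in> int_lattice \<Longrightarrow> l < phys \<tau> z / (1 + \<tau>\<^sup>2) \<Longrightarrow> phys \<tau> z / (1 + \<tau>\<^sup>2) < u \<Longrightarrow>
          \<Phi> (int_coord \<tau> z / (1 + \<tau>\<^sup>2)) = 0"
    using gaps[of "x \<bullet> b - e / 2" "x \<bullet> b + e / 2"] e(1) by auto
  define Q where "Q = {y. l < y \<bullet> b} \<inter> {y. y \<bullet> b < u}"
  have Q: "open Q" unfolding Q_def by (intro open_Int open_Collect_less continuous_intros)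
  have "Q \<inter> S = {}"
  proof (safe)
    fix y assume y: "y \<in> Q" "y \<in> S"
    then obtain z where z: "z \<in> int_lattice" "y = (1 / (1 + \<tau>\<^sup>2)) *\<^sub>R phys \<tau> z"
      "tensor_power \<Phi> (int_coord \<tau> z /\<^sub>R (1 + \<tau>\<^sup>2)) \<noteq> 0"
      by (auto simp: S_def cp_support_def)
    \<comment> \<open>Coordinate \<open>b\<close> of a lattice pair is a lattice pair of the
      one-dimensional scheme, for which the gap is known.\<close>
    define w where "w = (fst z \<bullet> b, snd z \<bullet> b)"
    have "w \<in> int_lattice" using z(1) b
      by (cases z) (auto simp: w_def int_lattice_Pair int_lattice_real, auto simp: int_lattice_def)
    moreover have "y \<bullet> b = phys \<tau> w / (1 + \<tau>\<^sup>2)"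
      by (simp add: z(2) w_def phys_def inner_diff_left)
    ultimately have "\<Phi> (int_coord \<tau> w / (1 + \<tau>\<^sup>2)) = 0" using gap y by (auto simp: Q_def)
    moreover have "(int_coord \<tau> z /\<^sub>R (1 + \<tau>\<^sup>2)) \<bullet> b = int_coord \<tau> w / (1 + \<tau>\<^sup>2)"
      by (simp add: w_def int_coord_def inner_add_left divide_inverse mult.commute)
    ultimately have "tensor_power \<Phi> (int_coord \<tau> z /\<^sub>R (1 + \<tau>\<^sup>2)) = 0"
      unfolding tensor_power_def using b by (intro prod_zero bexI[of _ b]) auto
    with z(3) show "y \<in> {}" by simp
  qed
  then have "Q \<inter> closure S = {}" using open_Int_closure_eq_empty[OF Q] by blast
  moreover define y where "y = x + ((l / 2 + u / 2) - x \<bullet> b) *\<^sub>R b"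
  have "\<bar>(l / 2 + u / 2) - x \<bullet> b\<bar> < e" using lu e(1) by linarith
  then have "y \<in> ball x e" using b by (simp add: y_def dist_norm)
  then have "y \<in> closure S" using e(2) by blast
  moreover have "y \<in> Q" using b lu by (simp add: Q_def y_def inner_add_left)
  ultimately show False by blast
qed

theorem theorem2p4:
  shows "\<exists>(\<mu> :: (real ^ 'n::finite) set \<Rightarrow> complex) (\<Lambda> :: (real ^ 'n) set)
          (\<nu> :: (real ^ 'n) set \<Rightarrow> complex) (S :: (real ^ 'n) set).
      temperate_measure \<mu> \<and> positive_definite \<mu> \<and>
      discrete \<Lambda> \<and> atomic_on \<mu> \<Lambda> \<and>
      has_fourier_transform \<mu> \<nu> \<and>
      temperate_measure \<nu> \<and> countable S \<and> atomic_on \<nu> S \<and>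
      \<not> (\<exists>L F. euclidean_lattice L \<and> finite F \<and> \<Lambda> \<subseteq> (\<Union>t\<in>F. (\<lambda>x. t + x) ` L)) \<and>
      uniform_discrete {x - y | x y. x \<in> \<Lambda> \<and> y \<in> \<Lambda>} \<and>
      interior (closure S) = {}"
proof -
  \<comment> \<open>Any irrational number will do.\<close>
  obtain \<tau> :: real where irr: "\<tau> \<notin> \<rat>"
    using countable_rat uncountable_UNIV_real by (metis UNIV_eq_I)
  obtain \<Phi> :: "real \<Rightarrow> real" and K C where cont: "continuous_on UNIV \<Phi>" and nonneg: "\<And>t. 0 \<le> \<Phi> t"
    and le: "\<And>t. \<Phi> t \<le> K * (weight t)\<^sup>2" and pos: "\<Phi> 0 > 0" and band: "bandlimited C (\<lambda>t. of_real (\<Phi> t))"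
    and gaps: "\<And>a b. a < b \<Longrightarrow> \<exists>a' b'. a \<le> a' \<and> a' < b' \<and> b' \<le> b \<and>
       (\<forall>z\<in>int_lattice. a' < phys \<tau> z / (1 + \<tau>\<^sup>2) \<and> phys \<tau> z / (1 + \<tau>\<^sup>2) < b' \<longrightarrow>
          \<Phi> (int_coord \<tau> z / (1 + \<tau>\<^sup>2)) = 0)"
    by (rule exists_window[OF irr]) (rule that)
  define A where "A = (tensor_power \<Phi> :: real ^ 'n \<Rightarrow> real)"
  let ?f = "fourier (\<lambda>t. complex_of_real (\<Phi> t))"
  let ?F = "fourier (\<lambda>y. complex_of_real (A y))"
  have int: "integrable lborel (\<lambda>t. complex_of_real (\<Phi> t))" and fC: "\<And>x. C < \<bar>x\<bar> \<Longrightarrow> ?f x = 0"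
    using band by (auto simp: bandlimited_def)
  have F: "?F x = (\<Prod>b\<in>Basis. ?f (x \<bullet> b))" for x unfolding A_def by (rule fourier_tensor_power[OF int])
  have A1: "continuous_on UNIV A" unfolding A_def tensor_power_def[abs_def]
    by (intro continuous_intros continuous_on_compose2[OF cont]) auto
  have A2: "0 \<le> A y" for y unfolding A_def tensor_power_def by (intro prod_nonneg) (simp add: nonneg)
  have A3: "A y \<le> K ^ DIM(real ^ 'n) * (weight y)\<^sup>2" for y unfolding A_def by (rule tensor_power_le[OF nonneg le])
  have Fzero: "?F x = 0" if "b \<in> Basis" "C < \<bar>x \<bullet> b\<bar>" for x b
    unfolding F using that fC by (intro prod_zero bexI[of _ b]) auto
  have A4: "cmod (?F x) \<le> (1 + C\<^sup>2) ^ (2 * DIM(real ^ 'n)) * (\<integral>y. cmod (complex_of_real (A y)) \<partial>lborel) * (weight x)\<^sup>2" for x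
    by (rule weighted_bound_of_box_support[OF fourier_norm_le Fzero])
  define \<Lambda> where "\<Lambda> = cp_support \<tau> (\<lambda>z. ?F (int_coord \<tau> z)) 1"
  define S where "S = cp_support \<tau> (\<lambda>z. of_real (A (int_coord \<tau> z /\<^sub>R (1 + \<tau>\<^sup>2)) / (1 + \<tau>\<^sup>2) ^ DIM(real ^ 'n))) (1 / (1 + \<tau>\<^sup>2))"
  define \<mu> where "\<mu> = cp_measure \<tau> (\<lambda>z. ?F (int_coord \<tau> z)) 1"
  define \<nu> where "\<nu> = cp_measure \<tau> (\<lambda>z. of_real (A (int_coord \<tau> z /\<^sub>R (1 + \<tau>\<^sup>2)) / (1 + \<tau>\<^sup>2) ^ DIM(real ^ 'n))) (1 / (1 + \<tau>\<^sup>2))"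
  note pair = cp_fourier_pair[OF irr A1 A2 A3 A4, folded \<Lambda>_def S_def \<mu>_def \<nu>_def]
  \<comment> \<open>Where the transform is nonzero each coordinate is at most \<open>C\<close> in
    modulus; the sum norm brings in the dimension. Differences then need only the doubled
    bound.\<close>
  have window: "norm (int_coord \<tau> z) \<le> real DIM(real ^ 'n) * C" if "?F (int_coord \<tau> z) \<noteq> 0" for z
  proof -
    have "norm (int_coord \<tau> z) \<le> (\<Sum>b\<in>Basis. \<bar>int_coord \<tau> z \<bullet> b\<bar>)" by (rule norm_le_l1)
    also have "\<dots> \<le> (\<Sum>b\<in>(Basis :: (real ^ 'n) set). C)" using Fzero that by (intro sum_mono) (meson not_le)
    finally show ?thesis by simp
  qed
  have diff: "uniform_discrete {x - y | x y. x \<in> \<Lambda> \<and> y \<in> \<Lambda>}"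
  proof (rule uniform_discrete_phys_window)
    fix d assume "d \<in> {x - y | x y. x \<in> \<Lambda> \<and> y \<in> \<Lambda>}"
    then obtain z w where z: "z \<in> int_lattice" "?F (int_coord \<tau> z) \<noteq> 0" and w: "w \<in> int_lattice" "?F (int_coord \<tau> w) \<noteq> 0"
      and d: "d = phys \<tau> z - phys \<tau> w" by (auto simp: \<Lambda>_def cp_support_def)
    show "\<exists>z\<in>int_lattice. d = phys \<tau> z \<and> norm (int_coord \<tau> z) \<le> 2 * (real DIM(real ^ 'n) * C)"
    proof (intro bexI[of _ "z - w"] conjI)
      show "norm (int_coord \<tau> (z - w)) \<le> 2 * (real DIM(real ^ 'n) * C)"
        using window[OF z(2)] window[OF w(2)] norm_triangle_ineq4[of "int_coord \<tau> z" "int_coord \<tau> w"]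
        unfolding int_coord_diff by linarith
    qed (use z w d in \<open>auto simp: phys_diff intro: int_lattice_diff\<close>)
  qed
  \<comment> \<open>The value at 0 is the integral of a nonnegative continuous function that is
    positive at 0. By continuity the transform is nonzero near 0, which will put an infinite family
    of collinear points into \<open>\<Lambda>\<close>.\<close>
  have f0: "?f 0 \<noteq> 0"
  proof -
    have "integrable lborel \<Phi>" using int by (simp only: complex_of_real_integrable_eq)
    then have "(\<integral>t. \<Phi> t \<partial>lborel) > 0" by (intro integral_pos_continuous cont nonneg pos)
    then show ?thesis by (simp add: fourier_chi)
  qed
  have "isCont ?f 0" using continuous_on_fourier[OF int, of UNIV] by (simp add: continuous_on_eq_continuous_at)
  then have "\<forall>\<^sub>F x in at 0. ?f x \<noteq> 0" using f0 unfolding isCont_def by (rule tendsto_imp_eventually_ne)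
  then obtain d where d: "d > 0" "\<And>x. x \<noteq> 0 \<Longrightarrow> \<bar>x\<bar> < d \<Longrightarrow> ?f x \<noteq> 0"
    by (auto simp: eventually_at dist_real_def)
  have fd: "?f x \<noteq> 0" if "\<bar>x\<bar> < d" for x using d(2)[of x] that f0 by (cases "x = 0") auto
  obtain b :: "real ^ 'n" where b: "b \<in> Basis" using nonempty_Basis by blast
  have nolat: "\<not> (\<exists>L F. euclidean_lattice L \<and> finite F \<and> \<Lambda> \<subseteq> (\<Union>t\<in>F. (\<lambda>x. t + x) ` L))"
  proof (rule not_in_finite_lattice_union[OF irr d(1)])
    show "b \<noteq> 0" using b by auto
    fix z :: "real \<times> real" assume z: "z \<in> int_lattice" "\<bar>int_coord \<tau> z\<bar> < d"
    \<comment> \<open>Places the one-dimensional scheme on the axis spanned by \<open>b\<close>; the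
      remaining factors of the transform are all \<open>?f 0\<close>.\<close>
    define w where "w = (fst z *\<^sub>R b, snd z *\<^sub>R b)"
    have "w \<in> int_lattice" using z(1) b
      by (cases z) (auto simp: w_def int_lattice_Pair int_lattice_real, auto simp: int_lattice_def inner_Basis)
    moreover have "int_coord \<tau> w = int_coord \<tau> z *\<^sub>R b" "phys \<tau> w = phys \<tau> z *\<^sub>R b"
      by (simp_all add: w_def int_coord_def phys_def algebra_simps)
    moreover have "?F (int_coord \<tau> z *\<^sub>R b) \<noteq> 0"
      unfolding F using fd[OF z(2)] f0 b by (auto simp: inner_Basis)
    ultimately show "phys \<tau> z *\<^sub>R b \<in> \<Lambda>"
      unfolding \<Lambda>_def cp_support_def by (intro image_eqI[of _ _ w]) auto
  qed
  have nowhere: "interior (closure S) = {}"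
    unfolding S_def A_def by (rule interior_closure_cp_support_empty[OF gaps])
  have discrete: "discrete \<Lambda>"
    by (rule uniform_discrete_imp_discrete[OF uniform_discrete_of_differences[OF diff]])
  show ?thesis
  proof (rule exI[of _ \<mu>], rule exI[of _ \<Lambda>], rule exI[of _ \<nu>], rule exI[of _ S], intro conjI)
    show "temperate_measure \<mu>" by (fact pair(1))
    show "positive_definite \<mu>" by (fact pair(7))
    show "atomic_on \<mu> \<Lambda>" by (fact pair(2))
    show "has_fourier_transform \<mu> \<nu>" by (fact pair(6))
    show "temperate_measure \<nu>" by (fact pair(3))
    show "countable S" by (fact pair(5))
    show "atomic_on \<nu> S" by (fact pair(4))
  qed (fact discrete nolat diff nowhere)+
qed

end
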